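(* Let $T>0$, let $\Omega\subset\mathbb R^3$ be a bounded open domain with boundary of class $\mathcal C^2$, let $\mathbf u_{\mathrm{init}}\in L^2(\Omega)$ and $\mathbf f\in L^{\frac32}(0,T;W^{-1,\frac32}(\Omega))$ (both $\mathbb R^3$-valued). If $(\mathbf u,p,\boldsymbol\sigma)$ is a weak solution in the sense defined in the context, then the relations $$\boldsymbol\sigma:\mathbf S\mathbf u=2p|\mathbf S\mathbf u|, \quad |\boldsymbol\sigma| \leq p, \quad \boldsymbol\sigma=\boldsymbol\sigma^{\intercal} \quad\text{and}\quad \mathrm{tr}\, \boldsymbol\sigma=0$$ are satisfied almost everywhere in $(0,T)\times\Omega$.
   Context: Notation. For a vector field $\mathbf u$ on $\Omega\subset\mathbb R^3$: $\mathbf D\mathbf u=\frac12(\nabla\mathbf u+(\nabla\mathbf u)^{\intercal})$ and $\mathbf S\mathbf u=\mathbf D\mathbf u-\frac13(\mathrm{div}\,\mathbf u)\mathbf I_3$. For $3\times3$ matrices, $\mathbf A:\mathbf B=\mathrm{tr}(\mathbf A^{\intercal}\mathbf B)$ and the norm is normalized by $|\mathbf A|^2=\frac12\mathbf A:\mathbf A$. For vectors $|\cdot|$ is the Euclidean norm. $W^{-1,\frac32}(\Omega)$ is the dual of $W^{1,3}_0(\Omega)$ and $\langle\cdot,\cdot\rangle$ is the duality bracket. The same symbols for function spaces are used for scalar-, vector- and matrix-valued functions. Weak solution. $(\mathbf u,p,\boldsymbol\sigma)$ is a weak solution (with data $\mathbf u_{\mathrm{init}},\mathbf f$) if - $\mathbf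 u \in L^\infty(0,T;L^2(\Omega))\cap L^3(0,T;W_0^{1,3}(\Omega))$ and $\partial_t \mathbf u \in L^{\frac32}(0,T;W^{-1,\frac32}(\Omega))$ (hence $\mathbf u\in C([0,T];L^2(\Omega))$); - $p \in L^{\frac32}((0,T)\times \Omega)$ with $p\geq 0$ a.e.; - $\boldsymbol\sigma \in L^{\frac32}((0,T)\times \Omega)$ with $|\boldsymbol\sigma|\leq p$, $\boldsymbol\sigma=\boldsymbol\sigma^{\intercal}$ and $\mathrm{tr}\,\boldsymbol\sigma=0$ a.e.; - for all $\boldsymbol\varphi\in L^3(0,T;W_0^{1,3}(\Omega))$ and all $\psi\in L^{\frac32}((0,T)\times \Omega)$, for a.e. $t\in(0,T)$, $$\langle \partial_t \mathbf u , \boldsymbol\varphi \rangle - \int_\Omega p\, \mathrm{div}\, \boldsymbol\varphi + \int_\Omega 2|\mathbf D\mathbf u|\mathbf D\mathbf u:\mathbf D\boldsymbol\varphi + \int_\Omega \boldsymbol\sigma:\mathbf S\boldsymbol\varphi = \langle \mathbf f , \boldsymbol\varphi \rangle,$$ $$\int_\Omega \psi \, \mathrm{div}\, \mathbf u - \int_\Omega 2\psi |\mathbf S\mathbf u| + \int_\Omega \psi \sqrt{p} = 0;$$ - the energy inequality $$\frac{1}{2}\int_\Omega |\mathbf u(T)|^2 + 4 \int_0^T\int_\Omega |\mathbf D\mathbf u|^3 + \int_0^T\int_\Omega |p|^{\frac32} \leq \frac{1}{2}\int_\Omega |\mathbf u_{\mathrm{init}}|^2 + \int_0^T \langle \mathbf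 f , \mathbf u \rangle$$ holds; - $\mathbf u|_{t=0}=\mathbf u_{\mathrm{init}}$ in $L^2(\Omega)$. *)

theory Defs
  imports "HOL-Analysis.Analysis"
begin

section \<open>Functions of class $C^k$ and domains with $C^2$ boundary\<close>

primrec C_k :: "nat \<Rightarrow> ('a::euclidean_space \<Rightarrow> 'b::real_normed_vector) \<Rightarrow> bool" where
  "C_k 0 f \<longleftrightarrow> continuous_on UNIV f"
| "C_k (Suc k) f \<longleftrightarrow>
     (\<forall>x. f differentiable (at x)) \<and> (\<forall>b\<in>Basis. C_k k (\<lambda>x. frechet_derivative f (at x) b))"

definition test_functions :: "'a::euclidean_space set \<Rightarrow> ('a \<Rightarrow> 'b::real_normed_vector) set" where
  "test_functions \<Omega> = {\<phi>. (\<forall>k. C_k k \<phi>) \<and> compact (closure {x. \<phi> x \<noteq> 0}) \<and> closure {x. \<phi> x \<noteq> 0} \<subseteq> \<Omega>}"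

text \<open>Near each boundary point, \<open>\<Omega>\<close> is, in suitably rotated or reflected Cartesian coordinates,
  the region strictly above the graph of a $C^2$ function.\<close>

definition C2_boundary :: "(real^3) set \<Rightarrow> bool" where
  "C2_boundary \<Omega> \<longleftrightarrow>
     (\<forall>x\<in>frontier \<Omega>. \<exists>r>0. \<exists>R :: real^3 \<Rightarrow> real^3. \<exists>\<gamma> :: real^2 \<Rightarrow> real.
        orthogonal_transformation R \<and> C_k 2 \<gamma> \<and>
        \<Omega> \<inter> ball x r = {y \<in> ball x r. \<gamma> (vector [R y $ 1, R y $ 2]) < R y $ 3})"

section \<open>Matrices\<close>

definition frob :: "real^3^3 \<Rightarrow> real^3^3 \<Rightarrow> real" where
  "frob A B = trace (transpose A ** B)"

text \<open>The normalisation is $|A|^2 = \frac12 A:A$, so this differs from the library's \<^const>\<open>norm\<close>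
  by the factor $\sqrt2$.\<close>

definition mnorm :: "real^3^3 \<Rightarrow> real" where
  "mnorm A = sqrt (1/2 * frob A A)"

text \<open>If \<open>G\<close> is the gradient of a vector field at a point, its divergence there is \<open>trace G\<close>,
  and the following give its symmetric gradient and the deviatoric part of it.\<close>

definition sym_part :: "real^3^3 \<Rightarrow> real^3^3" where
  "sym_part G = (1/2) *\<^sub>R (G + transpose G)"

definition dev_part :: "real^3^3 \<Rightarrow> real^3^3" where
  "dev_part G = sym_part G - (1/3 * trace G) *\<^sub>R mat 1"

section \<open>Lebesgue and Sobolev spaces\<close>

text \<open>Elements of function spaces are represented by functions; functions that agree almost
  everywhere on the domain are not identified, so the norms below are seminorms. The values of
  these functions outside the domain are irrelevant.\<close>

definition Lp :: "real \<Rightarrow> 'a::euclidean_space set \<Rightarrow> ('a \<Rightarrow> 'b::euclidean_space) set" where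
  "Lp q S = {f. f \<in> borel_measurable (lebesgue_on S) \<and>
                integrable (lebesgue_on S) (\<lambda>x. norm (f x) powr q)}"

definition Lp_norm :: "real \<Rightarrow> 'a::euclidean_space set \<Rightarrow> ('a \<Rightarrow> 'b::euclidean_space) \<Rightarrow> real" where
  "Lp_norm q S f = (LINT x|lebesgue_on S. norm (f x) powr q) powr (1/q)"

definition is_weak_gradient :: "(real^3) set \<Rightarrow> (real^3 \<Rightarrow> real^3) \<Rightarrow> (real^3 \<Rightarrow> real^3^3) \<Rightarrow> bool" where
  "is_weak_gradient \<Omega> u G \<longleftrightarrow>
     (\<forall>K. compact K \<and> K \<subseteq> \<Omega> \<longrightarrow> integrable (lebesgue_on K) u \<and> integrable (lebesgue_on K) G) \<and>
     (\<forall>\<phi>\<in>test_functions \<Omega>. \<forall>i j.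
        (LINT x|lebesgue_on \<Omega>. u x $ i * frechet_derivative \<phi> (at x) (axis j 1)) =
        - (LINT x|lebesgue_on \<Omega>. G x $ i $ j * \<phi> x))"

text \<open>The weak gradient is determined up to null sets.\<close>

definition weak_grad :: "(real^3) set \<Rightarrow> (real^3 \<Rightarrow> real^3) \<Rightarrow> real^3 \<Rightarrow> real^3^3" where
  "weak_grad \<Omega> u = (SOME G. is_weak_gradient \<Omega> u G)"

definition W1 :: "real \<Rightarrow> (real^3) set \<Rightarrow> (real^3 \<Rightarrow> real^3) set" where
  "W1 q \<Omega> = {u \<in> Lp q \<Omega>. \<exists>G\<in>Lp q \<Omega>. is_weak_gradient \<Omega> u G}"

definition W1_norm :: "real \<Rightarrow> (real^3) set \<Rightarrow> (real^3 \<Rightarrow> real^3) \<Rightarrow> real" where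
  "W1_norm q \<Omega> u =
     ((LINT x|lebesgue_on \<Omega>. norm (u x) powr q) +
      (LINT x|lebesgue_on \<Omega>. norm (weak_grad \<Omega> u x) powr q)) powr (1/q)"

definition W1_0 :: "real \<Rightarrow> (real^3) set \<Rightarrow> (real^3 \<Rightarrow> real^3) set" where
  "W1_0 q \<Omega> = {u \<in> W1 q \<Omega>. \<exists>\<phi>. (\<forall>n. \<phi> n \<in> test_functions \<Omega>) \<and>
                               (\<lambda>n::nat. W1_norm q \<Omega> (\<phi> n - u)) \<longlonglongrightarrow> 0}"

text \<open>The dual of \<open>W1_0 q \<Omega>\<close>, that is $W^{-1,q'}(\Omega)$ with $q'$ the conjugate exponent of $q$.
  The duality bracket is function application; values of a functional outside \<open>W1_0 q \<Omega>\<close>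
  are irrelevant.\<close>

definition W1_0_dual :: "real \<Rightarrow> (real^3) set \<Rightarrow> ((real^3 \<Rightarrow> real^3) \<Rightarrow> real) set" where
  "W1_0_dual q \<Omega> = {l.
     (\<forall>v\<in>W1_0 q \<Omega>. \<forall>w\<in>W1_0 q \<Omega>. \<forall>a b. l (\<lambda>x. a *\<^sub>R v x + b *\<^sub>R w x) = a * l v + b * l w) \<and>
     (\<exists>C. \<forall>v\<in>W1_0 q \<Omega>. \<bar>l v\<bar> \<le> C * W1_norm q \<Omega> v)}"

definition W1_0_dual_norm :: "real \<Rightarrow> (real^3) set \<Rightarrow> ((real^3 \<Rightarrow> real^3) \<Rightarrow> real) \<Rightarrow> real" where
  "W1_0_dual_norm q \<Omega> l = Sup {\<bar>l v\<bar> | v. v \<in> W1_0 q \<Omega> \<and> W1_norm q \<Omega> v \<le> 1}"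

section \<open>Spaces of functions of time\<close>

text \<open>The target space is given by its carrier \<open>X\<close> and its (semi)norm \<open>N\<close>. Strong (Bochner)
  measurability is approximation almost everywhere by simple functions.\<close>

definition strongly_measurable ::
  "'t measure \<Rightarrow> 'v set \<Rightarrow> ('v::minus \<Rightarrow> real) \<Rightarrow> ('t \<Rightarrow> 'v) \<Rightarrow> bool" where
  "strongly_measurable M X N u \<longleftrightarrow>
     (\<exists>s. (\<forall>n. simple_function M (s n) \<and> s n ` space M \<subseteq> X) \<and>
          (AE t in M. (\<lambda>n::nat. N (s n t - u t)) \<longlonglongrightarrow> 0))"

definition bochner_Lp ::
  "real \<Rightarrow> 't measure \<Rightarrow> 'v set \<Rightarrow> ('v::minus \<Rightarrow> real) \<Rightarrow> ('t \<Rightarrow> 'v) set" where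
  "bochner_Lp q M X N = {u. (AE t in M. u t \<in> X) \<and> strongly_measurable M X N u \<and>
                            integrable M (\<lambda>t. N (u t) powr q)}"

definition bochner_Linf ::
  "'t measure \<Rightarrow> 'v set \<Rightarrow> ('v::minus \<Rightarrow> real) \<Rightarrow> ('t \<Rightarrow> 'v) set" where
  "bochner_Linf M X N = {u. (AE t in M. u t \<in> X) \<and> strongly_measurable M X N u \<and>
                            (\<exists>C. AE t in M. N (u t) \<le> C)}"

abbreviation Linf_L2 :: "real \<Rightarrow> (real^3) set \<Rightarrow> (real \<Rightarrow> real^3 \<Rightarrow> real^3) set" where
  "Linf_L2 T \<Omega> \<equiv> bochner_Linf (lebesgue_on {0<..<T}) (Lp 2 \<Omega>) (Lp_norm 2 \<Omega>)"

abbreviation L3_W1_0 :: "real \<Rightarrow> (real^3) set \<Rightarrow> (real \<Rightarrow> real^3 \<Rightarrow> real^3) set" where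
  "L3_W1_0 T \<Omega> \<equiv> bochner_Lp 3 (lebesgue_on {0<..<T}) (W1_0 3 \<Omega>) (W1_norm 3 \<Omega>)"

abbreviation L32_dual :: "real \<Rightarrow> (real^3) set \<Rightarrow> (real \<Rightarrow> (real^3 \<Rightarrow> real^3) \<Rightarrow> real) set" where
  "L32_dual T \<Omega> \<equiv>
     bochner_Lp (3/2) (lebesgue_on {0<..<T}) (W1_0_dual 3 \<Omega>) (W1_0_dual_norm 3 \<Omega>)"

text \<open>\<open>g\<close> is the distributional time derivative of \<open>u\<close>, where \<open>u t\<close> acts on \<open>v\<close> through the
  $L^2$ inner product: $\int_0^T u\,\eta'\,dt = -\int_0^T g\,\eta\,dt$ as an identity of functionals,
  i.e. tested against every \<open>v\<close>.\<close>

definition is_time_derivative ::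
  "real \<Rightarrow> (real^3) set \<Rightarrow> (real \<Rightarrow> real^3 \<Rightarrow> real^3) \<Rightarrow> (real \<Rightarrow> (real^3 \<Rightarrow> real^3) \<Rightarrow> real) \<Rightarrow> bool" where
  "is_time_derivative T \<Omega> u g \<longleftrightarrow>
     (\<forall>\<eta>\<in>test_functions {0<..<T}. \<forall>v\<in>W1_0 3 \<Omega>.
        (LINT t|lebesgue_on {0<..<T}. (LINT x|lebesgue_on \<Omega>. u t x \<bullet> v x) * deriv \<eta> t) =
        - (LINT t|lebesgue_on {0<..<T}. g t v * \<eta> t))"

text \<open>The representative of \<open>u\<close> in $C([0,T];L^2(\Omega))$, which gives meaning to \<open>u\<close> at
  individual times.\<close>

definition continuous_L2_rep ::
  "real \<Rightarrow> (real^3) set \<Rightarrow> (real \<Rightarrow> real^3 \<Rightarrow> real^3) \<Rightarrow> (real \<Rightarrow> real^3 \<Rightarrow> real^3) \<Rightarrow> bool" where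
  "continuous_L2_rep T \<Omega> u v \<longleftrightarrow>
     (\<forall>t\<in>{0..T}. v t \<in> Lp 2 \<Omega>) \<and>
     (\<forall>t\<in>{0..T}. ((\<lambda>s. Lp_norm 2 \<Omega> (v s - v t)) \<longlongrightarrow> 0) (at t within {0..T})) \<and>
     (AE t in lebesgue_on {0<..<T}. AE x in lebesgue_on \<Omega>. v t x = u t x)"

text \<open>A representative of the spatial gradient of \<open>u\<close> as a measurable function on
  $(0,T)\times\Omega$. Choosing \<open>weak_grad \<Omega> (u t)\<close> for each \<open>t\<close> separately need not give a
  function that is jointly measurable, so statements almost everywhere in
  $(0,T)\times\Omega$ have to refer to such a representative.\<close>

definition is_spacetime_gradient ::
  "real \<Rightarrow> (real^3) set \<Rightarrow> (real \<Rightarrow> real^3 \<Rightarrow> real^3) \<Rightarrow> (real \<Rightarrow> real^3 \<Rightarrow> real^3^3) \<Rightarrow> bool" where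
  "is_spacetime_gradient T \<Omega> u G \<longleftrightarrow>
     (\<lambda>(t, x). G t x) \<in> borel_measurable (lebesgue_on ({0<..<T} \<times> \<Omega>)) \<and>
     (AE t in lebesgue_on {0<..<T}. is_weak_gradient \<Omega> (u t) (G t))"

section \<open>Weak solutions\<close>

definition weak_solution ::
  "real \<Rightarrow> (real^3) set \<Rightarrow> (real^3 \<Rightarrow> real^3) \<Rightarrow> (real \<Rightarrow> (real^3 \<Rightarrow> real^3) \<Rightarrow> real) \<Rightarrow>
   (real \<Rightarrow> real^3 \<Rightarrow> real^3) \<Rightarrow> (real \<Rightarrow> real^3 \<Rightarrow> real) \<Rightarrow> (real \<Rightarrow> real^3 \<Rightarrow> real^3^3) \<Rightarrow> bool" where
  "weak_solution T \<Omega> u_init f u p \<sigma> \<longleftrightarrow>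
     u \<in> Linf_L2 T \<Omega> \<and> u \<in> L3_W1_0 T \<Omega> \<and>
     (\<lambda>(t, x). p t x) \<in> Lp (3/2) ({0<..<T} \<times> \<Omega>) \<and>
     (AE (t, x) in lebesgue_on ({0<..<T} \<times> \<Omega>). p t x \<ge> 0) \<and>
     (\<lambda>(t, x). \<sigma> t x) \<in> Lp (3/2) ({0<..<T} \<times> \<Omega>) \<and>
     (AE (t, x) in lebesgue_on ({0<..<T} \<times> \<Omega>).
        mnorm (\<sigma> t x) \<le> p t x \<and> \<sigma> t x = transpose (\<sigma> t x) \<and> trace (\<sigma> t x) = 0) \<and>
     (\<exists>du\<in>L32_dual T \<Omega>. is_time_derivative T \<Omega> u du \<and>
        (\<forall>\<phi>\<in>L3_W1_0 T \<Omega>. \<forall>\<psi>. (\<lambda>(t, x). \<psi> t x) \<in> Lp (3/2) ({0<..<T} \<times> \<Omega>) \<longrightarrow>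
           (AE t in lebesgue_on {0<..<T}.
              du t (\<phi> t)
              - (LINT x|lebesgue_on \<Omega>. p t x * trace (weak_grad \<Omega> (\<phi> t) x))
              + (LINT x|lebesgue_on \<Omega>. 2 * mnorm (sym_part (weak_grad \<Omega> (u t) x)) *
                   frob (sym_part (weak_grad \<Omega> (u t) x)) (sym_part (weak_grad \<Omega> (\<phi> t) x)))
              + (LINT x|lebesgue_on \<Omega>. frob (\<sigma> t x) (dev_part (weak_grad \<Omega> (\<phi> t) x)))
              = f t (\<phi> t) \<and>
              (LINT x|lebesgue_on \<Omega>. \<psi> t x * trace (weak_grad \<Omega> (u t) x))
              - (LINT x|lebesgue_on \<Omega>. 2 * \<psi> t x * mnorm (dev_part (weak_grad \<Omega> (u t) x)))
              + (LINT x|lebesgue_on \<Omega>. \<psi> t x * sqrt (p t x)) = 0))) \<and>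
     (\<exists>v. continuous_L2_rep T \<Omega> u v \<and>
        (AE x in lebesgue_on \<Omega>. v 0 x = u_init x) \<and>
        1/2 * (LINT x|lebesgue_on \<Omega>. (norm (v T x))\<^sup>2)
        + 4 * (LINT t|lebesgue_on {0<..<T}. LINT x|lebesgue_on \<Omega>.
                 mnorm (sym_part (weak_grad \<Omega> (u t) x)) ^ 3)
        + (LINT t|lebesgue_on {0<..<T}. LINT x|lebesgue_on \<Omega>. \<bar>p t x\<bar> powr (3/2))
        \<le> 1/2 * (LINT x|lebesgue_on \<Omega>. (norm (u_init x))\<^sup>2)
        + (LINT t|lebesgue_on {0<..<T}. f t (u t)))"

end

theory Submission
  imports Defs
begin

text \<open>Test the momentum equation with \<open>u\<close>, the constitutive equation with \<open>p\<close>, and add. The terms with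
  the divergence cancel, and what remains is
  \[ \langle\partial_t u, u\rangle + 4\int|Du|^3 + \int p^{3/2}
     = \langle f, u\rangle + \int (2p|Su| - \sigma:Su). \]
  Cauchy-Schwarz for matrices gives $\sigma:Su \le 2|\sigma||Su| \le 2p|Su|$, so the last integrand is nonnegative.
  Integrated over time and compared with the energy inequality, the identity bounds its space-time integral by
  \[ \int_0^T\langle\partial_t u, u\rangle - \Big(\frac12\int|u(T)|^2 - \frac12\int|u_{init}|^2\Big). \]
  Once this is known to be at most 0, the nonnegative integrand vanishes almost everywhere, which is the claim.

  The heart of the matter is thus one half of the chain rule for the kinetic energy, lemma
  \<open>time_derivative_energy\<close>. Let \<open>v\<close> be the continuous representative of \<open>u\<close>. Dropping a square,
  \[ \frac12\int|v(t+h)|^2 - \frac12\int|v(t)|^2 \ge (v(t+h) - v(t), v(t))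
     = \int_t^{t+h}\langle\partial_t u(\tau), u(t)\rangle\,d\tau . \]
  Dividing by $h$, integrating over $t$ and letting $h$ tend to 0 yields the inequality
  (\<open>energy_gain\<close>). For the right-hand side, $u$ is approximated in $L^3(0,T;W^{1,3}_0)$ by simple
  functions; each of their values leaves a scalar function of $\tau$, whose averages over short intervals
  converge weakly (\<open>integral_diff_quot_primitive_tendsto\<close>), and Young's inequality controls the error.
  The equality in the display comes from testing the distributional time derivative with smooth functions that
  approach the indicator of an interval (\<open>weak_derivative_increment\<close>).

  All of this uses that the function spaces behave as expected. Smooth bumps give the fundamental lemma of the
  calculus of variations, hence uniqueness of weak gradients; so \<^const>\<open>W1_norm\<close> is a seminorm, \<open>W1_0\<close>
  is closed under linear combinations, and $|\langle l, v\rangle| \le \|l\|\,\|v\|$ (\<open>W1_0_seminormed\<close>,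
  \<open>dual_norm_bound\<close>). Fubini's theorem for the completed Lebesgue measure passes between integrals over
  space-time and iterated ones, the given gradient \<open>G\<close> standing for the gradients at single times.\<close>

section \<open>Smooth bump functions\<close>

lemma C_k_cong: "C_k k f \<Longrightarrow> f = g \<Longrightarrow> C_k k g" by simp

lemma C_k_imp_continuous: "C_k k f \<Longrightarrow> continuous_on UNIV f"
proof (cases k)
  case (Suc n)
  assume "C_k k f"
  then show ?thesis
    using Suc by (auto simp: continuous_on_eq_continuous_at intro: differentiable_imp_continuous_within)
qed simp

lemma C_k_lower: "C_k (Suc k) f \<Longrightarrow> C_k k f"
proof (induction k arbitrary: f)
  case 0
  then show ?case using C_k_imp_continuous by fastforce
next
  case (Suc k)
  then show ?case by (metis C_k.simps(2))
qed

lemma C_k_const: "C_k k (\<lambda>x. c)"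
  by (induction k arbitrary: c) (simp_all add: frechet_derivative_const)

lemma C_k_add: "C_k k f \<Longrightarrow> C_k k g \<Longrightarrow> C_k k (\<lambda>x. f x + g x)"
proof (induction k arbitrary: f g)
  case 0
  then show ?case by (simp add: continuous_on_add)
next
  case (Suc k)
  have d: "((\<lambda>x. f x + g x) has_derivative
      (\<lambda>h. frechet_derivative f (at x) h + frechet_derivative g (at x) h)) (at x)" for x
    using Suc.prems by (intro has_derivative_add) (simp_all add: frechet_derivative_works)
  have "frechet_derivative (\<lambda>x. f x + g x) (at x) =
      (\<lambda>h. frechet_derivative f (at x) h + frechet_derivative g (at x) h)" for x
    by (rule frechet_derivative_at[OF d, symmetric])
  with Suc d show ?case by (auto simp: differentiable_def)
qed

lemma C_k_linear:
  assumes "bounded_linear L"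
  shows "C_k k f \<Longrightarrow> C_k k (\<lambda>x. L (f x))"
proof (induction k arbitrary: f)
  case 0
  then show ?case using assms by (simp add: bounded_linear.continuous_on)
next
  case (Suc k)
  have d: "((\<lambda>x. L (f x)) has_derivative (\<lambda>h. L (frechet_derivative f (at x) h))) (at x)" for x
    using Suc.prems by (intro bounded_linear.has_derivative[OF assms])
      (simp add: frechet_derivative_works)
  then have "frechet_derivative (\<lambda>x. L (f x)) (at x) b = L (frechet_derivative f (at x) b)" for x b
    by (simp add: frechet_derivative_at[OF d, symmetric])
  with Suc d show ?case by (auto simp: differentiable_def)
qed

lemma C_k_mult:
  fixes f g :: "'a::euclidean_space \<Rightarrow> real"
  shows "C_k k f \<Longrightarrow> C_k k g \<Longrightarrow> C_k k (\<lambda>x. f x * g x)"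
proof (induction k arbitrary: f g)
  case 0
  then show ?case by (simp add: continuous_on_mult)
next
  case (Suc k)
  have d: "((\<lambda>x. f x * g x) has_derivative
      (\<lambda>h. f x * frechet_derivative g (at x) h + frechet_derivative f (at x) h * g x)) (at x)" for x
    using Suc.prems by (intro has_derivative_mult) (simp_all add: frechet_derivative_works)
  have e: "frechet_derivative (\<lambda>x. f x * g x) (at x) =
     (\<lambda>b. f x * frechet_derivative g (at x) b + frechet_derivative f (at x) b * g x)" for x
    by (rule frechet_derivative_at[OF d, symmetric])
  have "C_k k f" "C_k k g" using Suc.prems C_k_lower by blast+
  with Suc.prems have "C_k k (\<lambda>x. f x * frechet_derivative g (at x) b + frechet_derivative f (at x) b * g x)"
    if "b \<in> Basis" for b
    using that by (intro C_k_add Suc.IH) simp_all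
  with d show ?case by (auto simp: differentiable_def e)
qed

lemma C_k_prod:
  fixes f :: "'i \<Rightarrow> 'a::euclidean_space \<Rightarrow> real"
  assumes "\<And>i. i \<in> I \<Longrightarrow> C_k k (f i)"
  shows "C_k k (\<lambda>x. \<Prod>i\<in>I. f i x)"
  using assms
proof (induction I rule: infinite_finite_induct)
  case (insert i I)
  have "C_k k (\<lambda>x. f i x * (\<Prod>i\<in>I. f i x))"
    by (rule C_k_mult) (simp_all add: insert)
  then show ?case using insert.hyps by simp
qed (simp_all add: C_k_const)

lemma C_k_comp_affine:
  fixes f :: "real \<Rightarrow> real" and a :: "'a::euclidean_space"
  shows "C_k k f \<Longrightarrow> C_k k (\<lambda>x. f (a \<bullet> x + d))"
proof (induction k arbitrary: f)
  case 0
  then show ?case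
    by (auto intro!: continuous_intros continuous_on_compose2[of UNIV f])
next
  case (Suc k)
  let ?D = "\<lambda>y. frechet_derivative f (at y) 1"
  have fd: "(f has_derivative (\<lambda>h. h * ?D y)) (at y)" for y
  proof -
    have "(f has_derivative frechet_derivative f (at y)) (at y)"
      using Suc.prems frechet_derivative_works by auto
    moreover have "frechet_derivative f (at y) = (\<lambda>h. h * ?D y)"
    proof
      fix h
      have "linear (frechet_derivative f (at y))"
        using calculation by (rule has_derivative_linear)
      from linear_scale[OF this, of h 1]
      show "frechet_derivative f (at y) h = h * ?D y" by simp
    qed
    ultimately show ?thesis by simp
  qed
  have d: "((\<lambda>x. f (a \<bullet> x + d)) has_derivative (\<lambda>h. (a \<bullet> h) * ?D (a \<bullet> x + d))) (at x)" for x
    by (rule has_derivative_compose[OF _ fd])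
      (auto intro!: derivative_eq_intros)
  have e: "frechet_derivative (\<lambda>x. f (a \<bullet> x + d)) (at x) = (\<lambda>h. (a \<bullet> h) * ?D (a \<bullet> x + d))" for x
    by (rule frechet_derivative_at[OF d, symmetric])
  have "C_k k ?D" using Suc.prems by simp
  then have "C_k k (\<lambda>x. (a \<bullet> b) * ?D (a \<bullet> x + d))" for b
    by (intro C_k_mult C_k_const Suc.IH)
  with d show ?case by (auto simp: differentiable_def e)
qed

text \<open>The classical flat function: it and all its derivatives vanish at 0, and it is the building
  block of all test functions below.\<close>

definition flat_exp :: "real \<Rightarrow> real" where
  "flat_exp x = (if x > 0 then exp (- (1 / x)) else 0)"

lemma poly_exp_decay: "((\<lambda>y. poly P y * exp (- y)) \<longlongrightarrow> 0) at_top" for P :: "real poly"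
proof -
  have "((\<lambda>y. \<Sum>i\<le>degree P. coeff P i * (y ^ i / exp y)) \<longlongrightarrow> (\<Sum>i\<le>degree P. coeff P i * 0)) at_top"
    by (intro tendsto_intros tendsto_power_div_exp_0)
  then show ?thesis
    by (simp add: poly_altdef sum_distrib_right exp_minus divide_inverse mult.assoc)
qed

text \<open>The functions $P(1/x)\,e^{-1/x}$ on the positive half-line, continued by 0, are closed under
  differentiation, because $(P(1/x)e^{-1/x})' = Q(1/x)e^{-1/x}$ with $Q(y) = y^2(P(y) - P'(y))$;
  at 0 this holds since the exponential beats every polynomial. Smoothness is therefore an
  induction over all \<open>P\<close> at once.\<close>

lemma flat_exp_poly_has_derivative:
  fixes P :: "real poly"
  defines "f \<equiv> \<lambda>Q x. if x > 0 then poly Q (1 / x) * exp (- (1 / x)) else (0::real)"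
  shows "(f P has_real_derivative f ([:0,0,1:] * (P - pderiv P)) x) (at x)"
proof -
  consider "x > 0" | "x < 0" | "x = 0" by linarith
  then show ?thesis
  proof cases
    case 1
    have "((\<lambda>x. poly P (1 / x) * exp (- (1 / x))) has_real_derivative
        f ([:0,0,1:] * (P - pderiv P)) x) (at x)"
      using 1 by (auto intro!: derivative_eq_intros DERIV_chain2[OF poly_DERIV]
        simp: f_def field_simps power2_eq_square)
    then show ?thesis
      by (rule DERIV_cong_ev[THEN iffD1, rotated -1, of _ _ _ x])
        (use 1 in \<open>auto simp: f_def intro: eventually_mono[OF eventually_gt_at_top]
          eventually_mono[OF eventually_nhds_in_open[of "{0<..}"]]\<close>)
  next
    case 2
    have "((\<lambda>x. 0) has_real_derivative 0) (at x)" by simp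
    then show ?thesis
      by (rule DERIV_cong_ev[THEN iffD1, rotated -1, of _ _ _ x])
        (use 2 in \<open>auto simp: f_def intro: eventually_mono[OF eventually_nhds_in_open[of "{..<0}"]]\<close>)
  next
    case 3
    have "((\<lambda>h. f P h / h) \<longlongrightarrow> 0) (at_right 0)"
    proof -
      have "((\<lambda>h. poly (pCons 0 P) (inverse h) * exp (- inverse h)) \<longlongrightarrow> 0) (at_right (0::real))"
        using filterlim_compose[OF poly_exp_decay filterlim_inverse_at_top_right] .
      then show ?thesis
        by (rule Lim_transform_eventually)
          (auto simp: f_def eventually_at_right_less divide_inverse mult_ac
            intro: eventually_mono[OF eventually_at_right_less])
    qed
    moreover have "((\<lambda>h. f P h / h) \<longlongrightarrow> 0) (at_left 0)"
      by (rule Lim_transform_eventually[OF tendsto_const])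
        (auto simp: f_def eventually_at_filter)
    ultimately have "((\<lambda>h. f P h / h) \<longlongrightarrow> 0) (at 0)"
      by (rule filterlim_split_at[rotated])
    then show ?thesis
      unfolding 3 DERIV_def by (simp add: f_def cong: if_cong)
  qed
qed

lemma C_k_flat_exp: "C_k k flat_exp"
proof -
  define f where "f = (\<lambda>Q x. if x > 0 then poly Q (1 / x) * exp (- (1 / x)) else (0::real))"
  have der: "(f P has_derivative (*) (f ([:0,0,1:] * (P - pderiv P)) x)) (at x)" for P x
    using flat_exp_poly_has_derivative[of P x] unfolding f_def has_field_derivative_def .
  have e: "frechet_derivative (f P) (at x) = (*) (f ([:0,0,1:] * (P - pderiv P)) x)" for P x
    by (rule frechet_derivative_at[OF der, symmetric])
  have "C_k k (f P)" for P
  proof (induction k arbitrary: P)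
    case 0
    have "isCont (f P) x" for x using der[of P x] by (rule has_derivative_continuous)
    then show ?case by (simp add: continuous_on_eq_continuous_at)
  next
    case (Suc k)
    then show ?case using der e by (auto simp: differentiable_def)
  qed
  from this[of 1] show ?thesis
    by (rule C_k_cong) (auto simp: f_def flat_exp_def fun_eq_iff)
qed

definition flat_exp' :: "real \<Rightarrow> real" where
  "flat_exp' x = (if x > 0 then exp (- (1 / x)) / x\<^sup>2 else 0)"

lemma flat_exp_deriv: "(flat_exp has_real_derivative flat_exp' x) (at x)"
proof -
  have "flat_exp = (\<lambda>x. if x > 0 then poly 1 (1 / x) * exp (- (1 / x)) else (0::real))"
    by (auto simp: flat_exp_def)
  then show ?thesis
    using flat_exp_poly_has_derivative[of 1 x]
    by (cases "x > 0") (simp_all add: flat_exp'_def power2_eq_square)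
qed

lemma flat_exp_bounds: "0 \<le> flat_exp x" "flat_exp x \<le> 1"
  by (auto simp: flat_exp_def)

lemma flat_exp_scaled_tendsto:
  "(\<lambda>n. flat_exp (real n * x)) \<longlonglongrightarrow> (if x > 0 then 1 else 0)"
proof (cases "x > 0")
  case True
  have "(\<lambda>n. exp (- (inverse (real n) / x))) \<longlonglongrightarrow> exp (- (0 / x))"
    by (intro tendsto_intros lim_inverse_n) (use True in auto)
  then have "(\<lambda>n. exp (- (inverse (real n) / x))) \<longlonglongrightarrow> 1" by simp
  then have "(\<lambda>n. flat_exp (real n * x)) \<longlonglongrightarrow> 1"
    by (rule Lim_transform_eventually)
      (use True in \<open>auto simp: flat_exp_def field_simps intro!: eventually_mono[OF eventually_gt_at_top[of 0]]\<close>)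
  then show ?thesis using True by simp
next
  case False
  have "flat_exp (real n * x) = 0" for n
    using False by (auto simp: flat_exp_def mult_le_0_iff zero_less_mult_iff)
  then show ?thesis using False by simp
qed

text \<open>Since \<open>flat_exp (n * y)\<close> tends to 1 for positive \<open>y\<close> and vanishes otherwise, these smooth
  functions tend to the indicator of the open box as \<open>n\<close> grows, while keeping values in the unit
  interval and support in the closed box.\<close>

definition box_bump :: "'a::euclidean_space \<Rightarrow> 'a \<Rightarrow> nat \<Rightarrow> 'a \<Rightarrow> real" where
  "box_bump a b n x = (\<Prod>i\<in>Basis. flat_exp (real n * (x \<bullet> i - a \<bullet> i)) * flat_exp (real n * (b \<bullet> i - x \<bullet> i)))"

lemma C_k_box_bump: "C_k k (box_bump a b n)"
proof -
  have "C_k k (\<lambda>x. \<Prod>i\<in>Basis. flat_exp ((real n *\<^sub>R i) \<bullet> x + (- real n * (a \<bullet> i))) *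
      flat_exp ((- real n *\<^sub>R i) \<bullet> x + (real n * (b \<bullet> i))))"
    by (intro C_k_prod C_k_mult C_k_comp_affine C_k_flat_exp)
  then show ?thesis
    by (rule C_k_cong) (simp add: box_bump_def fun_eq_iff inner_commute algebra_simps)
qed

lemma box_bump_bounds: "0 \<le> box_bump a b n x" "box_bump a b n x \<le> 1"
  unfolding box_bump_def
  by (intro prod_nonneg prod_le_1 mult_nonneg_nonneg mult_le_one flat_exp_bounds conjI ballI)+

lemma box_bump_outside: "x \<notin> box a b \<Longrightarrow> box_bump a b n x = 0"
proof -
  assume "x \<notin> box a b"
  then obtain i where i: "i \<in> Basis" "x \<bullet> i \<le> a \<bullet> i \<or> b \<bullet> i \<le> x \<bullet> i"
    by (auto simp: mem_box not_less)
  then have "flat_exp (real n * (x \<bullet> i - a \<bullet> i)) * flat_exp (real n * (b \<bullet> i - x \<bullet> i)) = 0"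
    by (auto simp: flat_exp_def zero_less_mult_iff)
  with i(1) show ?thesis
    unfolding box_bump_def by (meson finite_Basis prod_zero)
qed

lemma box_bump_tendsto: "(\<lambda>n. box_bump a b n x) \<longlonglongrightarrow> indicator (box a b) x"
proof (cases "x \<in> box a b")
  case True
  have "(\<lambda>n. box_bump a b n x) \<longlonglongrightarrow>
    (\<Prod>i\<in>Basis. (if x \<bullet> i - a \<bullet> i > 0 then 1 else 0) * (if b \<bullet> i - x \<bullet> i > 0 then 1 else 0))"
    unfolding box_bump_def by (intro tendsto_prod tendsto_mult flat_exp_scaled_tendsto)
  moreover have "(\<Prod>i\<in>Basis. (if x \<bullet> i - a \<bullet> i > 0 then 1 else 0) * (if b \<bullet> i - x \<bullet> i > 0 then 1 else 0)) = (1::real)"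
    using True by (intro prod.neutral) (auto simp: mem_box)
  ultimately show ?thesis using True by simp
qed (simp add: box_bump_outside)

lemma test_functionsI:
  assumes "\<And>k. C_k k \<phi>" "compact K" "K \<subseteq> \<Omega>" "\<And>x. x \<notin> K \<Longrightarrow> \<phi> x = 0"
  shows "\<phi> \<in> test_functions \<Omega>"
proof -
  have "closure {x. \<phi> x \<noteq> 0} \<subseteq> K"
    using assms by (intro closure_minimal) (auto intro: compact_imp_closed)
  moreover from this have "compact (closure {x. \<phi> x \<noteq> 0})"
    using compact_Int_closed[OF assms(2), of "closure {x. \<phi> x \<noteq> 0}"] by (simp add: Int_absorb1)
  ultimately show ?thesis
    using assms(1,3) unfolding test_functions_def by auto
qed

lemma box_bump_test_function:
  "cbox a b \<subseteq> \<Omega> \<Longrightarrow> box_bump a b n \<in> test_functions \<Omega>"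
  by (rule test_functionsI[where K="cbox a b"])
    (auto simp: C_k_box_bump intro: box_bump_outside dest: subsetD[OF box_subset_cbox])

lemma test_functionsE:
  assumes "\<phi> \<in> test_functions \<Omega>"
  obtains K where "compact K" "K \<subseteq> \<Omega>" "\<And>x. x \<notin> K \<Longrightarrow> \<phi> x = 0" "\<And>k. C_k k \<phi>"
proof (rule that[of "closure {x. \<phi> x \<noteq> 0}"])
  show "\<phi> x = 0" if "x \<notin> closure {x. \<phi> x \<noteq> 0}" for x
    using that closure_subset[of "{x. \<phi> x \<noteq> 0}"] by auto
qed (use assms in \<open>simp_all add: test_functions_def\<close>)

lemma test_function_lin:
  assumes "\<phi> \<in> test_functions \<Omega>" "\<psi> \<in> test_functions \<Omega>"
  shows "(\<lambda>x. a *\<^sub>R \<phi> x + b *\<^sub>R \<psi> x) \<in> test_functions \<Omega>"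
proof -
  obtain K where K: "compact K" "K \<subseteq> \<Omega>" "\<And>x. x \<notin> K \<Longrightarrow> \<phi> x = 0" "\<And>k. C_k k \<phi>"
    by (rule test_functionsE[OF assms(1)]) (rule that; assumption)
  obtain L where L: "compact L" "L \<subseteq> \<Omega>" "\<And>x. x \<notin> L \<Longrightarrow> \<psi> x = 0" "\<And>k. C_k k \<psi>"
    by (rule test_functionsE[OF assms(2)]) (rule that; assumption)
  show ?thesis
  proof (rule test_functionsI[where K="K \<union> L"])
    show "C_k k (\<lambda>x. a *\<^sub>R \<phi> x + b *\<^sub>R \<psi> x)" for k
      by (intro C_k_add C_k_linear[OF bounded_linear_scaleR_right] K L)
  qed (use K(1-3) L(1-3) in auto)
qed

section \<open>Functions that vanish against all test functions\<close>

text \<open>Dynkin's theorem for the intersection-stable family of open boxes gives the Borel sets; the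
  case \<open>null\<close> then passes to the completion.\<close>

lemma lebesgue_sets_box_induct [consumes 1, case_names box empty compl union null]:
  assumes A: "A \<in> sets (lebesgue :: 'a::euclidean_space measure)"
    and box: "\<And>a b. P (box a b)"
    and empty: "P {}"
    and compl: "\<And>A. A \<in> sets lebesgue \<Longrightarrow> P A \<Longrightarrow> P (- A)"
    and union: "\<And>A. disjoint_family A \<Longrightarrow> (\<And>i. A i \<in> sets lebesgue) \<Longrightarrow> (\<And>i::nat. P (A i)) \<Longrightarrow> P (\<Union>i. A i)"
    and null: "\<And>A B. A \<in> sets lebesgue \<Longrightarrow> B \<in> sets lebesgue \<Longrightarrow> (AE x in lebesgue. x \<in> A \<longleftrightarrow> x \<in> B) \<Longrightarrow> P A \<Longrightarrow> P B"
  shows "P A"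
proof -
  let ?G = "range (\<lambda>(a, b). box a b :: 'a set)"
  have borel: "P B" if "B \<in> sets borel" for B
  proof -
    have "Int_stable ?G"
    proof (rule Int_stableI)
      fix A B assume "A \<in> ?G" "B \<in> ?G"
      then obtain a b c d where "A = box a b" "B = box c d" by auto
      moreover obtain e f where "box a b \<inter> box c d = box e f" by (rule that[OF box_Int_box])
      ultimately show "A \<inter> B \<in> ?G"
        using range_eqI[of "A \<inter> B" "\<lambda>(a, b). box a b" "(e, f)"] by simp
    qed
    moreover have "?G \<subseteq> Pow UNIV" by simp
    moreover have sb: "sigma_sets UNIV ?G = sets borel"
      by (simp add: borel_eq_box)
    with that have "B \<in> sigma_sets UNIV ?G" by simp
    ultimately show ?thesis
    proof (induction B rule: sigma_sets_induct_disjoint)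
      case (compl A)
      then show ?case
        using assms(4)[of A] by (simp add: sb Compl_eq_Diff_UNIV)
    next
      case (union A)
      then show ?case
        by (intro assms(5)) (auto simp: sb)
    qed (auto intro: box empty)
  qed
  from A obtain S N N' where S: "A = S \<union> N" "N \<subseteq> N'" "N' \<in> null_sets lborel" "S \<in> sets lborel"
    by (rule sets_completionE)
  have "AE x in lebesgue. x \<notin> N'"
    using S(3) by (intro AE_completion AE_not_in)
  then have "AE x in lebesgue. x \<in> S \<longleftrightarrow> x \<in> A"
    by eventually_elim (use S(1,2) in auto)
  then show ?thesis
    using null[of S A] A S(4) borel[of S] by auto
qed

text \<open>The sets over which \<open>g\<close> integrates to 0 form a Dynkin system, so they include $\{g > 0\}$
  and $\{g < 0\}$.\<close>

lemma AE_zero_if_box_integrals_zero: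
  fixes g :: "'a::euclidean_space \<Rightarrow> real"
  assumes g: "integrable lebesgue g"
    and box: "\<And>a b. (LINT x|lebesgue. indicator (box a b) x * g x) = 0"
  shows "AE x in lebesgue. g x = 0"
proof -
  have gi [simp]: "integrable lebesgue (\<lambda>x. indicator A x * g x)" if "A \<in> sets lebesgue" for A
    using integrable_real_mult_indicator[OF that g] by (simp add: mult.commute)
  have "(LINT x|lebesgue. g x) = 0"
  proof (rule LIMSEQ_unique)
    let ?B = "\<lambda>n::nat. box (- (real n *\<^sub>R One)) (real n *\<^sub>R One) :: 'a set"
    have "(\<lambda>n. indicator (?B n) x * g x) \<longlonglongrightarrow> g x" for x
    proof -
      obtain N where "x \<in> ?B N" using UN_box_eq_UNIV by blast
      then have "x \<in> ?B n" if "n \<ge> N" for n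
        using that by (force simp: mem_box)
      then show ?thesis
        by (intro tendsto_eventually) (auto simp: eventually_sequentially indicator_def intro!: exI[of _ N])
    qed
    then show "(\<lambda>n. LINT x|lebesgue. indicator (?B n) x * g x) \<longlonglongrightarrow> (LINT x|lebesgue. g x)"
      using g by (intro integral_dominated_convergence[where w="\<lambda>x. norm (g x)"]
          borel_measurable_integrable gi) (auto simp: indicator_def)
    show "(\<lambda>n. LINT x|lebesgue. indicator (?B n) x * g x) \<longlonglongrightarrow> 0"
      by (simp add: box)
  qed
  have all: "(LINT x|lebesgue. indicator A x * g x) = 0" if "A \<in> sets lebesgue" for A
    using that
  proof (induction A rule: lebesgue_sets_box_induct)
    case (compl A)
    have "(LINT x|lebesgue. indicator (-A) x * g x) = (LINT x|lebesgue. g x - indicator A x * g x)"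
      by (rule Bochner_Integration.integral_cong) (auto simp: indicator_def)
    also have "\<dots> = 0"
      using compl g \<open>(LINT x|lebesgue. g x) = 0\<close> by (subst Bochner_Integration.integral_diff) auto
    finally show ?case .
  next
    case (union A)
    have "(\<lambda>n. LINT x|lebesgue. indicator (\<Union>i<n. A i) x * g x) \<longlonglongrightarrow>
      (LINT x|lebesgue. indicator (\<Union>i. A i) x * g x)"
    proof (rule integral_dominated_convergence[where w="\<lambda>x. norm (g x)"])
      show "AE x in lebesgue. (\<lambda>n. indicat_real (\<Union>i<n. A i) x * g x) \<longlonglongrightarrow> indicat_real (\<Union> (range A)) x * g x"
        by (intro AE_I2 tendsto_intros LIMSEQ_indicator_UN)
      show "integrable lebesgue (\<lambda>x. norm (g x))" using g by simp
      show "(\<lambda>x. indicator (\<Union>i. A i) x * g x) \<in> borel_measurable lebesgue"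
        using union(2) by (intro borel_measurable_integrable gi) auto
      show "(\<lambda>x. indicator (\<Union>i<n. A i) x * g x) \<in> borel_measurable lebesgue" for n
        using union(2) by (intro borel_measurable_integrable gi) auto
      show "AE x in lebesgue. norm (indicator (\<Union>i<n. A i) x * g x) \<le> norm (g x)" for n
        by (intro AE_I2) (simp add: indicator_def)
    qed
    moreover have "(LINT x|lebesgue. indicator (\<Union>i<n. A i) x * g x) = 0" for n
    proof -
      have "indicator (\<Union>i<n. A i) x = (\<Sum>i<n. indicator (A i) x :: real)" for x
        using union(1) by (intro indicator_UN_disjoint) (auto simp: disjoint_family_on_def)
      then have "(LINT x|lebesgue. indicator (\<Union>i<n. A i) x * g x) = (LINT x|lebesgue. (\<Sum>i<n. indicator (A i) x * g x))"
        by (simp only: sum_distrib_right)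
      also have "\<dots> = (\<Sum>i<n. LINT x|lebesgue. indicator (A i) x * g x)"
        using union(2) by (intro Bochner_Integration.integral_sum gi)
      finally show ?thesis using union(3) by simp
    qed
    ultimately have "(\<lambda>n::nat. 0) \<longlonglongrightarrow> (LINT x|lebesgue. indicator (\<Union>i. A i) x * g x)" by simp
    then show ?case by (simp add: LIMSEQ_const_iff)
  next
    case (null A B)
    then have "(LINT x|lebesgue. indicator A x * g x) = (LINT x|lebesgue. indicator B x * g x)"
      by (intro integral_cong_AE borel_measurable_integrable gi) (auto simp: indicator_def)
    with null show ?case by simp
  qed (simp_all add: box)
  have pos: "AE x in lebesgue. \<not> f x > 0"
    if f: "integrable lebesgue f" "\<And>A. A \<in> sets lebesgue \<Longrightarrow> (LINT x|lebesgue. indicator A x * f x) = 0"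
    for f :: "'a \<Rightarrow> real"
  proof -
    let ?A = "{x \<in> space lebesgue. f x > 0}"
    have [measurable]: "f \<in> borel_measurable lebesgue" using f by simp
    have A: "?A \<in> sets lebesgue" by measurable
    have "AE x in lebesgue. indicator ?A x * f x = 0"
      using f(2)[OF A] integrable_real_mult_indicator[OF A f(1)]
      by (subst integral_nonneg_eq_0_iff_AE[symmetric]) (auto simp: indicator_def mult.commute)
    then show ?thesis by eventually_elim (auto simp: indicator_def split: if_splits)
  qed
  have "AE x in lebesgue. \<not> g x > 0" using g all by (rule pos)
  moreover have "AE x in lebesgue. \<not> - g x > 0"
    using g all by (intro pos) auto
  ultimately show ?thesis by eventually_elim auto
qed

lemma integrable_lebesgue_on_iff:
  fixes f :: "'a::euclidean_space \<Rightarrow> 'b::{banach, second_countable_topology}"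
  assumes "S \<in> sets lebesgue"
  shows "integrable (lebesgue_on S) f \<longleftrightarrow> integrable lebesgue (\<lambda>x. indicator S x *\<^sub>R f x)"
  using assms by (simp add: integrable_restrict_space)

lemma integral_lebesgue_on:
  fixes f :: "'a::euclidean_space \<Rightarrow> 'b::{banach, second_countable_topology}"
  assumes "S \<in> sets lebesgue"
  shows "integral\<^sup>L (lebesgue_on S) f = integral\<^sup>L lebesgue (\<lambda>x. indicator S x *\<^sub>R f x)"
  using assms by (simp add: integral_restrict_space)

lemma AE_lebesgue_on_iff:
  assumes "S \<in> sets lebesgue"
  shows "(AE x in lebesgue_on S. P x) \<longleftrightarrow> (AE x in lebesgue. x \<in> S \<longrightarrow> P x)"
  using assms by (simp add: AE_restrict_space_iff)

text \<open>By dominated convergence the bumps turn the hypothesis into vanishing integrals over all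
  boxes whose closure lies in \<open>\<Omega>\<close>. Countably many closed boxes exhaust \<open>\<Omega>\<close>.\<close>

lemma fundamental_lemma_calculus_of_variations:
  fixes g :: "'a::euclidean_space \<Rightarrow> real"
  assumes "open \<Omega>"
    and loc: "\<And>K. compact K \<Longrightarrow> K \<subseteq> \<Omega> \<Longrightarrow> integrable (lebesgue_on K) g"
    and test: "\<And>\<phi>. \<phi> \<in> test_functions \<Omega> \<Longrightarrow> (LINT x|lebesgue_on \<Omega>. g x * \<phi> x) = 0"
  shows "AE x in lebesgue_on \<Omega>. g x = 0"
proof -
  have \<Omega>: "\<Omega> \<in> sets lebesgue" using assms(1) by (intro sets_completionI_sets) simp
  have box: "(LINT x|lebesgue. indicator (box a b) x * g x) = 0" if ab: "cbox a b \<subseteq> \<Omega>" for a b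
  proof (rule LIMSEQ_unique)
    have i: "integrable lebesgue (\<lambda>x. indicator (cbox a b) x * g x)"
      using loc[of "cbox a b"] ab by (simp add: integrable_lebesgue_on_iff)
    have eq: "indicator \<Omega> x * (g x * box_bump a b n x) = indicator (cbox a b) x * g x * box_bump a b n x" for x n
      using ab box_bump_outside[of x a b n] box_subset_cbox[of a b]
      by (cases "x \<in> cbox a b") (auto simp: indicator_def)
    have m: "box_bump a b n \<in> borel_measurable lebesgue" for n
      using C_k_imp_continuous[OF C_k_box_bump[of 0 a b n]]
      by (intro measurable_completion) (simp add: borel_measurable_continuous_onI)
    show "(\<lambda>n. LINT x|lebesgue. indicator \<Omega> x * (g x * box_bump a b n x)) \<longlonglongrightarrow> (LINT x|lebesgue. indicator (box a b) x * g x)"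
      unfolding eq
    proof (rule integral_dominated_convergence)
      show "integrable lebesgue (\<lambda>x. norm (indicator (cbox a b) x * g x))" using i by simp
      show "(\<lambda>x. indicator (box a b) x * g x) \<in> borel_measurable lebesgue"
      proof -
        have "(\<lambda>x. indicator (box a b) x * (indicator (cbox a b) x * g x)) \<in> borel_measurable lebesgue"
          using borel_measurable_integrable[OF i]
          by (rule borel_measurable_times[rotated]) (auto intro!: borel_measurable_indicator)
        then show ?thesis
          by (rule measurable_cong[THEN iffD1, rotated]) (use box_subset_cbox[of a b] in \<open>auto simp: indicator_def\<close>)
      qed
      show "(\<lambda>x. indicator (cbox a b) x * g x * box_bump a b n x) \<in> borel_measurable lebesgue" for n
        using borel_measurable_integrable[OF i] m by (rule borel_measurable_times)
      show "AE x in lebesgue. (\<lambda>n. indicator (cbox a b) x * g x * box_bump a b n x) \<longlonglongrightarrow> indicator (box a b) x * g x"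
      proof (rule AE_I2)
        fix x
        have "(\<lambda>n. indicator (cbox a b) x * g x * box_bump a b n x) \<longlonglongrightarrow> indicator (cbox a b) x * g x * indicator (box a b) x"
          by (intro tendsto_intros box_bump_tendsto)
        also have "indicator (cbox a b) x * g x * indicator (box a b) x = indicator (box a b) x * g x"
          using box_subset_cbox[of a b] by (auto simp: indicator_def)
        finally show "(\<lambda>n. indicator (cbox a b) x * g x * box_bump a b n x) \<longlonglongrightarrow> indicator (box a b) x * g x" .
      qed
      show "AE x in lebesgue. norm (indicator (cbox a b) x * g x * box_bump a b n x) \<le> norm (indicator (cbox a b) x * g x)" for n
        using box_bump_bounds[of a b n] by (auto simp: abs_mult indicator_def mult_left_le)
    qed
    show "(\<lambda>n. LINT x|lebesgue. indicator \<Omega> x * (g x * box_bump a b n x)) \<longlonglongrightarrow> 0"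
      using test[OF box_bump_test_function[OF ab]] \<Omega> by (simp add: integral_lebesgue_on)
  qed
  have cbox0: "AE x in lebesgue. x \<in> cbox a b \<longrightarrow> g x = 0" if ab: "cbox a b \<subseteq> \<Omega>" for a b
  proof -
    have i: "integrable lebesgue (\<lambda>x. indicator (cbox a b) x * g x)"
      using loc[of "cbox a b"] ab by (simp add: integrable_lebesgue_on_iff)
    have "AE x in lebesgue. indicator (box a b) x * (indicator (cbox a b) x * g x) = 0"
    proof (rule AE_zero_if_box_integrals_zero)
      show "integrable lebesgue (\<lambda>x. indicator (box a b) x * (indicator (cbox a b) x * g x))"
        using integrable_real_mult_indicator[OF _ i, of "box a b"] by (simp add: mult.commute)
      fix c d :: 'a
      obtain e f where ef: "box c d \<inter> box a b = box e f" by (rule that[OF box_Int_box])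
      have "indicator (box c d) x * (indicator (box a b) x * (indicator (cbox a b) x * g x)) = indicator (box e f) x * g x" for x
        unfolding ef[symmetric] using box_subset_cbox[of a b] by (auto simp: indicator_def)
      moreover have "(LINT x|lebesgue. indicator (box e f) x * g x) = 0"
      proof (cases "box e f = {}")
        case False
        then have "cbox e f = closure (box e f)" by simp
        also have "\<dots> \<subseteq> closure (box a b)" using ef by (intro closure_mono) auto
        also have "\<dots> \<subseteq> cbox a b" by (intro closure_minimal box_subset_cbox closed_cbox)
        finally show ?thesis using ab by (intro box) auto
      qed simp
      ultimately show "(LINT x|lebesgue. indicator (box c d) x * (indicator (box a b) x * (indicator (cbox a b) x * g x))) = 0"
        by (simp only:)
    qed
    moreover have "AE x in lebesgue. x \<notin> frontier (cbox a b)"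
      using negligible_frontier_interval[of a b] by (intro AE_not_in) (simp add: negligible_iff_null_sets frontier_cbox)
    ultimately show ?thesis
      by eventually_elim (auto simp: indicator_def frontier_cbox split: if_splits)
  qed
  obtain \<D> where D: "countable \<D>" "\<D> \<subseteq> Pow \<Omega>" "\<And>X. X \<in> \<D> \<Longrightarrow> \<exists>a b. X = cbox a b" "\<Union>\<D> = \<Omega>"
    using open_countable_Union_open_cbox[OF assms(1)] by metis
  have "AE x in lebesgue. \<forall>X\<in>\<D>. x \<in> X \<longrightarrow> g x = 0"
  proof (subst AE_ball_countable[OF D(1)], rule ballI)
    fix X assume "X \<in> \<D>"
    moreover from this obtain a b where "X = cbox a b" using D(3) by blast
    ultimately show "AE x in lebesgue. x \<in> X \<longrightarrow> g x = 0"
      using D(2) cbox0[of a b] by blast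
  qed
  then show ?thesis
    unfolding AE_lebesgue_on_iff[OF \<Omega>] by eventually_elim (use D(4) in auto)
qed

section \<open>Weak gradients\<close>

lemma integrable_lborel_compact_support:
  fixes f :: "'a::euclidean_space \<Rightarrow> 'b::{banach, second_countable_topology}"
  assumes "continuous_on UNIV f" "compact K" "\<And>x. x \<notin> K \<Longrightarrow> f x = 0"
  shows "integrable lborel f"
proof -
  have "integrable lborel (\<lambda>x. indicator K x *\<^sub>R f x)"
    using assms by (intro borel_integrable_compact) (auto intro: continuous_on_subset)
  moreover have "(\<lambda>x. indicator K x *\<^sub>R f x) = f"
    using assms(3) by (auto simp: fun_eq_iff indicator_def)
  ultimately show ?thesis by simp
qed

lemma bounded_compact_support:
  fixes f :: "'a::euclidean_space \<Rightarrow> 'b::real_normed_vector"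
  assumes "continuous_on UNIV f" "compact K" "\<And>x. x \<notin> K \<Longrightarrow> f x = 0"
  obtains B where "B > 0" "\<And>x. norm (f x) \<le> B"
proof -
  have "bounded (f ` K)"
    using assms by (intro compact_imp_bounded compact_continuous_image) (auto intro: continuous_on_subset)
  then obtain B where B: "B > 0" "\<And>x. x \<in> K \<Longrightarrow> norm (f x) \<le> B"
    unfolding bounded_pos by auto
  moreover have "norm (f x) \<le> B" for x
    using B assms(3)[of x] by (cases "x \<in> K") auto
  ultimately show ?thesis using that by blast
qed

lemma frechet_derivative_outside_support:
  fixes f :: "'a::euclidean_space \<Rightarrow> 'b::real_normed_vector"
  assumes "closed K" "\<And>x. x \<notin> K \<Longrightarrow> f x = 0" "x \<notin> K"
  shows "frechet_derivative f (at x) = (\<lambda>h. 0)"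
proof -
  have "(f has_derivative (\<lambda>h. 0)) (at x)"
    by (rule has_derivative_transform_within_open[of "\<lambda>x. 0" _ x UNIV "- K"])
      (use assms in auto)
  from frechet_derivative_at[OF this] show ?thesis by simp
qed

lemma integral_lborel_translate:
  fixes f :: "'a::euclidean_space \<Rightarrow> real"
  assumes "f \<in> borel_measurable borel"
  shows "(LINT x|lborel. f (c + x)) = (LINT x|lborel. f x)"
  using integral_distr[of "(+) c" lborel borel f] assms by (simp add: lborel_distr_plus)

text \<open>By translation invariance the difference quotients of \<open>f\<close> in direction \<open>e\<close> have integral 0.
  The mean value theorem bounds them, and they live in a fixed ball, so they converge to the
  derivative under the integral.\<close>

lemma integral_derivative_compact_support:
  fixes f :: "'a::euclidean_space \<Rightarrow> real"
  assumes diff: "\<And>x. f differentiable (at x)"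
    and cont: "continuous_on UNIV (\<lambda>x. frechet_derivative f (at x) e)"
    and K: "compact K" "\<And>x. x \<notin> K \<Longrightarrow> f x = 0"
  shows "(LINT x|lborel. frechet_derivative f (at x) e) = 0"
proof (rule LIMSEQ_unique)
  let ?D = "\<lambda>x. frechet_derivative f (at x) e"
  have cf: "continuous_on UNIV f"
    using diff by (simp add: continuous_on_eq_continuous_at differentiable_imp_continuous_within)
  have fm [measurable]: "f \<in> borel_measurable borel"
    using cf by (rule borel_measurable_continuous_onI)
  have fi: "integrable lborel f"
    by (rule integrable_lborel_compact_support[OF cf K])
  obtain B where B: "B > 0" "\<And>x. norm (?D x) \<le> B"
  proof (rule bounded_compact_support[OF cont K(1)])
    show "?D x = 0" if "x \<notin> K" for x
      using frechet_derivative_outside_support[OF compact_imp_closed[OF K(1)] K(2) that] by simp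
  qed (rule that)
  obtain R where R: "\<And>x. x \<in> K \<Longrightarrow> norm x \<le> R"
    using compact_imp_bounded[OF K(1)] by (auto simp: bounded_iff)
  define h where "h = (\<lambda>n. inverse (real (Suc n)))"
  have h: "0 < h n" "h n \<le> 1" "h \<longlonglongrightarrow> 0" for n
    using LIMSEQ_inverse_real_of_nat by (auto simp: h_def inverse_le_1_iff)
  have lineder: "((\<lambda>t. f (x + t *\<^sub>R e)) has_real_derivative ?D (x + t *\<^sub>R e)) (at t)" for x t
  proof -
    have fd: "(f has_derivative frechet_derivative f (at y)) (at y)" for y
      using diff frechet_derivative_works by blast
    have "((\<lambda>t. f (x + t *\<^sub>R e)) has_derivative (\<lambda>s. frechet_derivative f (at (x + t *\<^sub>R e)) (s *\<^sub>R e))) (at t)"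
      by (rule has_derivative_compose[OF _ fd]) (auto intro!: derivative_eq_intros)
    moreover have "frechet_derivative f (at (x + t *\<^sub>R e)) (s *\<^sub>R e) = ?D (x + t *\<^sub>R e) * s" for s
      using linear_scale[OF has_derivative_linear[OF fd]] by simp
    ultimately show ?thesis by (simp add: has_field_derivative_def)
  qed
  define q where "q = (\<lambda>n x. (f (h n *\<^sub>R e + x) - f x) / h n)"
  have bound: "norm (q n x) \<le> B" for n x
  proof -
    have "norm (f (x + h n *\<^sub>R e) - f (x + 0 *\<^sub>R e)) \<le> B * norm (h n - 0)"
      by (rule field_differentiable_bound[of UNIV, OF _ lineder]) (use B(2) in auto)
    then show ?thesis
      using h(1)[of n] by (simp add: q_def field_simps)
  qed
  have supp: "q n x = 0" if "x \<notin> cball 0 (R + norm e)" for n x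
  proof -
    have "x \<notin> K"
      using that R[of x] norm_ge_zero[of e] by (auto simp: mem_cball simp del: norm_ge_zero)
    moreover have "h n *\<^sub>R e + x \<notin> K"
    proof
      assume "h n *\<^sub>R e + x \<in> K"
      then have "norm x \<le> R + norm (h n *\<^sub>R e)"
        using R[of "h n *\<^sub>R e + x"] norm_triangle_ineq4[of "h n *\<^sub>R e + x" "h n *\<^sub>R e"] by simp
      also have "norm (h n *\<^sub>R e) \<le> norm e"
        using h(1,2)[of n] by (simp add: mult_left_le_one_le)
      finally show False using that by simp
    qed
    ultimately show ?thesis using K(2) by (simp add: q_def)
  qed
  show "(\<lambda>n. LINT x|lborel. q n x) \<longlonglongrightarrow> (LINT x|lborel. ?D x)"
  proof (rule integral_dominated_convergence)
    show "integrable lborel (\<lambda>x. indicator (cball 0 (R + norm e)) x *\<^sub>R B)"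
      by (intro borel_integrable_compact) auto
    show "?D \<in> borel_measurable lborel"
      using cont by (simp add: borel_measurable_continuous_onI)
    show "q n \<in> borel_measurable lborel" for n
      unfolding q_def by measurable
    show "AE x in lborel. norm (q n x) \<le> indicator (cball 0 (R + norm e)) x *\<^sub>R B" for n
      using bound[of n] supp[of _ n] by (intro AE_I2) (auto simp: indicator_def)
    show "AE x in lborel. (\<lambda>n. q n x) \<longlonglongrightarrow> ?D x"
    proof (rule AE_I2)
      fix x
      have "((\<lambda>t. (f (x + t *\<^sub>R e) - f x) / t) \<longlongrightarrow> ?D x) (at 0)"
        using lineder[of x 0] by (simp add: DERIV_def)
      moreover have "filterlim h (at 0) sequentially"
        using h unfolding filterlim_at by (auto intro!: always_eventually simp: less_imp_neq[symmetric])
      ultimately show "(\<lambda>n. q n x) \<longlonglongrightarrow> ?D x"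
        unfolding q_def add.commute[of _ x] by (rule filterlim_compose)
    qed
  qed
  have "(LINT x|lborel. q n x) = 0" for n
  proof -
    have "integrable lborel (\<lambda>x. f (h n *\<^sub>R e + x))"
      using integrable_distr[of "(+) (h n *\<^sub>R e)" lborel borel f] fi by (simp add: lborel_distr_plus)
    then show ?thesis
      using fi integral_lborel_translate[OF fm, of "h n *\<^sub>R e"]
      by (simp add: q_def)
  qed
  then show "(\<lambda>n. LINT x|lborel. q n x) \<longlonglongrightarrow> 0" by simp
qed

lemma integrable_mult_compact_support:
  fixes g \<phi> :: "'a::euclidean_space \<Rightarrow> real"
  assumes \<Omega>: "\<Omega> \<in> sets lebesgue"
    and loc: "\<And>K. compact K \<Longrightarrow> K \<subseteq> \<Omega> \<Longrightarrow> integrable (lebesgue_on K) g"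
    and \<phi>: "continuous_on UNIV \<phi>" "compact K" "K \<subseteq> \<Omega>" "\<And>x. x \<notin> K \<Longrightarrow> \<phi> x = 0"
  shows "integrable (lebesgue_on \<Omega>) (\<lambda>x. g x * \<phi> x)"
proof -
  have K: "K \<in> sets lebesgue" using \<phi>(2) by (intro sets_completionI_sets) (simp add: borel_compact)
  obtain B where B: "B > 0" "\<And>x. norm (\<phi> x) \<le> B"
    using bounded_compact_support[OF \<phi>(1,2,4)] by metis
  have i: "integrable lebesgue (\<lambda>x. indicator K x * g x)"
    using loc[OF \<phi>(2,3)] K by (simp add: integrable_lebesgue_on_iff)
  have m: "\<phi> \<in> borel_measurable lebesgue"
    using \<phi>(1) by (intro measurable_completion) (simp add: borel_measurable_continuous_onI)
  have "integrable lebesgue (\<lambda>x. (indicator K x * g x) * \<phi> x)"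
  proof (rule Bochner_Integration.integrable_bound)
    show "integrable lebesgue (\<lambda>x. B * (indicator K x * g x))" using i by simp
    show "(\<lambda>x. (indicator K x * g x) * \<phi> x) \<in> borel_measurable lebesgue"
      using borel_measurable_integrable[OF i] m by (rule borel_measurable_times)
    show "AE x in lebesgue. norm ((indicator K x * g x) * \<phi> x) \<le> norm (B * (indicator K x * g x))"
      using B by (intro AE_I2) (auto simp: abs_mult indicator_def mult.commute intro!: mult_right_mono)
  qed
  moreover have "(indicator K x * g x) * \<phi> x = indicator \<Omega> x * (g x * \<phi> x)" for x
    using \<phi>(3,4) by (auto simp: indicator_def)
  ultimately show ?thesis
    using \<Omega> by (simp add: integrable_lebesgue_on_iff)
qed

lemma test_function_partial:
  assumes "\<phi> \<in> test_functions \<Omega>" "b \<in> Basis"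
  shows "continuous_on UNIV (\<lambda>x. frechet_derivative \<phi> (at x) b)"
    and "closure {x. \<phi> x \<noteq> 0} = K \<Longrightarrow> x \<notin> K \<Longrightarrow> frechet_derivative \<phi> (at x) b = 0"
proof -
  have "C_k (Suc 0) \<phi>" using assms(1) by (simp add: test_functions_def del: C_k.simps)
  then show "continuous_on UNIV (\<lambda>x. frechet_derivative \<phi> (at x) b)" using assms(2) by simp
  assume "closure {x. \<phi> x \<noteq> 0} = K" "x \<notin> K"
  then show "frechet_derivative \<phi> (at x) b = 0"
    using closure_subset[of "{x. \<phi> x \<noteq> 0}"]
    by (subst frechet_derivative_outside_support[of K]) auto
qed

lemma weak_gradient_integrable_test:
  assumes "open \<Omega>" "is_weak_gradient \<Omega> u G" "\<phi> \<in> test_functions \<Omega>"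
  shows "integrable (lebesgue_on \<Omega>) (\<lambda>x. u x $ i * frechet_derivative \<phi> (at x) (axis j 1))"
    and "integrable (lebesgue_on \<Omega>) (\<lambda>x. G x $ i $ j * \<phi> x)"
proof -
  let ?K = "closure {x. \<phi> x \<noteq> 0}"
  have \<Omega>: "\<Omega> \<in> sets lebesgue" using assms(1) by (intro sets_completionI_sets) simp
  have K: "compact ?K" "?K \<subseteq> \<Omega>" "C_k 0 \<phi>"
    using assms(3) unfolding test_functions_def by blast+
  have uG: "integrable (lebesgue_on K) u" "integrable (lebesgue_on K) G" if "compact K" "K \<subseteq> \<Omega>" for K
    using assms(2) that by (auto simp: is_weak_gradient_def)
  show "integrable (lebesgue_on \<Omega>) (\<lambda>x. u x $ i * frechet_derivative \<phi> (at x) (axis j 1))"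
    using uG test_function_partial[OF assms(3), of "axis j 1"] K(2)
    by (intro integrable_mult_compact_support[OF \<Omega> _ _ K(1)]
        integrable_bounded_linear[OF bounded_linear_vec_nth]) (auto simp: axis_in_Basis_iff)
  show "integrable (lebesgue_on \<Omega>) (\<lambda>x. G x $ i $ j * \<phi> x)"
  proof (rule integrable_mult_compact_support[OF \<Omega> _ _ K(1)])
    show "integrable (lebesgue_on K) (\<lambda>x. G x $ i $ j)" if "compact K" "K \<subseteq> \<Omega>" for K
      using uG(2)[OF that] by (intro integrable_bounded_linear[OF bounded_linear_vec_nth])
    show "\<phi> x = 0" if "x \<notin> ?K" for x
      using that closure_subset[of "{x. \<phi> x \<noteq> 0}"] by blast
  qed (use K in auto)
qed

lemma is_weak_gradientD:
  assumes "is_weak_gradient \<Omega> u G" "\<phi> \<in> test_functions \<Omega>"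
  shows "(LINT x|lebesgue_on \<Omega>. u x $ i * frechet_derivative \<phi> (at x) (axis j 1)) =
    - (LINT x|lebesgue_on \<Omega>. G x $ i $ j * \<phi> x)"
  using assms by (simp add: is_weak_gradient_def)

text \<open>Every entry of the difference of two weak gradients integrates to 0 against all test
  functions.\<close>

lemma weak_gradient_unique:
  assumes "open \<Omega>" "is_weak_gradient \<Omega> u G" "is_weak_gradient \<Omega> u H"
  shows "AE x in lebesgue_on \<Omega>. G x = H x"
proof -
  have "AE x in lebesgue_on \<Omega>. G x $ i $ j - H x $ i $ j = 0" for i j
  proof (rule fundamental_lemma_calculus_of_variations[OF assms(1)])
    fix K assume "compact K" "K \<subseteq> \<Omega>"
    then have "integrable (lebesgue_on K) G" "integrable (lebesgue_on K) H"
      using assms by (auto simp: is_weak_gradient_def)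
    then show "integrable (lebesgue_on K) (\<lambda>x. G x $ i $ j - H x $ i $ j)"
      by (intro Bochner_Integration.integrable_diff integrable_bounded_linear[OF bounded_linear_vec_nth])
  next
    fix \<phi> :: "real^3 \<Rightarrow> real" assume \<phi>: "\<phi> \<in> test_functions \<Omega>"
    have "(LINT x|lebesgue_on \<Omega>. (G x $ i $ j - H x $ i $ j) * \<phi> x) =
        (LINT x|lebesgue_on \<Omega>. G x $ i $ j * \<phi> x) - (LINT x|lebesgue_on \<Omega>. H x $ i $ j * \<phi> x)"
      using weak_gradient_integrable_test(2)[OF assms(1,2) \<phi>] weak_gradient_integrable_test(2)[OF assms(1,3) \<phi>]
      by (simp add: left_diff_distrib)
    also have "\<dots> = 0"
      using is_weak_gradientD[OF assms(2) \<phi>, of i j] is_weak_gradientD[OF assms(3) \<phi>, of i j] by linarith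
    finally show "(LINT x|lebesgue_on \<Omega>. (G x $ i $ j - H x $ i $ j) * \<phi> x) = 0" .
  qed
  then have "AE x in lebesgue_on \<Omega>. \<forall>i\<in>UNIV. \<forall>j\<in>UNIV. G x $ i $ j - H x $ i $ j = 0"
    by (intro AE_finite_allI) auto
  then show ?thesis
    by eventually_elim (auto simp: vec_eq_iff)
qed

lemma weak_gradient_lin:
  assumes "open \<Omega>" "is_weak_gradient \<Omega> u G" "is_weak_gradient \<Omega> v H"
  shows "is_weak_gradient \<Omega> (\<lambda>x. a *\<^sub>R u x + b *\<^sub>R v x) (\<lambda>x. a *\<^sub>R G x + b *\<^sub>R H x)"
  unfolding is_weak_gradient_def
proof (intro conjI allI impI ballI)
  fix K assume "compact K \<and> K \<subseteq> \<Omega>"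
  then show "integrable (lebesgue_on K) (\<lambda>x. a *\<^sub>R u x + b *\<^sub>R v x)"
    "integrable (lebesgue_on K) (\<lambda>x. a *\<^sub>R G x + b *\<^sub>R H x)"
    using assms(2,3) by (auto simp: is_weak_gradient_def)
next
  fix \<phi> :: "real^3 \<Rightarrow> real" and i j assume \<phi>: "\<phi> \<in> test_functions \<Omega>"
  note I = weak_gradient_integrable_test[OF assms(1,2) \<phi>, of i j]
    weak_gradient_integrable_test[OF assms(1,3) \<phi>, of i j]
  have "(LINT x|lebesgue_on \<Omega>. (a *\<^sub>R u x + b *\<^sub>R v x) $ i * frechet_derivative \<phi> (at x) (axis j 1))
    = (LINT x|lebesgue_on \<Omega>. a * (u x $ i * frechet_derivative \<phi> (at x) (axis j 1)) + b * (v x $ i * frechet_derivative \<phi> (at x) (axis j 1)))"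
    by (intro Bochner_Integration.integral_cong) (auto simp: algebra_simps)
  also have "\<dots> = a * (LINT x|lebesgue_on \<Omega>. u x $ i * frechet_derivative \<phi> (at x) (axis j 1))
     + b * (LINT x|lebesgue_on \<Omega>. v x $ i * frechet_derivative \<phi> (at x) (axis j 1))"
    using I by simp
  also have "\<dots> = - (a * (LINT x|lebesgue_on \<Omega>. G x $ i $ j * \<phi> x) + b * (LINT x|lebesgue_on \<Omega>. H x $ i $ j * \<phi> x))"
    by (simp add: is_weak_gradientD[OF assms(2) \<phi>] is_weak_gradientD[OF assms(3) \<phi>])
  also have "\<dots> = - (LINT x|lebesgue_on \<Omega>. a * (G x $ i $ j * \<phi> x) + b * (H x $ i $ j * \<phi> x))"
    using I by simp
  also have "(LINT x|lebesgue_on \<Omega>. a * (G x $ i $ j * \<phi> x) + b * (H x $ i $ j * \<phi> x)) =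
      (LINT x|lebesgue_on \<Omega>. (a *\<^sub>R G x + b *\<^sub>R H x) $ i $ j * \<phi> x)"
    by (intro Bochner_Integration.integral_cong) (auto simp: algebra_simps)
  finally show "(LINT x|lebesgue_on \<Omega>. (a *\<^sub>R u x + b *\<^sub>R v x) $ i * frechet_derivative \<phi> (at x) (axis j 1))
    = - (LINT x|lebesgue_on \<Omega>. (a *\<^sub>R G x + b *\<^sub>R H x) $ i $ j * \<phi> x)" .
qed

lemma frechet_derivative_nth:
  assumes "f differentiable (at x)"
  shows "frechet_derivative (\<lambda>x. f x $ i) (at x) = (\<lambda>h. frechet_derivative f (at x) h $ i)"
    and "(\<lambda>x. f x $ i) differentiable (at x)"
proof -
  have "((\<lambda>x. f x $ i) has_derivative (\<lambda>h. frechet_derivative f (at x) h $ i)) (at x)"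
    using assms by (intro bounded_linear.has_derivative[OF bounded_linear_vec_nth])
      (simp add: frechet_derivative_works)
  then show "frechet_derivative (\<lambda>x. f x $ i) (at x) = (\<lambda>h. frechet_derivative f (at x) h $ i)"
    "(\<lambda>x. f x $ i) differentiable (at x)"
    by (auto simp: differentiable_def frechet_derivative_at[symmetric])
qed

definition classical_grad :: "(real^3 \<Rightarrow> real^3) \<Rightarrow> real^3 \<Rightarrow> real^3^3" where
  "classical_grad \<phi> x = (\<chi> i j. frechet_derivative \<phi> (at x) (axis j 1) $ i)"

lemma classical_grad_test_function:
  assumes "\<phi> \<in> test_functions \<Omega>"
  shows "continuous_on UNIV (classical_grad \<phi>)"
    and "x \<notin> closure {x. \<phi> x \<noteq> 0} \<Longrightarrow> classical_grad \<phi> x = 0"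
proof -
  show "continuous_on UNIV (classical_grad \<phi>)"
    unfolding classical_grad_def
    by (intro continuous_on_vec_lambda continuous_on_component test_function_partial(1)[OF assms])
      (auto simp: axis_in_Basis_iff)
  show "classical_grad \<phi> x = 0" if "x \<notin> closure {x. \<phi> x \<noteq> 0}"
    using test_function_partial(2)[OF assms _ refl that]
    by (simp add: classical_grad_def vec_eq_iff axis_in_Basis_iff)
qed

text \<open>Integration by parts. The lemma matters because \<open>W1_0\<close> is defined through \<open>W1_norm q \<Omega> (\<phi> n
  - u)\<close>: this number controls the gradient of the difference only if \<open>\<phi> n\<close> has a weak gradient, as
  \<^const>\<open>weak_grad\<close> is an arbitrary choice otherwise.\<close>

lemma classical_grad_is_weak_gradient:
  assumes "open \<Omega>" and \<phi>: "\<phi> \<in> test_functions \<Omega>"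
  shows "is_weak_gradient \<Omega> \<phi> (classical_grad \<phi>)"
  unfolding is_weak_gradient_def
proof (intro conjI allI impI ballI)
  have c: "continuous_on UNIV \<phi>" and d: "\<And>x. \<phi> differentiable (at x)"
  proof -
    have "C_k 0 \<phi>" "C_k (Suc 0) \<phi>" using \<phi> unfolding test_functions_def by blast+
    then show "continuous_on UNIV \<phi>" "\<And>x. \<phi> differentiable (at x)" by simp_all
  qed
  {
    fix K assume K: "compact K \<and> K \<subseteq> \<Omega>"
    have ci: "integrable (lebesgue_on K) f" if "continuous_on UNIV f" for f :: "real^3 \<Rightarrow> 'b::euclidean_space"
    proof -
      have "integrable lborel (\<lambda>x. indicator K x *\<^sub>R f x)"
        using K that by (intro borel_integrable_compact) (auto intro: continuous_on_subset)
      then show ?thesis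
        using K by (simp add: integrable_lebesgue_on_iff sets_completionI_sets borel_compact
            integrable_completion borel_measurable_integrable)
    qed
    show "integrable (lebesgue_on K) \<phi>" "integrable (lebesgue_on K) (classical_grad \<phi>)"
      using c classical_grad_test_function(1)[OF \<phi>] by (auto intro: ci)
  }
  fix \<eta> :: "real^3 \<Rightarrow> real" and i j assume \<eta>: "\<eta> \<in> test_functions \<Omega>"
  have \<Omega>: "\<Omega> \<in> sets lebesgue" using assms(1) by (intro sets_completionI_sets) simp
  let ?K = "closure {x. \<eta> x \<noteq> 0}"
  let ?e = "axis j 1 :: real^3"
  have K: "compact ?K" "?K \<subseteq> \<Omega>" and \<eta>0: "\<And>x. x \<notin> ?K \<Longrightarrow> \<eta> x = 0"
    using \<eta> closure_subset[of "{x. \<eta> x \<noteq> 0}"] unfolding test_functions_def by blast+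
  have \<eta>c: "continuous_on UNIV \<eta>" and \<eta>d: "\<And>x. \<eta> differentiable (at x)"
  proof -
    have "C_k 0 \<eta>" "C_k (Suc 0) \<eta>" using \<eta> unfolding test_functions_def by blast+
    then show "continuous_on UNIV \<eta>" "\<And>x. \<eta> differentiable (at x)" by simp_all
  qed
  have e: "?e \<in> Basis" by (simp add: axis_in_Basis_iff)
  note \<eta>' = test_function_partial[OF \<eta> e]
  let ?D = "\<lambda>x. \<phi> x $ i * frechet_derivative \<eta> (at x) ?e"
  let ?E = "\<lambda>x. classical_grad \<phi> x $ i $ j * \<eta> x"
  have der: "((\<lambda>x. \<phi> x $ i * \<eta> x) has_derivative
      (\<lambda>h. \<phi> x $ i * frechet_derivative \<eta> (at x) h + frechet_derivative \<phi> (at x) h $ i * \<eta> x)) (at x)" for x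
    using frechet_derivative_nth[OF d[of x], of i] \<eta>d[of x]
    by (intro has_derivative_mult) (simp_all add: frechet_derivative_works)
  have fd: "frechet_derivative (\<lambda>x. \<phi> x $ i * \<eta> x) (at x) ?e = ?D x + ?E x" for x
    by (subst frechet_derivative_at[OF der, symmetric]) (simp add: classical_grad_def)
  have cD: "continuous_on UNIV ?D"
    by (intro continuous_on_mult continuous_on_component c \<eta>'(1))
  have cE: "continuous_on UNIV ?E"
    by (intro continuous_on_mult continuous_on_component classical_grad_test_function(1)[OF \<phi>] \<eta>c)
  have D0: "?D x = 0" "?E x = 0" if "x \<notin> ?K" for x
    using \<eta>'(2)[OF refl that] \<eta>0[OF that] by simp_all
  have iD: "integrable lborel ?D" and iE: "integrable lborel ?E"
    using D0 by (intro integrable_lborel_compact_support[OF cD K(1)] integrable_lborel_compact_support[OF cE K(1)]; blast)+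
  have "(LINT x|lborel. ?D x + ?E x) = 0"
    unfolding fd[symmetric]
  proof (rule integral_derivative_compact_support[OF _ _ K(1)])
    show "(\<lambda>x. \<phi> x $ i * \<eta> x) differentiable (at x)" for x using der by (auto simp: differentiable_def)
    show "continuous_on UNIV (\<lambda>x. frechet_derivative (\<lambda>x. \<phi> x $ i * \<eta> x) (at x) ?e)"
      unfolding fd by (intro continuous_on_add cD cE)
    show "\<phi> x $ i * \<eta> x = 0" if "x \<notin> ?K" for x using \<eta>0[OF that] by simp
  qed
  then have "(LINT x|lborel. ?D x) = - (LINT x|lborel. ?E x)"
    using iD iE by simp
  moreover have "(LINT x|lebesgue_on \<Omega>. f x) = (LINT x|lborel. f x)"
    if "integrable lborel f" "\<And>x. x \<notin> ?K \<Longrightarrow> f x = 0" for f :: "real^3 \<Rightarrow> real"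
  proof -
    have "(LINT x|lebesgue_on \<Omega>. f x) = (LINT x|lebesgue. f x)"
      unfolding integral_lebesgue_on[OF \<Omega>]
      using that(2) K(2) by (intro Bochner_Integration.integral_cong) (auto simp: indicator_def)
    then show ?thesis using that(1) by (simp add: integral_completion borel_measurable_integrable)
  qed
  ultimately show "(LINT x|lebesgue_on \<Omega>. ?D x) = - (LINT x|lebesgue_on \<Omega>. ?E x)"
    using iD iE D0 by simp
qed

lemma weak_grad_is_weak_gradient:
  "is_weak_gradient \<Omega> u G \<Longrightarrow> is_weak_gradient \<Omega> u (weak_grad \<Omega> u)"
  unfolding weak_grad_def by (metis someI)

lemma weak_grad_AE_eq:
  "open \<Omega> \<Longrightarrow> is_weak_gradient \<Omega> u G \<Longrightarrow> AE x in lebesgue_on \<Omega>. weak_grad \<Omega> u x = G x"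
  by (rule weak_gradient_unique[OF _ weak_grad_is_weak_gradient])

section \<open>Lebesgue seminorms\<close>

lemma powr_add_le:
  fixes x y q :: real
  assumes "q > 0" "x \<ge> 0" "y \<ge> 0"
  shows "(x + y) powr q \<le> 2 powr q * (x powr q + y powr q)"
proof -
  have "(x + y) powr q \<le> (2 * max x y) powr q"
    using assms by (intro powr_mono2) auto
  also have "\<dots> = 2 powr q * max x y powr q"
    using assms by (simp add: powr_mult)
  also have "max x y powr q \<le> x powr q + y powr q"
    by (auto simp: max_def)
  finally show ?thesis by simp
qed

text \<open>Convexity of the real function $x^q$ on the open half-line is extended to the value 0 by
  hand.\<close>

lemma powr_norm_convex:
  fixes a b :: "'a::real_normed_vector"
  assumes q: "q \<ge> 1" and l: "0 \<le> l" "l \<le> 1"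
  shows "norm (l *\<^sub>R a + (1 - l) *\<^sub>R b) powr q \<le> l * norm a powr q + (1 - l) * norm b powr q"
proof -
  have small: "(m * y) powr q \<le> m * y powr q" if "0 \<le> m" "m \<le> 1" "y \<ge> 0" for m y :: real
  proof -
    have "m powr q \<le> m"
      using powr_mono'[of 1 q m] q that by simp
    then show ?thesis using that by (simp add: powr_mult mult_right_mono)
  qed
  have conv: "(l * x + (1 - l) * y) powr q \<le> l * x powr q + (1 - l) * y powr q"
    if "x \<ge> 0" "y \<ge> 0" for x y
  proof (cases "x = 0 \<or> y = 0")
    case True
    then show ?thesis using small[of l x] small[of "1 - l" y] that l by auto
  next
    case False
    then have "x > 0" "y > 0" using that by auto
    then show ?thesis
      using powr_convex[OF q] l convex_onD[of "{0<..}" "\<lambda>x. x powr q" "1 - l" x y] by simp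
  qed
  have "norm (l *\<^sub>R a + (1 - l) *\<^sub>R b) powr q \<le> (l * norm a + (1 - l) * norm b) powr q"
    using q l by (intro powr_mono2 order_trans[OF norm_triangle_ineq]) auto
  also have "\<dots> \<le> l * norm a powr q + (1 - l) * norm b powr q"
    by (rule conv) auto
  finally show ?thesis .
qed

lemma borel_measurable_AE_lebesgue_on:
  fixes f g :: "'a::euclidean_space \<Rightarrow> 'b::euclidean_space"
  assumes S: "S \<in> sets lebesgue" and "f \<in> borel_measurable (lebesgue_on S)"
    and eq: "AE x in lebesgue_on S. f x = g x"
  shows "g \<in> borel_measurable (lebesgue_on S)"
proof -
  have "(\<lambda>x. if x \<in> S then g x else 0) \<in> borel_measurable lebesgue"
    by (rule borel_measurable_AE[OF borel_measurable_if_I[OF assms(2) S]])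
      (use eq in \<open>auto simp: AE_lebesgue_on_iff[OF S]\<close>)
  then show ?thesis by (rule borel_measurable_if_D)
qed

lemma Lp_AE_cong:
  fixes f g :: "'a::euclidean_space \<Rightarrow> 'b::euclidean_space"
  assumes S: "S \<in> sets lebesgue" and f: "f \<in> Lp q S" and eq: "AE x in lebesgue_on S. f x = g x"
  shows "g \<in> Lp q S" "(LINT x|lebesgue_on S. norm (g x) powr q) = (LINT x|lebesgue_on S. norm (f x) powr q)"
proof -
  have fm: "f \<in> borel_measurable (lebesgue_on S)" using f by (simp add: Lp_def)
  have gm: "g \<in> borel_measurable (lebesgue_on S)"
    by (rule borel_measurable_AE_lebesgue_on[OF S fm eq])
  have nm: "(\<lambda>x. norm (h x) powr q) \<in> borel_measurable (lebesgue_on S)"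
    if "h \<in> borel_measurable (lebesgue_on S)" for h :: "'a \<Rightarrow> 'b"
    using that by measurable
  have eq': "AE x in lebesgue_on S. norm (g x) powr q = norm (f x) powr q"
    using eq by eventually_elim simp
  show "g \<in> Lp q S"
    using f gm integrable_cong_AE[OF nm[OF gm] nm[OF fm] eq'] by (simp add: Lp_def)
  show "(LINT x|lebesgue_on S. norm (g x) powr q) = (LINT x|lebesgue_on S. norm (f x) powr q)"
    by (rule integral_cong_AE[OF nm[OF gm] nm[OF fm] eq'])
qed

lemma Lp_lin:
  fixes f g :: "'a::euclidean_space \<Rightarrow> 'b::euclidean_space"
  assumes "q > 0" "f \<in> Lp q S" "g \<in> Lp q S"
  shows "(\<lambda>x. a *\<^sub>R f x + b *\<^sub>R g x) \<in> Lp q S"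
proof -
  have [measurable]: "f \<in> borel_measurable (lebesgue_on S)" "g \<in> borel_measurable (lebesgue_on S)"
    using assms by (auto simp: Lp_def)
  have "integrable (lebesgue_on S) (\<lambda>x. norm (a *\<^sub>R f x + b *\<^sub>R g x) powr q)"
  proof (rule Bochner_Integration.integrable_bound)
    show "integrable (lebesgue_on S) (\<lambda>x. 2 powr q * (\<bar>a\<bar> powr q * norm (f x) powr q + \<bar>b\<bar> powr q * norm (g x) powr q))"
      using assms by (intro integrable_mult_right Bochner_Integration.integrable_add) (auto simp: Lp_def)
    show "AE x in lebesgue_on S. norm (norm (a *\<^sub>R f x + b *\<^sub>R g x) powr q) \<le>
        norm (2 powr q * (\<bar>a\<bar> powr q * norm (f x) powr q + \<bar>b\<bar> powr q * norm (g x) powr q))"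
    proof (rule AE_I2)
      fix x
      have "norm (a *\<^sub>R f x + b *\<^sub>R g x) powr q \<le> (norm (a *\<^sub>R f x) + norm (b *\<^sub>R g x)) powr q"
        using assms(1) by (intro powr_mono2 norm_triangle_ineq) auto
      also have "\<dots> \<le> 2 powr q * (norm (a *\<^sub>R f x) powr q + norm (b *\<^sub>R g x) powr q)"
        using assms(1) by (intro powr_add_le) auto
      finally show "norm (norm (a *\<^sub>R f x + b *\<^sub>R g x) powr q) \<le>
        norm (2 powr q * (\<bar>a\<bar> powr q * norm (f x) powr q + \<bar>b\<bar> powr q * norm (g x) powr q))"
        by (simp add: powr_mult)
    qed
  qed measurable
  then show ?thesis by (simp add: Lp_def)
qed

section \<open>Seminormed function spaces and their duals\<close>

text \<open>Function types form no real vector space class, so the space is a carrier that is closed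
  under pointwise linear combinations. The definitions of \<open>dual\<close> and \<open>dual_norm\<close> are shaped like
  those of \<^const>\<open>W1_0_dual\<close> and \<^const>\<open>W1_0_dual_norm\<close>, which are instances.\<close>

locale seminormed =
  fixes X :: "('a \<Rightarrow> 'b::real_vector) set" and N :: "('a \<Rightarrow> 'b) \<Rightarrow> real"
  assumes nonempty: "X \<noteq> {}"
    and lin: "v \<in> X \<Longrightarrow> w \<in> X \<Longrightarrow> (\<lambda>x. a *\<^sub>R v x + b *\<^sub>R w x) \<in> X"
    and nonneg: "0 \<le> N v"
    and scale: "v \<in> X \<Longrightarrow> N (\<lambda>x. a *\<^sub>R v x) = \<bar>a\<bar> * N v"
    and triangle: "v \<in> X \<Longrightarrow> w \<in> X \<Longrightarrow> N (\<lambda>x. v x + w x) \<le> N v + N w"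
begin

lemma zero: "(\<lambda>x. 0) \<in> X"
  using nonempty lin[of _ _ 0 0] by auto

lemma N_zero: "N (\<lambda>x. 0) = 0"
  using scale[OF zero, of 0] by simp

lemma scaleX: "v \<in> X \<Longrightarrow> (\<lambda>x. a *\<^sub>R v x) \<in> X"
  using lin[of v v a 0] by simp

lemma diff: "v \<in> X \<Longrightarrow> w \<in> X \<Longrightarrow> v - w \<in> X"
  using lin[of v w 1 "-1"] by (simp add: fun_diff_def)

lemma diff_triangle: "v \<in> X \<Longrightarrow> w \<in> X \<Longrightarrow> N (v - w) \<le> N v + N w"
  using triangle[of v "\<lambda>x. (-1) *\<^sub>R w x"] scaleX[of w "-1"] scale[of w "-1"] by (simp add: fun_diff_def)

lemma diff_commute: "v \<in> X \<Longrightarrow> w \<in> X \<Longrightarrow> N (v - w) = N (w - v)"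
proof -
  assume "v \<in> X" "w \<in> X"
  have "(\<lambda>x. (-1) *\<^sub>R (w - v) x) = v - w" by (simp add: fun_eq_iff)
  then show ?thesis
    using scale[OF diff[OF \<open>w \<in> X\<close> \<open>v \<in> X\<close>], of "-1"] by simp
qed

lemma diff_diff_triangle:
  assumes "v \<in> X" "w \<in> X" "z \<in> X"
  shows "\<bar>N (v - z) - N (w - z)\<bar> \<le> N (v - w)"
proof -
  have tri: "N (v - z) \<le> N (v - w) + N (w - z)" if "v \<in> X" "w \<in> X" for v w
  proof -
    have "N (\<lambda>x. (v - w) x + (w - z) x) \<le> N (v - w) + N (w - z)"
      by (intro triangle diff that assms)
    moreover have "(\<lambda>x. (v - w) x + (w - z) x) = v - z" by (simp add: fun_eq_iff)
    ultimately show ?thesis by simp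
  qed
  show ?thesis
    using tri[OF assms(1,2)] tri[OF assms(2,1)] diff_commute[OF assms(1,2)] by linarith
qed

definition dual :: "(('a \<Rightarrow> 'b) \<Rightarrow> real) set" where
  "dual = {l. (\<forall>v\<in>X. \<forall>w\<in>X. \<forall>a b. l (\<lambda>x. a *\<^sub>R v x + b *\<^sub>R w x) = a * l v + b * l w) \<and>
     (\<exists>C. \<forall>v\<in>X. \<bar>l v\<bar> \<le> C * N v)}"

definition dual_norm :: "(('a \<Rightarrow> 'b) \<Rightarrow> real) \<Rightarrow> real" where
  "dual_norm l = Sup {\<bar>l v\<bar> | v. v \<in> X \<and> N v \<le> 1}"

lemma dual_lin: "l \<in> dual \<Longrightarrow> v \<in> X \<Longrightarrow> w \<in> X \<Longrightarrow> l (\<lambda>x. a *\<^sub>R v x + b *\<^sub>R w x) = a * l v + b * l w"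
  by (simp add: dual_def)

lemma dual_app_diff: "l \<in> dual \<Longrightarrow> v \<in> X \<Longrightarrow> w \<in> X \<Longrightarrow> l (v - w) = l v - l w"
  using dual_lin[of l v w 1 "-1"] by (simp add: fun_diff_def)

lemma dual_diff: "l \<in> dual \<Longrightarrow> m \<in> dual \<Longrightarrow> l - m \<in> dual"
proof -
  assume lm: "l \<in> dual" "m \<in> dual"
  then obtain C D where C: "\<forall>v\<in>X. \<bar>l v\<bar> \<le> C * N v" and D: "\<forall>v\<in>X. \<bar>m v\<bar> \<le> D * N v"
    by (auto simp: dual_def)
  have "\<bar>(l - m) v\<bar> \<le> (C + D) * N v" if "v \<in> X" for v
    using C[rule_format, OF that] D[rule_format, OF that] by (simp add: algebra_simps)
  moreover have "(l - m) (\<lambda>x. a *\<^sub>R v x + b *\<^sub>R w x) = a * (l - m) v + b * (l - m) w"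
    if "v \<in> X" "w \<in> X" for v w a b
    using dual_lin[OF lm(1) that] dual_lin[OF lm(2) that] by (simp add: algebra_simps)
  ultimately show ?thesis unfolding dual_def by blast
qed

lemma dual_norm_upper:
  assumes "l \<in> dual" "v \<in> X" "N v \<le> 1"
  shows "\<bar>l v\<bar> \<le> dual_norm l"
proof -
  obtain C where C: "\<forall>v\<in>X. \<bar>l v\<bar> \<le> C * N v" using assms(1) by (auto simp: dual_def)
  have "bdd_above {\<bar>l v\<bar> | v. v \<in> X \<and> N v \<le> 1}"
  proof (rule bdd_aboveI)
    fix y assume "y \<in> {\<bar>l v\<bar> | v. v \<in> X \<and> N v \<le> 1}"
    then obtain v where v: "y = \<bar>l v\<bar>" "v \<in> X" "N v \<le> 1" by blast
    have "C * N v \<le> \<bar>C\<bar> * 1" using v(3) nonneg[of v] by (intro mult_mono) auto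
    then show "y \<le> \<bar>C\<bar>" using C v by force
  qed
  then show ?thesis
    unfolding dual_norm_def using assms by (intro cSup_upper) auto
qed

lemma dual_norm_nonneg: "l \<in> dual \<Longrightarrow> 0 \<le> dual_norm l"
  using dual_norm_upper[OF _ zero] by (fastforce simp: N_zero)

text \<open>If \<open>N v = 0\<close>, boundedness of \<open>l\<close> forces \<open>l v = 0\<close>; otherwise normalise \<open>v\<close>.\<close>

lemma dual_norm_bound:
  assumes "l \<in> dual" "v \<in> X"
  shows "\<bar>l v\<bar> \<le> dual_norm l * N v"
proof (cases "N v = 0")
  case True
  then show ?thesis using assms by (auto simp: dual_def)
next
  case False
  then have p: "N v > 0" using nonneg[of v] by simp
  have "\<bar>l (\<lambda>x. (1 / N v) *\<^sub>R v x)\<bar> \<le> dual_norm l"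
    using p assms by (intro dual_norm_upper scaleX) (simp_all add: scale)
  moreover have "l (\<lambda>x. (1 / N v) *\<^sub>R v x) = l v / N v"
    using dual_lin[OF assms(1,2,2), of "1 / N v" 0] by simp
  ultimately show ?thesis using p by (simp add: field_simps)
qed

end

text \<open>For a convex functional \<open>E\<close> that is homogeneous of degree \<open>q\<close>, the sublevel set $E \le 1$ is
  convex, and $v + w$ is \<open>\<alpha> + \<beta>\<close> times a convex combination of $v/\alpha$ and $w/\beta$. So the
  triangle inequality for $E^{1/q}$ comes from pointwise convexity of the integrand.\<close>

lemma minkowski_of_convex:
  fixes E :: "('a \<Rightarrow> 'b::real_vector) \<Rightarrow> real"
  assumes q: "q \<ge> 1"
    and E: "\<And>v. 0 \<le> E v"
    and lin: "\<And>v w a b. v \<in> X \<Longrightarrow> w \<in> X \<Longrightarrow> (\<lambda>x. a *\<^sub>R v x + b *\<^sub>R w x) \<in> X"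
    and convex: "\<And>v w l. v \<in> X \<Longrightarrow> w \<in> X \<Longrightarrow> 0 \<le> l \<Longrightarrow> l \<le> 1 \<Longrightarrow>
        E (\<lambda>x. l *\<^sub>R v x + (1 - l) *\<^sub>R w x) \<le> l * E v + (1 - l) * E w"
    and hom: "\<And>v a. v \<in> X \<Longrightarrow> E (\<lambda>x. a *\<^sub>R v x) = \<bar>a\<bar> powr q * E v"
    and vw: "v \<in> X" "w \<in> X"
  shows "E (\<lambda>x. v x + w x) powr (1/q) \<le> E v powr (1/q) + E w powr (1/q)"
proof (rule field_le_epsilon)
  fix e :: real assume "e > 0"
  \<comment> \<open>The summand \<open>e/2\<close> keeps the denominators positive when a seminorm vanishes.\<close>
  define \<alpha> where "\<alpha> = E v powr (1/q) + e/2"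
  define \<beta> where "\<beta> = E w powr (1/q) + e/2"
  have pos: "\<alpha> > 0" "\<beta> > 0"
    using \<open>e > 0\<close> by (auto simp: \<alpha>_def \<beta>_def intro: add_nonneg_pos)
  have unit: "E (\<lambda>x. (1 / c) *\<^sub>R z x) \<le> 1" if "z \<in> X" "E z powr (1/q) \<le> c" "c > 0" for z c
  proof -
    have "E z = (E z powr (1/q)) powr q"
      using q E[of z] by (simp add: powr_powr)
    also have "\<dots> \<le> c powr q" using q that by (intro powr_mono2) auto
    finally show ?thesis using that(1,3) by (simp add: hom powr_divide field_simps)
  qed
  let ?l = "\<alpha> / (\<alpha> + \<beta>)"
  let ?v = "\<lambda>x. (1 / \<alpha>) *\<^sub>R v x" and ?w = "\<lambda>x. (1 / \<beta>) *\<^sub>R w x"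
  have X: "?v \<in> X" "?w \<in> X" using lin[OF vw(1,1), of _ 0] lin[OF vw(2,2), of _ 0] by auto
  have l: "0 \<le> ?l" "?l \<le> 1" "1 - ?l = \<beta> / (\<alpha> + \<beta>)" using pos by (auto simp: field_simps)
  have "E (\<lambda>x. ?l *\<^sub>R ?v x + (1 - ?l) *\<^sub>R ?w x) \<le> ?l * E ?v + (1 - ?l) * E ?w"
    by (intro convex X l)
  also have "\<dots> \<le> ?l * 1 + (1 - ?l) * 1"
    using l \<open>e > 0\<close> pos vw by (intro add_mono mult_left_mono unit) (auto simp: \<alpha>_def \<beta>_def)
  finally have le1: "E (\<lambda>x. ?l *\<^sub>R ?v x + (1 - ?l) *\<^sub>R ?w x) \<le> 1" by simp
  have eq: "(\<lambda>x. v x + w x) = (\<lambda>x. (\<alpha> + \<beta>) *\<^sub>R (?l *\<^sub>R ?v x + (1 - ?l) *\<^sub>R ?w x))"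
    using pos unfolding l(3) by (auto simp: fun_eq_iff scaleR_add_right)
  have "E (\<lambda>x. v x + w x) \<le> (\<alpha> + \<beta>) powr q"
    unfolding eq hom[OF lin[OF X]]
    using mult_left_mono[OF le1, of "\<bar>\<alpha> + \<beta>\<bar> powr q"] pos by simp
  then have "E (\<lambda>x. v x + w x) powr (1/q) \<le> ((\<alpha> + \<beta>) powr q) powr (1/q)"
    using q E by (intro powr_mono2) auto
  also have "\<dots> = \<alpha> + \<beta>" using q pos by (simp add: powr_powr)
  finally show "E (\<lambda>x. v x + w x) powr (1/q) \<le> E v powr (1/q) + E w powr (1/q) + e"
    by (simp add: \<alpha>_def \<beta>_def)
qed

section \<open>The Sobolev spaces\<close>

lemma W1_weak_grad:
  assumes "open \<Omega>" "u \<in> W1 q \<Omega>"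
  shows "is_weak_gradient \<Omega> u (weak_grad \<Omega> u)" "weak_grad \<Omega> u \<in> Lp q \<Omega>" "u \<in> Lp q \<Omega>"
proof -
  obtain G where G: "G \<in> Lp q \<Omega>" "is_weak_gradient \<Omega> u G" using assms(2) by (auto simp: W1_def)
  show "is_weak_gradient \<Omega> u (weak_grad \<Omega> u)" by (rule weak_grad_is_weak_gradient[OF G(2)])
  have "AE x in lebesgue_on \<Omega>. G x = weak_grad \<Omega> u x"
    using weak_grad_AE_eq[OF assms(1) G(2)] by eventually_elim simp
  then show "weak_grad \<Omega> u \<in> Lp q \<Omega>"
    using assms(1) by (intro Lp_AE_cong(1)[OF _ G(1)] sets_completionI_sets) auto
  show "u \<in> Lp q \<Omega>" using assms(2) by (simp add: W1_def)
qed

lemma W1_lin: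
  assumes "open \<Omega>" "q > 0" "u \<in> W1 q \<Omega>" "v \<in> W1 q \<Omega>"
  shows "(\<lambda>x. a *\<^sub>R u x + b *\<^sub>R v x) \<in> W1 q \<Omega>"
    and "AE x in lebesgue_on \<Omega>. weak_grad \<Omega> (\<lambda>x. a *\<^sub>R u x + b *\<^sub>R v x) x
           = a *\<^sub>R weak_grad \<Omega> u x + b *\<^sub>R weak_grad \<Omega> v x"
proof -
  note u = W1_weak_grad[OF assms(1,3)] and v = W1_weak_grad[OF assms(1,4)]
  have g: "is_weak_gradient \<Omega> (\<lambda>x. a *\<^sub>R u x + b *\<^sub>R v x) (\<lambda>x. a *\<^sub>R weak_grad \<Omega> u x + b *\<^sub>R weak_grad \<Omega> v x)"
    by (intro weak_gradient_lin assms(1) u v)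
  moreover have "(\<lambda>x. a *\<^sub>R weak_grad \<Omega> u x + b *\<^sub>R weak_grad \<Omega> v x) \<in> Lp q \<Omega>"
    "(\<lambda>x. a *\<^sub>R u x + b *\<^sub>R v x) \<in> Lp q \<Omega>"
    by (intro Lp_lin assms(2) u v)+
  ultimately show "(\<lambda>x. a *\<^sub>R u x + b *\<^sub>R v x) \<in> W1 q \<Omega>"
    unfolding W1_def by blast
  show "AE x in lebesgue_on \<Omega>. weak_grad \<Omega> (\<lambda>x. a *\<^sub>R u x + b *\<^sub>R v x) x
           = a *\<^sub>R weak_grad \<Omega> u x + b *\<^sub>R weak_grad \<Omega> v x"
    by (rule weak_grad_AE_eq[OF assms(1) g])
qed

text \<open>The \<open>q\<close>-th power of \<^const>\<open>W1_norm\<close>. Being a sum of integrals, it inherits homogeneity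
  and convexity from its integrands.\<close>

definition W1_energy :: "real \<Rightarrow> (real^3) set \<Rightarrow> (real^3 \<Rightarrow> real^3) \<Rightarrow> real" where
  "W1_energy q \<Omega> u = (LINT x|lebesgue_on \<Omega>. norm (u x) powr q) +
      (LINT x|lebesgue_on \<Omega>. norm (weak_grad \<Omega> u x) powr q)"

lemma W1_norm_energy: "W1_norm q \<Omega> u = W1_energy q \<Omega> u powr (1/q)"
  by (simp add: W1_norm_def W1_energy_def)

lemma W1_energy_nonneg: "0 \<le> W1_energy q \<Omega> u"
  unfolding W1_energy_def by (intro add_nonneg_nonneg integral_nonneg_AE) auto

lemma W1_energy_lin:
  assumes "open \<Omega>" "q > 0" "u \<in> W1 q \<Omega>" "v \<in> W1 q \<Omega>"
  shows "W1_energy q \<Omega> (\<lambda>x. a *\<^sub>R u x + b *\<^sub>R v x) =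
    (LINT x|lebesgue_on \<Omega>. norm (a *\<^sub>R u x + b *\<^sub>R v x) powr q) +
    (LINT x|lebesgue_on \<Omega>. norm (a *\<^sub>R weak_grad \<Omega> u x + b *\<^sub>R weak_grad \<Omega> v x) powr q)"
proof -
  note u = W1_weak_grad[OF assms(1,3)] and v = W1_weak_grad[OF assms(1,4)]
  have \<Omega>: "\<Omega> \<in> sets lebesgue" using assms(1) by (intro sets_completionI_sets) simp
  have "AE x in lebesgue_on \<Omega>. a *\<^sub>R weak_grad \<Omega> u x + b *\<^sub>R weak_grad \<Omega> v x =
      weak_grad \<Omega> (\<lambda>x. a *\<^sub>R u x + b *\<^sub>R v x) x"
    using W1_lin(2)[OF assms, of a b] by eventually_elim simp
  then show ?thesis
    unfolding W1_energy_def
    by (subst Lp_AE_cong(2)[OF \<Omega> Lp_lin[OF assms(2) u(2) v(2)]]) auto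
qed

lemma W1_seminormed:
  assumes "open \<Omega>" "q \<ge> 1"
  shows "seminormed (W1 q \<Omega>) (W1_norm q \<Omega>)"
proof
  have q: "q > 0" using assms(2) by simp
  have "is_weak_gradient \<Omega> (\<lambda>x. 0) (\<lambda>x. 0)" by (simp add: is_weak_gradient_def)
  moreover have "(\<lambda>x. 0 :: real^3) \<in> Lp q \<Omega>" "(\<lambda>x. 0 :: real^3^3) \<in> Lp q \<Omega>"
    by (simp_all add: Lp_def)
  ultimately have "(\<lambda>x. 0) \<in> W1 q \<Omega>" by (auto simp: W1_def)
  then show "W1 q \<Omega> \<noteq> {}" by blast
  show lin: "(\<lambda>x. a *\<^sub>R v x + b *\<^sub>R w x) \<in> W1 q \<Omega>" if "v \<in> W1 q \<Omega>" "w \<in> W1 q \<Omega>" for v w a b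
    by (rule W1_lin(1)[OF assms(1) q that])
  show "0 \<le> W1_norm q \<Omega> v" for v by (simp add: W1_norm_def)
  have hom: "W1_energy q \<Omega> (\<lambda>x. a *\<^sub>R v x) = \<bar>a\<bar> powr q * W1_energy q \<Omega> v" if "v \<in> W1 q \<Omega>" for v a
    using W1_energy_lin[OF assms(1) q that that, of a 0]
    by (simp add: powr_mult W1_energy_def distrib_left)
  then show "W1_norm q \<Omega> (\<lambda>x. a *\<^sub>R v x) = \<bar>a\<bar> * W1_norm q \<Omega> v" if "v \<in> W1 q \<Omega>" for v a
    using that q by (simp add: W1_norm_energy powr_mult powr_powr W1_energy_nonneg)
  have convex: "W1_energy q \<Omega> (\<lambda>x. l *\<^sub>R v x + (1 - l) *\<^sub>R w x) \<le> l * W1_energy q \<Omega> v + (1 - l) * W1_energy q \<Omega> w"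
    if vw: "v \<in> W1 q \<Omega>" "w \<in> W1 q \<Omega>" and l: "0 \<le> l" "l \<le> 1" for v w l
  proof -
    note v = W1_weak_grad[OF assms(1) vw(1)] and w = W1_weak_grad[OF assms(1) vw(2)]
    have le: "(LINT x|lebesgue_on \<Omega>. norm (l *\<^sub>R f x + (1 - l) *\<^sub>R g x) powr q) \<le>
        l * (LINT x|lebesgue_on \<Omega>. norm (f x) powr q) + (1 - l) * (LINT x|lebesgue_on \<Omega>. norm (g x) powr q)"
      if "f \<in> Lp q \<Omega>" "g \<in> Lp q \<Omega>" for f g :: "real^3 \<Rightarrow> 'z::euclidean_space"
    proof -
      have i: "integrable (lebesgue_on \<Omega>) (\<lambda>x. norm (f x) powr q)" "integrable (lebesgue_on \<Omega>) (\<lambda>x. norm (g x) powr q)"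
        using that by (auto simp: Lp_def)
      have "(LINT x|lebesgue_on \<Omega>. norm (l *\<^sub>R f x + (1 - l) *\<^sub>R g x) powr q) \<le>
          (LINT x|lebesgue_on \<Omega>. l * norm (f x) powr q + (1 - l) * norm (g x) powr q)"
        using Lp_lin[OF q that, of l "1 - l"] i powr_norm_convex[OF assms(2) l]
        by (intro integral_mono) (auto simp: Lp_def)
      then show ?thesis using i by simp
    qed
    show ?thesis
      unfolding W1_energy_lin[OF assms(1) q vw]
      using le[OF v(3) w(3)] le[OF v(2) w(2)] by (simp add: W1_energy_def algebra_simps)
  qed
  show "W1_norm q \<Omega> (\<lambda>x. v x + w x) \<le> W1_norm q \<Omega> v + W1_norm q \<Omega> w"
    if "v \<in> W1 q \<Omega>" "w \<in> W1 q \<Omega>" for v w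
    unfolding W1_norm_energy
    by (rule minkowski_of_convex[where X="W1 q \<Omega>"])
      (use assms(2) W1_energy_nonneg lin convex hom that in auto)
qed

lemma test_function_in_W1:
  assumes "open \<Omega>" "q > 0" "\<phi> \<in> test_functions \<Omega>"
  shows "\<phi> \<in> W1 q \<Omega>"
proof -
  have \<Omega>: "\<Omega> \<in> sets lebesgue" using assms(1) by (intro sets_completionI_sets) simp
  have K: "compact (closure {x. \<phi> x \<noteq> 0})" "C_k 0 \<phi>"
    using assms(3) unfolding test_functions_def by blast+
  have Lp: "f \<in> Lp q \<Omega>" if "continuous_on UNIV f" "compact K" "\<And>x. x \<notin> K \<Longrightarrow> f x = 0"
    for f :: "real^3 \<Rightarrow> 'z::euclidean_space" and K
  proof -
    have "continuous_on UNIV (\<lambda>x. norm (f x) powr q)"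
      using that(1) assms(2) by (intro continuous_on_powr' continuous_intros) auto
    then have "integrable lborel (\<lambda>x. norm (f x) powr q)"
      using that by (intro integrable_lborel_compact_support[where K=K]) auto
    then have "integrable lebesgue (\<lambda>x. norm (f x) powr q)"
      by (simp add: integrable_completion borel_measurable_integrable)
    then have "integrable (lebesgue_on \<Omega>) (\<lambda>x. norm (f x) powr q)"
      using integrable_mult_indicator[OF \<Omega>] unfolding integrable_lebesgue_on_iff[OF \<Omega>] by blast
    moreover have "f \<in> borel_measurable (lebesgue_on \<Omega>)"
      using that(1) by (intro measurable_restrict_space1 measurable_completion)
        (simp add: borel_measurable_continuous_onI)
    ultimately show ?thesis by (simp add: Lp_def)
  qed
  have "\<phi> \<in> Lp q \<Omega>"
    using K closure_subset[of "{x. \<phi> x \<noteq> 0}"] by (intro Lp[OF _ K(1)]) auto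
  moreover have "classical_grad \<phi> \<in> Lp q \<Omega>"
    by (rule Lp[OF classical_grad_test_function(1)[OF assms(3)] K(1) classical_grad_test_function(2)[OF assms(3)]])
  ultimately show ?thesis
    using classical_grad_is_weak_gradient[OF assms(1,3)] unfolding W1_def by blast
qed

text \<open>Linear combinations of approximating test functions approximate the linear combination, by
  the triangle inequality of the ambient space \<^const>\<open>W1\<close>.\<close>

lemma W1_0_seminormed:
  assumes "open \<Omega>" "q \<ge> 1"
  shows "seminormed (W1_0 q \<Omega>) (W1_norm q \<Omega>)"
proof -
  interpret W: seminormed "W1 q \<Omega>" "W1_norm q \<Omega>" by (rule W1_seminormed[OF assms])
  have q: "q > 0" using assms(2) by simp
  have test0: "(\<lambda>x. 0) \<in> test_functions \<Omega>" by (simp add: test_functions_def C_k_const)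
  have zero: "(\<lambda>x. 0) \<in> W1_0 q \<Omega>"
  proof -
    have "(\<lambda>n::nat. W1_norm q \<Omega> ((\<lambda>x. 0) - (\<lambda>x. 0))) \<longlonglongrightarrow> 0"
      by (simp add: fun_diff_def W.N_zero)
    then show ?thesis
      using test0 W.zero by (auto simp: W1_0_def intro!: exI[of _ "\<lambda>n x. 0"])
  qed
  have lin: "(\<lambda>x. a *\<^sub>R v x + b *\<^sub>R w x) \<in> W1_0 q \<Omega>" if vw: "v \<in> W1_0 q \<Omega>" "w \<in> W1_0 q \<Omega>" for v w a b
  proof -
    obtain \<phi> where \<phi>: "\<And>n. \<phi> n \<in> test_functions \<Omega>" "(\<lambda>n::nat. W1_norm q \<Omega> (\<phi> n - v)) \<longlonglongrightarrow> 0" and v: "v \<in> W1 q \<Omega>"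
      using vw(1) by (auto simp: W1_0_def)
    obtain \<psi> where \<psi>: "\<And>n. \<psi> n \<in> test_functions \<Omega>" "(\<lambda>n::nat. W1_norm q \<Omega> (\<psi> n - w)) \<longlonglongrightarrow> 0" and w: "w \<in> W1 q \<Omega>"
      using vw(2) by (auto simp: W1_0_def)
    define \<rho> where "\<rho> = (\<lambda>n x. a *\<^sub>R \<phi> n x + b *\<^sub>R \<psi> n x)"
    have W: "\<phi> n - v \<in> W1 q \<Omega>" "\<psi> n - w \<in> W1 q \<Omega>" for n
      by (intro W.diff v w test_function_in_W1 assms q \<phi> \<psi>)+
    have le: "W1_norm q \<Omega> (\<rho> n - (\<lambda>x. a *\<^sub>R v x + b *\<^sub>R w x)) \<le>
        \<bar>a\<bar> * W1_norm q \<Omega> (\<phi> n - v) + \<bar>b\<bar> * W1_norm q \<Omega> (\<psi> n - w)" for n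
    proof -
      have "\<rho> n - (\<lambda>x. a *\<^sub>R v x + b *\<^sub>R w x) = (\<lambda>x. a *\<^sub>R (\<phi> n - v) x + b *\<^sub>R (\<psi> n - w) x)"
        by (simp add: \<rho>_def fun_eq_iff algebra_simps)
      then show ?thesis
        using W.triangle[OF W.scaleX[OF W(1)] W.scaleX[OF W(2)], of a n b n]
        unfolding W.scale[OF W(1)] W.scale[OF W(2)] by simp
    qed
    have lim0: "(\<lambda>n. \<bar>a\<bar> * W1_norm q \<Omega> (\<phi> n - v) + \<bar>b\<bar> * W1_norm q \<Omega> (\<psi> n - w)) \<longlonglongrightarrow> 0"
      using tendsto_add[OF tendsto_mult_left[OF \<phi>(2), of "\<bar>a\<bar>"] tendsto_mult_left[OF \<psi>(2), of "\<bar>b\<bar>"]] by simp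
    have "(\<lambda>n. W1_norm q \<Omega> (\<rho> n - (\<lambda>x. a *\<^sub>R v x + b *\<^sub>R w x))) \<longlonglongrightarrow> 0"
      by (rule tendsto_sandwich[OF _ _ tendsto_const lim0]) (use W.nonneg le in auto)
    moreover have "\<rho> n \<in> test_functions \<Omega>" for n
      unfolding \<rho>_def by (intro test_function_lin \<phi> \<psi>)
    ultimately show ?thesis
      using W.lin[OF v w] by (auto simp: W1_0_def intro!: exI[of _ \<rho>])
  qed
  have sub: "W1_0 q \<Omega> \<subseteq> W1 q \<Omega>" by (auto simp: W1_0_def)
  show ?thesis
  proof
    show "W1_0 q \<Omega> \<noteq> {}" using zero by blast
    show "W1_norm q \<Omega> (\<lambda>x. v x + w x) \<le> W1_norm q \<Omega> v + W1_norm q \<Omega> w"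
      if "v \<in> W1_0 q \<Omega>" "w \<in> W1_0 q \<Omega>" for v w
      using that sub by (intro W.triangle) auto
  qed (use lin sub W.nonneg W.scale in auto)
qed

lemma W1_0_dual_eq:
  assumes "seminormed (W1_0 q \<Omega>) (W1_norm q \<Omega>)"
  shows "W1_0_dual q \<Omega> = seminormed.dual (W1_0 q \<Omega>) (W1_norm q \<Omega>)"
    and "W1_0_dual_norm q \<Omega> = seminormed.dual_norm (W1_0 q \<Omega>) (W1_norm q \<Omega>)"
  using assms by (simp_all add: W1_0_dual_def seminormed.dual_def W1_0_dual_norm_def seminormed.dual_norm_def fun_eq_iff)

section \<open>Strongly measurable functions of time\<close>

text \<open>Strong measurability only provides limits almost everywhere; these are measurable because
  Lebesgue measure is complete.\<close>

lemma borel_measurable_AE_LIMSEQ: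
  fixes s :: "nat \<Rightarrow> 'a::euclidean_space \<Rightarrow> real"
  assumes S: "S \<in> sets lebesgue" and s: "\<And>n. s n \<in> borel_measurable (lebesgue_on S)"
    and lim: "AE x in lebesgue_on S. (\<lambda>n. s n x) \<longlonglongrightarrow> g x"
  shows "g \<in> borel_measurable (lebesgue_on S)"
proof (rule borel_measurable_AE_lebesgue_on[OF S])
  show "(\<lambda>x. lim (\<lambda>n. s n x)) \<in> borel_measurable (lebesgue_on S)"
    using s by measurable
  show "AE x in lebesgue_on S. lim (\<lambda>n. s n x) = g x"
    using lim by eventually_elim (rule limI)
qed

lemma tendsto_of_abs_le:
  fixes f g :: "nat \<Rightarrow> real"
  assumes "\<And>n. \<bar>f n - L\<bar> \<le> g n" "g \<longlonglongrightarrow> 0"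
  shows "f \<longlonglongrightarrow> L"
proof -
  have "(\<lambda>n. f n - L) \<longlonglongrightarrow> 0"
    by (rule Lim_null_comparison[OF _ assms(2)]) (simp add: assms(1))
  then show ?thesis by (simp add: LIM_zero_iff)
qed

lemma measurable_simple_compose:
  assumes s: "simple_function M s" and f: "\<And>w. w \<in> s ` space M \<Longrightarrow> f w \<in> borel_measurable M"
  shows "(\<lambda>t. f (s t) t) \<in> borel_measurable M"
proof (rule measurable_compose_countable'[where I="s ` space M"])
  show "countable (s ` space M)" using s by (intro countable_finite) (simp add: simple_function_def)
  show "s \<in> measurable M (count_space (s ` space M))"
  proof (rule measurable_count_space_eq2[THEN iffD2, rotated])
    show "finite (s ` space M)" using s by (simp add: simple_function_def)
    show "s \<in> space M \<rightarrow> s ` space M \<and> (\<forall>a\<in>s ` space M. s -` {a} \<inter> space M \<in> sets M)"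
      using s by (auto simp: simple_function_def)
  qed
qed (rule f)

context seminormed
begin

lemma measurable_dual_app:
  assumes S: "S \<in> sets lebesgue" and l: "l \<in> bochner_Lp r (lebesgue_on S) dual dual_norm" and w: "w \<in> X"
  shows "(\<lambda>t::real. l t w) \<in> borel_measurable (lebesgue_on S)"
proof -
  let ?M = "lebesgue_on S"
  obtain s where s: "\<And>n. simple_function ?M (s n)" "\<And>n. s n ` space ?M \<subseteq> dual"
    and lim: "AE t in ?M. (\<lambda>n::nat. dual_norm (s n t - l t)) \<longlonglongrightarrow> 0"
    using l by (auto simp: bochner_Lp_def strongly_measurable_def)
  have lX: "AE t in ?M. l t \<in> dual" using l by (simp add: bochner_Lp_def)
  have "(\<lambda>t. s n t w) \<in> borel_measurable ?M" for n
    using measurable_simple_compose[OF s(1)[of n], of "\<lambda>l t. l w"] by simp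
  then show ?thesis
  proof (rule borel_measurable_AE_LIMSEQ[OF S])
    show "AE t in ?M. (\<lambda>n. s n t w) \<longlonglongrightarrow> l t w"
      using lim lX AE_space
    proof eventually_elim
      case (elim t)
      have "\<bar>s n t w - l t w\<bar> \<le> dual_norm (s n t - l t) * N w" for n
        using dual_norm_bound[OF dual_diff[of "s n t" "l t"] w] s(2)[of n] elim by auto
      moreover have "(\<lambda>n. dual_norm (s n t - l t) * N w) \<longlonglongrightarrow> 0"
        using tendsto_mult_right[OF elim(1), of "N w"] by simp
      ultimately show ?case by (rule tendsto_of_abs_le)
    qed
  qed
qed

lemma bochner_LpE:
  assumes "u \<in> bochner_Lp q M X N"
  obtains s where "\<And>n. simple_function M (s n)" "\<And>n t. t \<in> space M \<Longrightarrow> s n t \<in> X"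
    "AE t in M. (\<lambda>n::nat. N (s n t - u t)) \<longlonglongrightarrow> 0"
proof -
  obtain s where "(\<forall>n. simple_function M (s n) \<and> s n ` space M \<subseteq> X) \<and>
          (AE t in M. (\<lambda>n::nat. N (s n t - u t)) \<longlonglongrightarrow> 0)"
    using assms by (auto simp: bochner_Lp_def strongly_measurable_def)
  then show ?thesis by (intro that[of s]) auto
qed

lemma measurable_N_diff:
  assumes S: "S \<in> sets lebesgue" and u: "u \<in> bochner_Lp q (lebesgue_on S) X N" and w: "w \<in> X"
  shows "(\<lambda>t::real. N (w - u t)) \<in> borel_measurable (lebesgue_on S)"
proof -
  let ?M = "lebesgue_on S"
  obtain s where s: "\<And>n. simple_function ?M (s n)" "\<And>n t. t \<in> space ?M \<Longrightarrow> s n t \<in> X"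
    and lim: "AE t in ?M. (\<lambda>n::nat. N (s n t - u t)) \<longlonglongrightarrow> 0"
    by (rule bochner_LpE[OF u]) (rule that; assumption)
  have uX: "AE t in ?M. u t \<in> X" using u by (simp add: bochner_Lp_def)
  have "(\<lambda>t. N (w - s n t)) \<in> borel_measurable ?M" for n
    using measurable_simple_compose[OF s(1)[of n], of "\<lambda>v t. N (w - v)"] by simp
  then show ?thesis
  proof (rule borel_measurable_AE_LIMSEQ[OF S])
    show "AE t in ?M. (\<lambda>n. N (w - s n t)) \<longlonglongrightarrow> N (w - u t)"
      using lim uX AE_space
    proof eventually_elim
      case (elim t)
      have "\<bar>N (w - s n t) - N (w - u t)\<bar> \<le> N (s n t - u t)" for n
        using diff_diff_triangle[OF s(2)[OF elim(3)] elim(2) w]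
          diff_commute[OF w s(2)[OF elim(3)]] diff_commute[OF w elim(2)] by simp
      then show ?case using elim(1) by (rule tendsto_of_abs_le)
    qed
  qed
qed

lemma measurable_N:
  assumes S: "S \<in> sets lebesgue" and u: "u \<in> bochner_Lp q (lebesgue_on S) X N"
  shows "(\<lambda>t::real. N (u t)) \<in> borel_measurable (lebesgue_on S)"
proof (rule borel_measurable_AE_lebesgue_on[OF S measurable_N_diff[OF S u zero]])
  have "AE t in lebesgue_on S. u t \<in> X" using u by (simp add: bochner_Lp_def)
  then show "AE t in lebesgue_on S. N ((\<lambda>x. 0) - u t) = N (u t)"
    by eventually_elim (use scale[of _ "-1"] in \<open>simp add: fun_diff_def\<close>)
qed

text \<open>On the simple approximations of \<open>u\<close> the pairing is measurable by \<open>measurable_dual_app\<close>, and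
  it depends continuously on its second argument.\<close>

lemma measurable_dual_pairing:
  assumes S: "S \<in> sets lebesgue" and l: "l \<in> bochner_Lp r (lebesgue_on S) dual dual_norm"
    and u: "u \<in> bochner_Lp q (lebesgue_on S) X N"
  shows "(\<lambda>t::real. l t (u t)) \<in> borel_measurable (lebesgue_on S)"
proof -
  let ?M = "lebesgue_on S"
  obtain s where s: "\<And>n. simple_function ?M (s n)" "\<And>n t. t \<in> space ?M \<Longrightarrow> s n t \<in> X"
    and lim: "AE t in ?M. (\<lambda>n::nat. N (s n t - u t)) \<longlonglongrightarrow> 0"
    by (rule bochner_LpE[OF u]) (rule that; assumption)
  have uX: "AE t in ?M. u t \<in> X" "AE t in ?M. l t \<in> dual" using u l by (auto simp: bochner_Lp_def)
  have "(\<lambda>t. l t (s n t)) \<in> borel_measurable ?M" for n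
    using s(2) by (intro measurable_simple_compose[OF s(1)[of n], of "\<lambda>v t. l t v"] measurable_dual_app[OF S l]) auto
  then show ?thesis
  proof (rule borel_measurable_AE_LIMSEQ[OF S])
    show "AE t in ?M. (\<lambda>n. l t (s n t)) \<longlonglongrightarrow> l t (u t)"
      using lim uX AE_space
    proof eventually_elim
      case (elim t)
      have "\<bar>l t (s n t) - l t (u t)\<bar> \<le> dual_norm (l t) * N (s n t - u t)" for n
        using dual_norm_bound[OF elim(3) diff[OF s(2)[OF elim(4)] elim(2)]]
        by (simp add: dual_app_diff[OF elim(3) s(2)[OF elim(4)] elim(2)])
      moreover have "(\<lambda>n. dual_norm (l t) * N (s n t - u t)) \<longlonglongrightarrow> 0"
        using tendsto_mult_left[OF elim(1), of "dual_norm (l t)"] by simp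
      ultimately show ?case by (rule tendsto_of_abs_le)
    qed
  qed
qed

text \<open>Given simple functions that converge to \<open>u\<close> almost everywhere, discard their values where
  the seminorm exceeds twice that of \<open>u\<close>. Then the error is at most \<open>3 * N (u t)\<close>, and dominated
  convergence applies.\<close>

lemma simple_approximation:
  assumes S: "S \<in> sets lebesgue" and q: "q > 0"
    and u: "u \<in> bochner_Lp q (lebesgue_on S) X N" and "\<epsilon> > 0"
  obtains \<sigma> where "simple_function (lebesgue_on S) \<sigma>" "\<And>t::real. t \<in> S \<Longrightarrow> \<sigma> t \<in> X"
    "integrable (lebesgue_on S) (\<lambda>t. N (\<sigma> t - u t) powr q)"
    "(LINT t|lebesgue_on S. N (\<sigma> t - u t) powr q) < \<epsilon>"
proof -
  let ?M = "lebesgue_on S"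
  obtain s where s: "\<And>n. simple_function ?M (s n)" "\<And>n t. t \<in> space ?M \<Longrightarrow> s n t \<in> X"
    and lim: "AE t in ?M. (\<lambda>n::nat. N (s n t - u t)) \<longlonglongrightarrow> 0"
    by (rule bochner_LpE[OF u]) (rule that; assumption)
  have uX: "AE t in ?M. u t \<in> X" and ui: "integrable ?M (\<lambda>t. N (u t) powr q)"
    using u by (auto simp: bochner_Lp_def)
  define A where "A = (\<lambda>n. {t \<in> space ?M. N (s n t) \<le> 2 * N (u t)})"
  define \<sigma> where "\<sigma> = (\<lambda>n t. if t \<in> A n then s n t else (\<lambda>x. 0))"
  have A: "A n \<in> sets ?M" for n
  proof -
    have [measurable]: "(\<lambda>t. N (s n t)) \<in> borel_measurable ?M"
      using measurable_simple_compose[OF s(1)[of n], of "\<lambda>v t. N v"] by simp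
    have [measurable]: "(\<lambda>t. N (u t)) \<in> borel_measurable ?M" by (rule measurable_N[OF S u])
    show ?thesis unfolding A_def by measurable
  qed
  have \<sigma>s: "simple_function ?M (\<sigma> n)" for n
    unfolding \<sigma>_def using A[of n] sets.sets_into_space[OF A[of n]]
    by (intro simple_function_If_set s simple_function_const) (simp add: Int_absorb2)
  have \<sigma>X: "\<sigma> n t \<in> X" if "t \<in> S" for n t
    using s(2) zero that by (auto simp: \<sigma>_def)
  have le: "AE t in ?M. N (\<sigma> n t - u t) \<le> 3 * N (u t)" for n
    using uX AE_space
  proof eventually_elim
    case (elim t)
    have "N (\<sigma> n t - u t) \<le> N (\<sigma> n t) + N (u t)"
      using \<sigma>X elim by (intro diff_triangle) auto
    also have "N (\<sigma> n t) \<le> 2 * N (u t)"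
      using nonneg[of "u t"] by (auto simp: \<sigma>_def A_def N_zero)
    finally show ?case by simp
  qed
  have lim\<sigma>: "AE t in ?M. (\<lambda>n. N (\<sigma> n t - u t)) \<longlonglongrightarrow> 0"
    using lim uX AE_space
  proof eventually_elim
    case (elim t)
    have N0: "N ((\<lambda>x. 0) - u t) = N (u t)"
      using scale[OF elim(2), of "-1"] by (simp add: fun_diff_def)
    show ?case
    proof (cases "N (u t) = 0")
      case True
      have "N (\<sigma> n t - u t) \<le> N (s n t - u t)" for n
        using True nonneg N0 by (auto simp: \<sigma>_def)
      then show ?thesis
        using nonneg by (intro tendsto_sandwich[OF _ _ tendsto_const elim(1)]) auto
    next
      case False
      then have p: "N (u t) > 0" using nonneg[of "u t"] by simp
      have "\<forall>\<^sub>F n in sequentially. N (s n t - u t) < N (u t)"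
        using order_tendstoD(2)[OF elim(1) p] .
      then have "\<forall>\<^sub>F n in sequentially. N (s n t - u t) = N (\<sigma> n t - u t)"
      proof eventually_elim
        case (elim n)
        have "N (s n t) - N (u t) \<le> N (s n t - u t)"
          using diff_diff_triangle[OF s(2)[OF \<open>t \<in> space ?M\<close>] \<open>u t \<in> X\<close> zero, of n]
          by (simp add: fun_diff_def)
        then have "t \<in> A n" using elim \<open>t \<in> space ?M\<close> by (simp add: A_def)
        then show ?case by (simp add: \<sigma>_def)
      qed
      then show ?thesis by (rule Lim_transform_eventually[OF elim(1)])
    qed
  qed
  have m: "(\<lambda>t. N (\<sigma> n t - u t) powr q) \<in> borel_measurable ?M" for n
  proof -
    have [measurable]: "(\<lambda>t. N (\<sigma> n t - u t)) \<in> borel_measurable ?M"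
      using \<sigma>X by (intro measurable_simple_compose[OF \<sigma>s[of n], of "\<lambda>v t. N (v - u t)"] measurable_N_diff[OF S u]) auto
    show ?thesis by measurable
  qed
  have wi: "integrable ?M (\<lambda>t. 3 powr q * N (u t) powr q)" using ui by simp
  have bd: "AE t in ?M. norm (N (\<sigma> n t - u t) powr q) \<le> 3 powr q * N (u t) powr q" for n
    using le[of n]
  proof eventually_elim
    case (elim t)
    have "N (\<sigma> n t - u t) powr q \<le> (3 * N (u t)) powr q"
      using elim q nonneg by (intro powr_mono2) auto
    then show ?case using nonneg by (simp add: powr_mult)
  qed
  have "(\<lambda>n. LINT t|?M. N (\<sigma> n t - u t) powr q) \<longlonglongrightarrow> (LINT t|?M. 0)"
  proof (rule integral_dominated_convergence[OF _ m wi _ bd])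
    show "AE t in ?M. (\<lambda>n. N (\<sigma> n t - u t) powr q) \<longlonglongrightarrow> 0"
      using lim\<sigma>
    proof eventually_elim
      case (elim t)
      have "(\<lambda>n. N (\<sigma> n t - u t) powr q) \<longlonglongrightarrow> 0 powr q"
        using q elim nonneg by (intro tendsto_powr' tendsto_const) auto
      then show ?case by simp
    qed
  qed simp
  then have "\<forall>\<^sub>F n in sequentially. (LINT t|?M. N (\<sigma> n t - u t) powr q) < \<epsilon>"
    using \<open>\<epsilon> > 0\<close> by (intro order_tendstoD(2)) auto
  then obtain n where "(LINT t|?M. N (\<sigma> n t - u t) powr q) < \<epsilon>"
    by (auto simp: eventually_sequentially)
  moreover have "integrable ?M (\<lambda>t. N (\<sigma> n t - u t) powr q)"
    by (rule Bochner_Integration.integrable_bound[OF wi m]) (use bd[of n] in auto)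
  ultimately show ?thesis using that[of "\<sigma> n"] \<sigma>s \<sigma>X by auto
qed

end

section \<open>Difference quotients of primitives\<close>

definition primitive :: "(real \<Rightarrow> real) \<Rightarrow> real \<Rightarrow> real" where
  "primitive g t = (LINT \<tau>|lebesgue. indicator {..t} \<tau> * g \<tau>)"

lemma integrable_indicator_times:
  fixes g :: "real \<Rightarrow> real"
  assumes "integrable lebesgue g" "A \<in> sets lebesgue"
  shows "integrable lebesgue (\<lambda>\<tau>. indicator A \<tau> * g \<tau>)"
  using integrable_mult_indicator[OF assms(2,1)] by simp

lemma integrable_indicator_bounded:
  fixes A :: "real set"
  shows "bounded A \<Longrightarrow> A \<in> sets lebesgue \<Longrightarrow> integrable lebesgue (indicator A :: real \<Rightarrow> real)"
  using bounded_set_imp_lmeasurable by (simp add: lmeasurable_iff_integrable)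

lemma primitive_diff:
  assumes "integrable lebesgue g" "s \<le> t"
  shows "primitive g t - primitive g s = (LINT \<tau>|lebesgue. indicator {s<..t} \<tau> * g \<tau>)"
proof -
  have "primitive g t - primitive g s = (LINT \<tau>|lebesgue. indicator {..t} \<tau> * g \<tau> - indicator {..s} \<tau> * g \<tau>)"
    unfolding primitive_def using assms(1) by (intro Bochner_Integration.integral_diff[symmetric] integrable_indicator_times) auto
  also have "\<dots> = (LINT \<tau>|lebesgue. indicator {s<..t} \<tau> * g \<tau>)"
    using assms(2) by (intro Bochner_Integration.integral_cong) (auto simp: indicator_def)
  finally show ?thesis .
qed

lemma primitive_diff_mono:
  assumes "integrable lebesgue g" "integrable lebesgue k" "s \<le> t"
    and "AE \<tau> in lebesgue. \<tau> \<in> {s<..t} \<longrightarrow> g \<tau> \<le> k \<tau>"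
  shows "primitive g t - primitive g s \<le> primitive k t - primitive k s"
  unfolding primitive_diff[OF assms(1,3)] primitive_diff[OF assms(2,3)]
  using assms by (intro integral_mono_AE integrable_indicator_times) (auto simp: indicator_def)

lemma primitive_lin:
  assumes "integrable lebesgue g" "integrable lebesgue k"
  shows "primitive (\<lambda>\<tau>. a * g \<tau> + b * k \<tau>) t = a * primitive g t + b * primitive k t"
proof -
  have "primitive (\<lambda>\<tau>. a * g \<tau> + b * k \<tau>) t = (LINT \<tau>|lebesgue. a * (indicator {..t} \<tau> * g \<tau>) + b * (indicator {..t} \<tau> * k \<tau>))"
    unfolding primitive_def by (intro Bochner_Integration.integral_cong) (auto simp: algebra_simps)
  then show ?thesis
    using integrable_indicator_times[OF assms(1), of "{..t}"] integrable_indicator_times[OF assms(2), of "{..t}"]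
    by (simp add: primitive_def)
qed

lemma primitive_indicator_increment:
  assumes S: "bounded S" "S \<in> sets lebesgue" and h: "0 \<le> h"
  shows "primitive (indicator S) (t + h) - primitive (indicator S) t \<le> h"
proof -
  note i = integrable_indicator_bounded[OF S]
  have "primitive (indicator S) (t + h) - primitive (indicator S) t = (LINT \<tau>|lebesgue. indicator {t<..t + h} \<tau> * indicator S \<tau>)"
    using h by (intro primitive_diff i) simp
  also have "\<dots> \<le> (LINT \<tau>|lebesgue. indicator {t<..t + h} \<tau>)"
    using i by (intro integral_mono integrable_indicator_times) (auto intro!: integrable_indicator_bounded split: split_indicator)
  also have "\<dots> = h" using h by simp
  finally show ?thesis .
qed

lemma continuous_primitive:
  assumes g: "integrable lebesgue g"
  shows "continuous_on UNIV (primitive g)"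
proof -
  have "isCont (primitive g) t" for t
    unfolding continuous_at_sequentially
  proof (intro allI impI)
    fix x :: "nat \<Rightarrow> real" assume x: "x \<longlonglongrightarrow> t"
    have m: "(\<lambda>\<tau>. indicator {..s} \<tau> * g \<tau>) \<in> borel_measurable lebesgue" for s :: real
      by (intro borel_measurable_integrable integrable_indicator_times g) auto
    have "AE \<tau> in lebesgue. \<tau> \<noteq> t"
      using AE_lborel_singleton[of t] by (rule AE_completion)
    then have lim: "AE \<tau> in lebesgue. (\<lambda>n. indicator {..x n} \<tau> * g \<tau>) \<longlonglongrightarrow> indicator {..t} \<tau> * g \<tau>"
    proof eventually_elim
      case (elim \<tau>)
      have "\<forall>\<^sub>F n in sequentially. indicator {..t} \<tau> * g \<tau> = indicator {..x n} \<tau> * g \<tau>"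
      proof (cases "\<tau> < t")
        case True
        from order_tendstoD(1)[OF x True] show ?thesis
          by (rule eventually_mono) (use True in \<open>auto simp: indicator_def\<close>)
      next
        case False
        then have "t < \<tau>" using elim by simp
        from order_tendstoD(2)[OF x this] show ?thesis
          by (rule eventually_mono) (use \<open>t < \<tau>\<close> in \<open>auto simp: indicator_def\<close>)
      qed
      then show ?case by (rule Lim_transform_eventually[OF tendsto_const])
    qed
    show "(primitive g \<circ> x) \<longlonglongrightarrow> primitive g t"
      unfolding primitive_def comp_def
      by (rule integral_dominated_convergence[OF m m _ lim, where w="\<lambda>\<tau>. norm (g \<tau>)"])
        (use g in \<open>auto simp: indicator_def\<close>)
  qed
  then show ?thesis by (simp add: continuous_on_eq_continuous_at)
qed

text \<open>Increments in time tend to 0 along this one sequence.\<close>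

definition step :: "nat \<Rightarrow> real" where "step n = inverse (real (Suc n))"

lemma step: "0 < step n" "step n \<le> 1" "step \<longlonglongrightarrow> 0"
  using LIMSEQ_inverse_real_of_nat by (auto simp: step_def[abs_def] inverse_le_1_iff)

definition diff_quot :: "(real \<Rightarrow> real) \<Rightarrow> nat \<Rightarrow> real \<Rightarrow> real" where
  "diff_quot F n t = (F (t + step n) - F t) / step n"

lemma continuous_diff_quot:
  assumes "continuous_on UNIV F"
  shows "continuous_on UNIV (diff_quot F n)"
proof -
  have "continuous_on UNIV (\<lambda>t. F (t + step n))"
    by (rule continuous_on_compose2[OF assms]) (auto intro!: continuous_intros)
  then show ?thesis
    unfolding diff_quot_def[abs_def] using step(1)[of n] assms
    by (intro continuous_on_divide continuous_on_diff continuous_on_const) auto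
qed

lemma integrable_diff_quot:
  assumes F: "continuous_on UNIV F" and A: "A \<in> sets lebesgue" "A \<subseteq> {c..d}"
  shows "integrable lebesgue (\<lambda>t. indicator A t * diff_quot F n t)"
proof -
  have "integrable lborel (\<lambda>t. indicator {c..d} t *\<^sub>R diff_quot F n t)"
    using continuous_diff_quot[OF F, of n] by (intro borel_integrable_compact) (auto intro: continuous_on_subset)
  then have "integrable lebesgue (\<lambda>t. indicator {c..d} t *\<^sub>R diff_quot F n t)"
    by (simp add: integrable_completion borel_measurable_integrable)
  from integrable_indicator_times[OF _ A(1), of "\<lambda>t. indicator {c..d} t *\<^sub>R diff_quot F n t"] this
  have "integrable lebesgue (\<lambda>t. indicator A t * (indicator {c..d} t *\<^sub>R diff_quot F n t))" by blast
  moreover have "indicator A t * (indicator {c..d} t *\<^sub>R diff_quot F n t) = indicator A t * diff_quot F n t" for t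
    using A(2) by (auto simp: indicator_def)
  ultimately show ?thesis by (simp only:)
qed

text \<open>With an antiderivative \<open>P\<close> of \<open>F\<close>, the integral is the difference of the quotients of \<open>P\<close> at
  \<open>d\<close> and at \<open>c\<close>.\<close>

lemma integral_diff_quot_tendsto:
  assumes F: "continuous_on UNIV F" and cd: "c \<le> d"
  shows "(\<lambda>n. LINT t|lebesgue. indicator {c<..<d} t * diff_quot F n t) \<longlonglongrightarrow> F d - F c"
proof -
  have cF: "continuous_on A F" for A using F continuous_on_subset by blast
  obtain P where P: "\<And>x. x \<in> {c-1..d+2} \<Longrightarrow> (P has_vector_derivative F x) (at x within {c-1..d+2})"
    using antiderivative_continuous[OF cF] by blast
  have P': "(P has_real_derivative F x) (at x)" if "c - 1 < x" "x < d + 2" for x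
    using P[of x] that at_within_Icc_at[of "c-1" x "d+2"]
    by (simp add: has_real_derivative_iff_has_vector_derivative)
  have eq: "(LINT t|lebesgue. indicator {c<..<d} t * diff_quot F n t) = (P (d + step n) - P d) / step n - (P (c + step n) - P c) / step n" for n
  proof -
    have D: "((\<lambda>t. (P (t + step n) - P t) / step n) has_real_derivative diff_quot F n t) (at t)" if "c \<le> t" "t \<le> d" for t
    proof -
      have "((\<lambda>t. P (t + step n)) has_real_derivative F (t + step n)) (at t)"
        using that step(1,2)[of n] by (intro DERIV_shift[THEN iffD1] P') auto
      moreover have "(P has_real_derivative F t) (at t)"
        using that by (intro P') auto
      ultimately show ?thesis
        unfolding diff_quot_def by (intro DERIV_cdivide DERIV_diff)
    qed
    have "(LINT t|lborel. indicator {c..d} t *\<^sub>R diff_quot F n t) = (P (d + step n) - P d) / step n - (P (c + step n) - P c) / step n"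
    proof (rule integral_FTC_atLeastAtMost[OF cd])
      show "((\<lambda>t. (P (t + step n) - P t) / step n) has_vector_derivative diff_quot F n t) (at t within {c..d})" if "c \<le> t" "t \<le> d" for t
        using D[OF that] by (simp add: has_real_derivative_iff_has_vector_derivative has_vector_derivative_at_within)
    qed (use continuous_diff_quot[OF F, of n] continuous_on_subset in blast)
    moreover have "(LINT t|lebesgue. indicator {c<..<d} t * diff_quot F n t) = (LINT t|lebesgue. indicator {c..d} t * diff_quot F n t)"
    proof (rule integral_cong_AE)
      show "(\<lambda>t. indicator {c<..<d} t * diff_quot F n t) \<in> borel_measurable lebesgue"
        "(\<lambda>t. indicator {c..d} t * diff_quot F n t) \<in> borel_measurable lebesgue"
        by (auto intro!: borel_measurable_integrable integrable_diff_quot[OF F, of _ c d])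
      have "AE t in lebesgue. t \<noteq> c \<and> t \<noteq> d"
        using AE_lborel_singleton[of c] AE_lborel_singleton[of d] by (intro AE_completion) auto
      then show "AE t in lebesgue. indicator {c<..<d} t * diff_quot F n t = indicator {c..d} t * diff_quot F n t"
        by eventually_elim (auto simp: indicator_def)
    qed
    moreover have "(\<lambda>t. indicator {c..d} t * diff_quot F n t) \<in> borel_measurable lborel"
      using borel_measurable_continuous_onI[OF continuous_diff_quot[OF F, of n]] by simp
    ultimately show ?thesis by (simp add: integral_completion)
  qed
  have lim: "(\<lambda>n. (P (x + step n) - P x) / step n) \<longlonglongrightarrow> F x" if "c - 1 < x" "x < d + 2" for x
  proof -
    have "((\<lambda>h. (P (x + h) - P x) / h) \<longlongrightarrow> F x) (at 0)" using P'[OF that] by (simp add: DERIV_def)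
    moreover have "filterlim step (at 0) sequentially"
      using step unfolding filterlim_at by (auto intro!: always_eventually simp: less_imp_neq[symmetric])
    ultimately show ?thesis by (rule filterlim_compose)
  qed
  show ?thesis unfolding eq using cd by (intro tendsto_diff lim) auto
qed

text \<open>The difference quotients of the primitive of \<open>g\<close> are averages of \<open>g\<close> over short intervals,
  and they converge weakly to \<open>g\<close>: on intervals by the preceding lemma, and on measurable sets by
  a Dynkin argument. A countable union needs the averages to be equi-integrable. That is what
  \<open>young\<close> supplies: up to a small multiple of averages of \<open>\<mu>\<close>, whose integrals stay bounded, the
  averages of \<open>g\<close> are bounded by a constant.\<close>

lemma integral_diff_quot_primitive_tendsto:
  assumes g: "integrable lebesgue g" and \<mu>: "integrable lebesgue \<mu>"
    and young: "\<And>\<kappa>. \<kappa> > 0 \<Longrightarrow> \<exists>C. AE \<tau> in lebesgue. \<bar>g \<tau>\<bar> \<le> C * indicator {c<..<d} \<tau> + \<kappa> * \<mu> \<tau>"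
    and \<mu>0: "\<And>\<tau>. 0 \<le> \<mu> \<tau>"
    and A: "A \<in> sets lebesgue"
  shows "(\<lambda>n. LINT t|lebesgue. indicator (A \<inter> {c<..<d}) t * diff_quot (primitive g) n t) \<longlonglongrightarrow>
    (LINT t|lebesgue. indicator (A \<inter> {c<..<d}) t * g t)"
  using A
proof (induction A rule: lebesgue_sets_box_induct)
  note cg = continuous_primitive[OF g]
  have iq: "integrable lebesgue (\<lambda>t. indicator (B \<inter> {c<..<d}) t * diff_quot (primitive g) n t)" if "B \<in> sets lebesgue" for B n
    using that by (intro integrable_diff_quot[OF cg, of _ c d]) auto
  have ig: "integrable lebesgue (\<lambda>t. indicator (B \<inter> {c<..<d}) t * g t)" if "B \<in> sets lebesgue" for B
    using that by (intro integrable_indicator_times[OF g]) auto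
  have interval: "(\<lambda>n. LINT t|lebesgue. indicator {a<..<b} t * diff_quot (primitive g) n t) \<longlonglongrightarrow> (LINT t|lebesgue. indicator {a<..<b} t * g t)"
    for a b
  proof (cases "a \<le> b")
    case True
    have "AE t in lebesgue. t \<noteq> b"
      using AE_lborel_singleton[of b] by (intro AE_completion) auto
    then have "(LINT t|lebesgue. indicator {a<..<b} t * g t) = (LINT t|lebesgue. indicator {a<..b} t * g t)"
      by (intro integral_cong_AE borel_measurable_integrable integrable_indicator_times[OF g])
        (auto simp: indicator_def elim!: eventually_mono)
    then show ?thesis
      using integral_diff_quot_tendsto[OF cg True] primitive_diff[OF g True] by simp
  qed simp
  {
    case (box a b)
    have "box a b \<inter> {c<..<d} = {max a c<..<min b d}" by (auto simp: box_real)
    then show ?case using interval by simp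
  next
    case empty
    then show ?case by simp
  next
    case (compl B)
    have "(\<lambda>n. (LINT t|lebesgue. indicator {c<..<d} t * diff_quot (primitive g) n t) - (LINT t|lebesgue. indicator (B \<inter> {c<..<d}) t * diff_quot (primitive g) n t))
      \<longlonglongrightarrow> (LINT t|lebesgue. indicator {c<..<d} t * g t) - (LINT t|lebesgue. indicator (B \<inter> {c<..<d}) t * g t)"
      by (intro tendsto_diff interval compl)
    moreover have "(LINT t|lebesgue. indicator {c<..<d} t * k t) - (LINT t|lebesgue. indicator (B \<inter> {c<..<d}) t * k t) =
        (LINT t|lebesgue. indicator (- B \<inter> {c<..<d}) t * k t)"
      if "\<And>B. B \<in> sets lebesgue \<Longrightarrow> integrable lebesgue (\<lambda>t. indicator (B \<inter> {c<..<d}) t * k t)" for k :: "real \<Rightarrow> real"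
    proof -
      have "(LINT t|lebesgue. indicator (- B \<inter> {c<..<d}) t * k t) =
          (LINT t|lebesgue. indicator {c<..<d} t * k t - indicator (B \<inter> {c<..<d}) t * k t)"
        by (intro Bochner_Integration.integral_cong) (auto simp: indicator_def)
      then show ?thesis
        using that[of UNIV] that[OF compl(1)] by simp
    qed
    ultimately show ?case using iq ig by simp
  next
    case (union B)
    let ?I = "{c<..<d}"
    let ?U = "\<Union>i. B i"
    let ?P = "\<lambda>N. \<Union>i<N. B i"
    define L where "L = (\<lambda>(k :: real \<Rightarrow> real) S. LINT t|lebesgue. indicator (S \<inter> ?I) t * k t)"
    have meas: "?U \<in> sets lebesgue" "?P N \<in> sets lebesgue" for N using union(2) by auto
    have P: "(\<lambda>n. L (diff_quot (primitive g) n) (?P N)) \<longlonglongrightarrow> L g (?P N)" for N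
    proof -
      have sum: "L k (?P N) = (\<Sum>i<N. L k (B i))"
        if "\<And>B. B \<in> sets lebesgue \<Longrightarrow> integrable lebesgue (\<lambda>t. indicator (B \<inter> ?I) t * k t)" for k
      proof -
        have "indicator (?P N \<inter> ?I) t * k t = (\<Sum>i<N. indicator (B i \<inter> ?I) t * k t)" for t
        proof -
          have "indicator (?P N) t = (\<Sum>i<N. indicator (B i) t :: real)"
            using union(1) by (intro indicator_UN_disjoint) (auto simp: disjoint_family_on_def)
          then show ?thesis
            by (simp only: indicator_inter_arith sum_distrib_right)
        qed
        then have "L k (?P N) = (LINT t|lebesgue. (\<Sum>i<N. indicator (B i \<inter> ?I) t * k t))"
          by (simp only: L_def)
        also have "\<dots> = (\<Sum>i<N. L k (B i))"
          unfolding L_def by (intro Bochner_Integration.integral_sum that union(2))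
        finally show ?thesis .
      qed
      have "L (diff_quot (primitive g) n) (?P N) = (\<Sum>i<N. L (diff_quot (primitive g) n) (B i))" for n
        by (rule sum) (rule iq)
      moreover have "L g (?P N) = (\<Sum>i<N. L g (B i))"
        by (rule sum) (rule ig)
      moreover have "(\<lambda>n. \<Sum>i<N. L (diff_quot (primitive g) n) (B i)) \<longlonglongrightarrow> (\<Sum>i<N. L g (B i))"
        using union(3) by (intro tendsto_sum) (simp add: L_def)
      ultimately show ?thesis by simp
    qed
    have tail: "(\<lambda>N. LINT t|lebesgue. indicator ((?U - ?P N) \<inter> ?I) t * k t) \<longlonglongrightarrow> 0"
      if k: "integrable lebesgue k" for k :: "real \<Rightarrow> real"
    proof -
      have "(\<lambda>N. LINT t|lebesgue. indicator ((?U - ?P N) \<inter> ?I) t * k t) \<longlonglongrightarrow> (LINT t|(lebesgue::real measure). 0)"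
      proof (rule integral_dominated_convergence[where w="\<lambda>t. norm (k t)"])
        show "(\<lambda>t. indicator ((?U - ?P N) \<inter> ?I) t * k t) \<in> borel_measurable lebesgue" for N
          using meas by (intro borel_measurable_integrable integrable_indicator_times k) auto
        show "AE t in lebesgue. (\<lambda>N. indicator ((?U - ?P N) \<inter> ?I) t * k t) \<longlonglongrightarrow> 0"
        proof (rule AE_I2)
          fix t
          have "\<forall>\<^sub>F N in sequentially. t \<notin> ?U - ?P N"
          proof (cases "t \<in> ?U")
            case True
            then obtain i where "t \<in> B i" by blast
            then show ?thesis by (auto simp: eventually_sequentially intro!: exI[of _ "Suc i"])
          qed simp
          then have "\<forall>\<^sub>F N in sequentially. indicator ((?U - ?P N) \<inter> ?I) t * k t = 0"
            by eventually_elim (auto simp: indicator_def)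
          then show "(\<lambda>N. indicator ((?U - ?P N) \<inter> ?I) t * k t) \<longlonglongrightarrow> 0"
            by (rule tendsto_eventually)
        qed
      qed (use k in \<open>auto simp: indicator_def\<close>)
      then show ?thesis by simp
    qed
    have L_split: "L k ?U = L k (?P N) + L k (?U - ?P N)"
      if "\<And>B. B \<in> sets lebesgue \<Longrightarrow> integrable lebesgue (\<lambda>t. indicator (B \<inter> ?I) t * k t)" for k N
    proof -
      have "L k ?U = (LINT t|lebesgue. indicator (?P N \<inter> ?I) t * k t + indicator ((?U - ?P N) \<inter> ?I) t * k t)"
        unfolding L_def by (intro Bochner_Integration.integral_cong) (auto simp: indicator_def)
      then show ?thesis
        unfolding L_def using that[OF meas(2)[of N]] that[of "?U - ?P N"] meas by simp
    qed
    have m: "(\<lambda>n. LINT t|lebesgue. indicator ?I t * diff_quot (primitive \<mu>) n t) \<longlonglongrightarrow> primitive \<mu> (max c d) - primitive \<mu> c"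
    proof (cases "c \<le> d")
      case True
      then show ?thesis using integral_diff_quot_tendsto[OF continuous_primitive[OF \<mu>] True] by (simp add: max_absorb2)
    qed simp
    define J where "J = \<bar>primitive \<mu> (max c d) - primitive \<mu> c\<bar> + 1"
    have J: "\<forall>\<^sub>F n in sequentially. (LINT t|lebesgue. indicator ?I t * diff_quot (primitive \<mu>) n t) < J" "J > 0"
      using order_tendstoD(2)[OF m, of J] by (auto simp: J_def)
    show ?case
    proof (rule LIMSEQ_I)
      fix e :: real assume "e > 0"
      \<comment> \<open>The four quarters of \<open>e\<close>: \<open>C\<close> times the measure of the tail, \<open>\<kappa>\<close> times the averages of
        \<open>\<mu>\<close>, the tail of \<open>g\<close>, and the convergence on the first \<open>N\<close> sets.\<close>
      define \<kappa> where "\<kappa> = e / (4 * J)"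
      have \<kappa>: "\<kappa> > 0" "\<kappa> * J = e / 4" using \<open>e > 0\<close> J(2) by (auto simp: \<kappa>_def)
      obtain C0 where C0: "AE \<tau> in lebesgue. \<bar>g \<tau>\<bar> \<le> C0 * indicator ?I \<tau> + \<kappa> * \<mu> \<tau>"
        using young[OF \<kappa>(1)] by blast
      define C where "C = \<bar>C0\<bar> + 1"
      have C: "AE \<tau> in lebesgue. \<bar>g \<tau>\<bar> \<le> C * indicator ?I \<tau> + \<kappa> * \<mu> \<tau>" "C > 0"
        using C0 by (auto simp: C_def elim!: eventually_mono split: split_indicator)
      have one: "integrable lebesgue (indicator ?I :: real \<Rightarrow> real)"
        by (rule integrable_indicator_bounded) auto
      have "\<forall>\<^sub>F N in sequentially. \<bar>L (indicator ?I) (?U - ?P N)\<bar> < e / (4 * C) \<and> \<bar>L g (?U - ?P N)\<bar> < e / 4"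
      proof (rule eventually_conj)
        show "\<forall>\<^sub>F N in sequentially. \<bar>L (indicator ?I) (?U - ?P N)\<bar> < e / (4 * C)"
          using tendstoD[OF tail[OF one] divide_pos_pos[of e "4 * C"]] \<open>e > 0\<close> C(2) by (simp only: zero_less_mult_iff zero_less_numeral simp_thms L_def dist_real_def diff_zero)
        show "\<forall>\<^sub>F N in sequentially. \<bar>L g (?U - ?P N)\<bar> < e / 4"
          using tendstoD[OF tail[OF g], of "e / 4"] \<open>e > 0\<close> by (simp only: L_def dist_real_def diff_zero)
      qed
      then obtain N where N: "\<bar>L (indicator ?I) (?U - ?P N)\<bar> < e / (4 * C)" "\<bar>L g (?U - ?P N)\<bar> < e / 4"
        by (auto simp: eventually_sequentially)
      let ?T = "?U - ?P N"
      have T: "?T \<in> sets lebesgue" using meas by auto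
      have diff_quot_le: "\<bar>diff_quot (primitive g) n t\<bar> \<le> C + \<kappa> * diff_quot (primitive \<mu>) n t" for n t
      proof -
        let ?k = "\<lambda>\<tau>. C * indicator ?I \<tau> + \<kappa> * \<mu> \<tau>"
        have ik: "integrable lebesgue ?k" using one \<mu> by simp
        have pk: "primitive ?k (t + step n) - primitive ?k t \<le> C * step n + \<kappa> * (primitive \<mu> (t + step n) - primitive \<mu> t)"
        proof -
          have "primitive (indicator ?I) (t + step n) - primitive (indicator ?I) t \<le> step n"
            using step(1)[of n] by (intro primitive_indicator_increment) auto
          from mult_left_mono[OF this, of C] show ?thesis
            unfolding primitive_lin[OF one \<mu>] using C(2) by (simp add: algebra_simps)
        qed
        have "primitive g (t + step n) - primitive g t \<le> primitive ?k (t + step n) - primitive ?k t"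
          using C(1) step(1)[of n] by (intro primitive_diff_mono g ik) (auto elim!: eventually_mono)
        moreover have "primitive (\<lambda>\<tau>. - g \<tau>) (t + step n) - primitive (\<lambda>\<tau>. - g \<tau>) t \<le> primitive ?k (t + step n) - primitive ?k t"
          using C(1) step(1)[of n] g by (intro primitive_diff_mono ik) (auto elim!: eventually_mono)
        moreover have "primitive (\<lambda>\<tau>. - g \<tau>) s = - primitive g s" for s
          using primitive_lin[OF g g, of "-1" 0 s] by simp
        ultimately have "\<bar>primitive g (t + step n) - primitive g t\<bar> \<le> C * step n + \<kappa> * (primitive \<mu> (t + step n) - primitive \<mu> t)"
          using pk by simp
        then show ?thesis
          using step(1)[of n] by (simp add: diff_quot_def field_simps)
      qed
      have Ltail: "\<bar>L (diff_quot (primitive g) n) ?T\<bar> < e / 2" if n: "(LINT t|lebesgue. indicator ?I t * diff_quot (primitive \<mu>) n t) < J" for n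
      proof -
        have i\<mu>: "integrable lebesgue (\<lambda>t. indicator ?I t * diff_quot (primitive \<mu>) n t)"
          by (intro integrable_diff_quot[OF continuous_primitive[OF \<mu>], of _ c d]) auto
        have pos: "0 \<le> diff_quot (primitive \<mu>) n t" for t
          using primitive_diff_mono[OF _ \<mu>, of "\<lambda>\<tau>. 0" t "t + step n"] step(1)[of n] \<mu>0
          by (simp add: diff_quot_def primitive_def)
        have iT: "integrable lebesgue (\<lambda>t. indicator (?T \<inter> ?I) t * indicator ?I t :: real)"
          using T by (intro integrable_indicator_times one) auto
        have "\<bar>L (diff_quot (primitive g) n) ?T\<bar> \<le> (LINT t|lebesgue. \<bar>indicator (?T \<inter> ?I) t * diff_quot (primitive g) n t\<bar>)"
          unfolding L_def by (rule integral_abs_bound)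
        also have "\<dots> \<le> (LINT t|lebesgue. C * (indicator (?T \<inter> ?I) t * indicator ?I t) + \<kappa> * (indicator ?I t * diff_quot (primitive \<mu>) n t))"
        proof (rule integral_mono)
          show "integrable lebesgue (\<lambda>t. \<bar>indicator (?T \<inter> ?I) t * diff_quot (primitive g) n t\<bar>)"
            by (intro integrable_abs iq T)
          show "integrable lebesgue (\<lambda>t. C * (indicator (?T \<inter> ?I) t * indicator ?I t) + \<kappa> * (indicator ?I t * diff_quot (primitive \<mu>) n t))"
            using i\<mu> iT by simp
          show "\<bar>indicator (?T \<inter> ?I) t * diff_quot (primitive g) n t\<bar> \<le>
              C * (indicator (?T \<inter> ?I) t * indicator ?I t) + \<kappa> * (indicator ?I t * diff_quot (primitive \<mu>) n t)" for t
            using diff_quot_le[of n t] pos[of t] \<kappa>(1) by (auto simp: indicator_def)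
        qed
        also have "\<dots> = C * L (indicator ?I) ?T + \<kappa> * (LINT t|lebesgue. indicator ?I t * diff_quot (primitive \<mu>) n t)"
          using i\<mu> iT by (simp add: L_def)
        also have "C * L (indicator ?I) ?T < e / 4"
        proof -
          have "L (indicator ?I) ?T < e / (4 * C)" using N(1) by linarith
          then show ?thesis using C(2) by (simp add: field_simps)
        qed
        also have "\<kappa> * (LINT t|lebesgue. indicator ?I t * diff_quot (primitive \<mu>) n t) \<le> e / 4"
          unfolding \<kappa>(2)[symmetric] using n \<kappa>(1) by (intro mult_left_mono) auto
        finally show ?thesis by simp
      qed
      have "\<forall>\<^sub>F n in sequentially. \<bar>L (diff_quot (primitive g) n) ?U - L g ?U\<bar> < e"
      proof -
        have "\<forall>\<^sub>F n in sequentially. \<bar>L (diff_quot (primitive g) n) (?P N) - L g (?P N)\<bar> < e / 4"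
          using tendstoD[OF P, of "e/4" N] \<open>e > 0\<close> by (simp add: dist_real_def)
        with J(1) show ?thesis
        proof eventually_elim
          case (elim n)
          show ?case
            using Ltail[OF elim(1)] elim(2) N(2) L_split[OF iq, of n N] L_split[OF ig, of N]
            by linarith
        qed
      qed
      then show "\<exists>no. \<forall>n\<ge>no. norm ((LINT t|lebesgue. indicator (?U \<inter> ?I) t * diff_quot (primitive g) n t) -
          (LINT t|lebesgue. indicator (?U \<inter> ?I) t * g t)) < e"
        by (simp add: eventually_sequentially L_def)
    qed
  next
    case (null A B)
    have "(LINT t|lebesgue. indicator (A \<inter> {c<..<d}) t * k t) = (LINT t|lebesgue. indicator (B \<inter> {c<..<d}) t * k t)"
      if "\<And>B. B \<in> sets lebesgue \<Longrightarrow> integrable lebesgue (\<lambda>t. indicator (B \<inter> {c<..<d}) t * k t)" for k :: "real \<Rightarrow> real"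
      using null(3) by (intro integral_cong_AE borel_measurable_integrable that null) (auto simp: indicator_def elim!: eventually_mono)
    then show ?case using null(4) iq ig by simp
  }
qed

section \<open>A one-sided chain rule\<close>

text \<open>Young's inequality, weighted so that the term in \<open>m\<close> can be made small.\<close>

lemma young_3_2:
  fixes m n \<kappa> :: real
  assumes "m \<ge> 0" "n \<ge> 0" "\<kappa> > 0"
  shows "m * n \<le> \<kappa> * m powr (3/2) + n powr 3 / \<kappa>\<^sup>2"
proof -
  let ?d = "\<kappa> powr (2/3)"
  have d: "?d > 0" using assms by simp
  have "m * n = (m * ?d) * (n / ?d)" using assms(3) by simp
  also have "\<dots> \<le> (m * ?d) powr (3/2) / (3/2) + (n / ?d) powr 3 / 3"
    using assms d by (intro Youngs_inequality) auto
  also have "(m * ?d) powr (3/2) = \<kappa> * m powr (3/2)"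
    using assms by (simp add: powr_mult powr_powr)
  also have "(n / ?d) powr 3 = n powr 3 / \<kappa>\<^sup>2"
    using assms by (simp add: powr_divide powr_powr)
  also have "\<kappa> * m powr (3/2) / (3/2) + n powr 3 / \<kappa>\<^sup>2 / 3 \<le> \<kappa> * m powr (3/2) + n powr 3 / \<kappa>\<^sup>2"
    using assms by (intro add_mono) (auto simp: field_simps)
  finally show ?thesis .
qed

lemma borel_measurable_indicator_times:
  fixes f :: "'a::euclidean_space \<Rightarrow> real"
  assumes "S \<in> sets lebesgue" "f \<in> borel_measurable (lebesgue_on S)"
  shows "(\<lambda>x. indicator S x * f x) \<in> borel_measurable lebesgue"
  using assms borel_measurable_restrict_space_iff[of S lebesgue f] by simp

text \<open>Divide the hypothesis by \<open>h\<close>, integrate over \<open>t\<close> and let \<open>h\<close> tend to 0. The side of \<open>F\<close>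
  tends to its increment. On the other side, \<open>u\<close> is replaced by a simple function \<open>\<sigma>\<close>: on each set
  where \<open>\<sigma>\<close> takes the value \<open>w\<close>, only the scalar function $l(\tau)\,w$ is left, whose averages
  converge weakly. The error is a pairing of \<open>l \<tau>\<close>, averaged over short intervals, with \<open>\<sigma> t - u
  t\<close>; weighted Young splits it into a small multiple of an integral of \<open>l\<close> and a multiple of the
  distance of \<open>\<sigma>\<close> from \<open>u\<close>.\<close>

lemma (in seminormed) energy_gain:
  fixes T :: real and F :: "real \<Rightarrow> real" and l :: "real \<Rightarrow> ('a \<Rightarrow> 'b) \<Rightarrow> real" and u
  defines "S \<equiv> {0<..<T}"
  assumes T: "T > 0"
    and l: "l \<in> bochner_Lp (3/2) (lebesgue_on S) dual dual_norm"
    and u: "u \<in> bochner_Lp 3 (lebesgue_on S) X N"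
    and F: "continuous_on UNIV F"
    and key: "AE t in lebesgue_on S. \<forall>h>0.
      primitive (\<lambda>\<tau>. indicator S \<tau> * l \<tau> (u t)) (t + h) - primitive (\<lambda>\<tau>. indicator S \<tau> * l \<tau> (u t)) t \<le> F (t + h) - F t"
  shows "integrable (lebesgue_on S) (\<lambda>t. l t (u t))"
    and "(LINT t|lebesgue_on S. l t (u t)) \<le> F T - F 0"
proof -
  let ?M = "lebesgue_on S"
  have S: "S \<in> sets lebesgue" by (simp add: S_def)
  have one: "integrable lebesgue (indicator S :: real \<Rightarrow> real)"
    by (rule integrable_indicator_bounded) (auto simp: S_def)
  define m where "m = (\<lambda>\<tau>. dual_norm (l \<tau>))"
  define \<mu> where "\<mu> = (\<lambda>\<tau>. indicator S \<tau> * m \<tau> powr (3/2))"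
  have \<mu>i: "integrable lebesgue \<mu>"
    using l by (simp add: bochner_Lp_def integrable_lebesgue_on_iff[OF S] \<mu>_def m_def)
  have \<mu>0: "0 \<le> \<mu> \<tau>" for \<tau> by (simp add: \<mu>_def)
  have lX: "AE \<tau> in lebesgue. \<tau> \<in> S \<longrightarrow> l \<tau> \<in> dual"
    using l by (simp add: bochner_Lp_def AE_lebesgue_on_iff[OF S])
  have uX: "AE \<tau> in lebesgue. \<tau> \<in> S \<longrightarrow> u \<tau> \<in> X"
    using u by (simp add: bochner_Lp_def AE_lebesgue_on_iff[OF S])
  have pair: "\<bar>l \<tau> w\<bar> \<le> \<kappa> * \<mu> \<tau> + N w powr 3 / \<kappa>\<^sup>2"
    if "\<tau> \<in> S" "l \<tau> \<in> dual" "w \<in> X" "\<kappa> > 0" for \<tau> w \<kappa>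
  proof -
    have "\<bar>l \<tau> w\<bar> \<le> m \<tau> * N w" unfolding m_def by (rule dual_norm_bound[OF that(2,3)])
    also have "\<dots> \<le> \<kappa> * m \<tau> powr (3/2) + N w powr 3 / \<kappa>\<^sup>2"
      by (rule young_3_2) (use that dual_norm_nonneg nonneg in \<open>auto simp: m_def\<close>)
    finally show ?thesis using that(1) by (simp add: \<mu>_def)
  qed
  define g where "g = (\<lambda>w \<tau>. indicator S \<tau> * l \<tau> w)"
  have g_le: "AE \<tau> in lebesgue. \<bar>g w \<tau>\<bar> \<le> (N w powr 3 / \<kappa>\<^sup>2) * indicator S \<tau> + \<kappa> * \<mu> \<tau>" if "w \<in> X" "\<kappa> > 0" for w \<kappa>
    using lX
  proof eventually_elim
    case (elim \<tau>)
    then show ?case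
      using pair[of \<tau> w \<kappa>] that \<mu>0[of \<tau>] by (cases "\<tau> \<in> S") (auto simp: g_def)
  qed
  have gi: "integrable lebesgue (g w)" if "w \<in> X" for w
  proof (rule Bochner_Integration.integrable_bound)
    show "integrable lebesgue (\<lambda>\<tau>. (N w powr 3 / 1\<^sup>2) * indicator S \<tau> + 1 * \<mu> \<tau>)" using one \<mu>i by simp
    show "g w \<in> borel_measurable lebesgue"
      unfolding g_def by (rule borel_measurable_indicator_times[OF S measurable_dual_app[OF S l that]])
    show "AE \<tau> in lebesgue. norm (g w \<tau>) \<le> norm ((N w powr 3 / 1\<^sup>2) * indicator S \<tau> + 1 * \<mu> \<tau>)"
      using g_le[OF that zero_less_one] by eventually_elim simp
  qed
  have conv: "(\<lambda>n. LINT t|lebesgue. indicator (A \<inter> S) t * diff_quot (primitive (g w)) n t) \<longlonglongrightarrow> (LINT t|lebesgue. indicator (A \<inter> S) t * g w t)"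
    if "w \<in> X" "A \<in> sets lebesgue" for w A
    unfolding S_def
  proof (rule integral_diff_quot_primitive_tendsto[OF gi[OF that(1)] \<mu>i _ \<mu>0 that(2)])
    fix \<kappa> :: real assume "\<kappa> > 0"
    from g_le[OF that(1) this]
    show "\<exists>C. AE \<tau> in lebesgue. \<bar>g w \<tau>\<bar> \<le> C * indicator {0<..<T} \<tau> + \<kappa> * \<mu> \<tau>"
      unfolding S_def by (rule exI)
  qed
  have i\<sigma>N: "integrable lebesgue (\<lambda>t. indicator S t * N (u t) powr 3)"
    using u by (simp add: bochner_Lp_def integrable_lebesgue_on_iff[OF S])
  have pi: "integrable lebesgue (\<lambda>t. indicator S t * l t (u t))"
  proof (rule Bochner_Integration.integrable_bound)
    show "integrable lebesgue (\<lambda>t. indicator S t * N (u t) powr 3 + \<mu> t)" using i\<sigma>N \<mu>i by simp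
    show "(\<lambda>t. indicator S t * l t (u t)) \<in> borel_measurable lebesgue"
      by (rule borel_measurable_indicator_times[OF S measurable_dual_pairing[OF S l u]])
    show "AE t in lebesgue. norm (indicator S t * l t (u t)) \<le> norm (indicator S t * N (u t) powr 3 + \<mu> t)"
      using lX uX
    proof eventually_elim
      case (elim t)
      then show ?case
        using pair[of t "u t" 1] \<mu>0[of t] by (cases "t \<in> S") auto
    qed
  qed
  then show "integrable ?M (\<lambda>t. l t (u t))" by (simp add: integrable_lebesgue_on_iff[OF S])
  define I where "I = integral\<^sup>L lebesgue \<mu>"
  have I: "I \<ge> 0" unfolding I_def using \<mu>0 by (intro integral_nonneg_AE) auto
  have main: "(LINT t|lebesgue. indicator S t * l t (u t)) \<le> F T - F 0 + 2 * \<kappa> * (I + 1)" if \<kappa>: "\<kappa> > 0" for \<kappa>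
  proof -
    \<comment> \<open>The error \<open>\<kappa> ^ 3\<close> survives the factor \<open>1 / \<kappa>\<^sup>2\<close> of Young's inequality as
      \<open>\<kappa>\<close>.\<close>
    obtain \<sigma> where \<sigma>: "simple_function ?M \<sigma>" "\<And>t. t \<in> S \<Longrightarrow> \<sigma> t \<in> X"
      "integrable ?M (\<lambda>t. N (\<sigma> t - u t) powr 3)" "(LINT t|?M. N (\<sigma> t - u t) powr 3) < \<kappa> ^ 3"
      by (rule simple_approximation[OF S _ u, of "\<kappa> ^ 3"]) (use \<kappa> in auto)
    let ?W = "\<sigma> ` S"
    define A where "A = (\<lambda>w. {t \<in> S. \<sigma> t = w})"
    have W: "finite ?W" using \<sigma>(1) by (simp add: simple_function_def)
    have WX: "w \<in> X" if "w \<in> ?W" for w using that \<sigma>(2) by auto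
    have A: "A w \<in> sets lebesgue" if "w \<in> ?W" for w
    proof -
      have "\<sigma> -` {w} \<inter> S \<in> sets ?M" using \<sigma>(1) that by (auto simp: simple_function_def)
      moreover have "\<sigma> -` {w} \<inter> S = A w" by (auto simp: A_def)
      ultimately show ?thesis using S by (simp add: sets_restrict_space_iff)
    qed
    have AS: "A w \<inter> S = A w" for w by (auto simp: A_def)
    \<comment> \<open>A quantity that depends on time also through \<open>\<sigma> t\<close> is a finite sum over the values of
      \<open>\<sigma>\<close>.\<close>
    have decomp: "indicator S t * Q (\<sigma> t) t = (\<Sum>w\<in>?W. indicator (A w) t * Q w t)" for Q :: "('a \<Rightarrow> 'b) \<Rightarrow> real \<Rightarrow> real" and t
    proof (cases "t \<in> S")
      case True
      then have "(\<Sum>w\<in>?W. indicator (A w) t * Q w t) = (\<Sum>w\<in>?W. if w = \<sigma> t then Q w t else 0)"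
        by (intro sum.cong) (auto simp: A_def)
      then show ?thesis using True W by (simp add: sum.delta)
    next
      case False
      then have "indicator (A w) t = (0::real)" for w by (simp add: A_def)
      then show ?thesis using False by simp
    qed
    have cp: "continuous_on UNIV (primitive (g w))" if "w \<in> X" for w
      by (rule continuous_primitive[OF gi[OF that]])
    define D where "D = (\<lambda>t. indicator S t * N (\<sigma> t - u t) powr 3)"
    have D: "integrable lebesgue D" "integral\<^sup>L lebesgue D < \<kappa> ^ 3"
      using \<sigma>(3,4) by (simp_all add: D_def integrable_lebesgue_on_iff[OF S] integral_lebesgue_on[OF S])
    have D2: "(LINT t|lebesgue. D t / \<kappa>\<^sup>2) \<le> \<kappa>"
    proof -
      have "(LINT t|lebesgue. D t / \<kappa>\<^sup>2) \<le> \<kappa> ^ 3 / \<kappa>\<^sup>2"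
        using D(2) \<kappa> by (simp add: divide_right_mono)
      also have "\<dots> = \<kappa>" using \<kappa> by (simp add: power3_eq_cube power2_eq_square)
      finally show ?thesis .
    qed
    note c\<mu> = continuous_primitive[OF \<mu>i]
    have iqF: "integrable lebesgue (\<lambda>t. indicator S t * diff_quot F n t)" for n
      using S by (intro integrable_diff_quot[OF F, of _ 0 T]) (auto simp: S_def)
    have iq\<mu>: "integrable lebesgue (\<lambda>t. indicator S t * diff_quot (primitive \<mu>) n t)" for n
      using S by (intro integrable_diff_quot[OF c\<mu>, of _ 0 T]) (auto simp: S_def)
    have iqg: "integrable lebesgue (\<lambda>t. indicator (A w) t * diff_quot (primitive (g w)) n t)" if "w \<in> ?W" for w n
      using A[OF that] by (intro integrable_diff_quot[OF cp[OF WX[OF that]], of _ 0 T]) (auto simp: A_def S_def)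
    \<comment> \<open>Replacing \<open>u t\<close> by \<open>\<sigma> t\<close> costs at most the two Young terms, for all increments at once.\<close>
    have point: "AE t in lebesgue. \<forall>n. indicator S t * diff_quot (primitive (g (\<sigma> t))) n t \<le>
        indicator S t * diff_quot F n t + \<kappa> * (indicator S t * diff_quot (primitive \<mu>) n t) + D t / \<kappa>\<^sup>2"
      using uX key[unfolded AE_lebesgue_on_iff[OF S]]
    proof eventually_elim
      case (elim t)
      show ?case
      proof (cases "t \<in> S")
        case True
        then have tX: "u t \<in> X" "\<sigma> t \<in> X" using elim \<sigma>(2) by auto
        show ?thesis
        proof
          fix n
          let ?h = "step n"
          let ?c = "N (\<sigma> t - u t) powr 3 / \<kappa>\<^sup>2"
          have ik: "integrable lebesgue (\<lambda>\<tau>. \<kappa> * \<mu> \<tau> + ?c * indicator S \<tau>)"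
            using \<mu>i one by simp
          have "primitive (g (\<sigma> t)) (t + ?h) - primitive (g (\<sigma> t)) t \<le>
             primitive (\<lambda>\<tau>. 1 * g (u t) \<tau> + 1 * (\<kappa> * \<mu> \<tau> + ?c * indicator S \<tau>)) (t + ?h) - primitive (\<lambda>\<tau>. 1 * g (u t) \<tau> + 1 * (\<kappa> * \<mu> \<tau> + ?c * indicator S \<tau>)) t"
          proof (rule primitive_diff_mono)
            show "AE \<tau> in lebesgue. \<tau> \<in> {t<..t + ?h} \<longrightarrow> g (\<sigma> t) \<tau> \<le> 1 * g (u t) \<tau> + 1 * (\<kappa> * \<mu> \<tau> + ?c * indicator S \<tau>)"
              using lX
            proof eventually_elim
              case (elim \<tau>)
              show ?case
              proof (cases "\<tau> \<in> S")
                case True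
                then have "\<bar>l \<tau> (\<sigma> t - u t)\<bar> \<le> \<kappa> * \<mu> \<tau> + ?c"
                  using elim tX \<kappa> by (intro pair diff) auto
                moreover have "l \<tau> (\<sigma> t - u t) = l \<tau> (\<sigma> t) - l \<tau> (u t)"
                  using elim True tX by (intro dual_app_diff) auto
                ultimately have "l \<tau> (\<sigma> t) \<le> l \<tau> (u t) + (\<kappa> * \<mu> \<tau> + ?c)" by linarith
                then show ?thesis using True by (simp add: g_def)
              qed (simp add: g_def \<mu>_def)
            qed
          qed (use gi tX ik step(1)[of n] in auto)
          also have "\<dots> = (primitive (g (u t)) (t + ?h) - primitive (g (u t)) t) + \<kappa> * (primitive \<mu> (t + ?h) - primitive \<mu> t)
              + ?c * (primitive (indicator S) (t + ?h) - primitive (indicator S) t)"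
            unfolding primitive_lin[OF gi[OF tX(1)] ik] primitive_lin[OF \<mu>i one] by (simp add: algebra_simps diff_divide_distrib)
          also have "primitive (g (u t)) (t + ?h) - primitive (g (u t)) t \<le> F (t + ?h) - F t"
            using elim(2) True step(1)[of n] by (simp add: g_def)
          also have "?c * (primitive (indicator S) (t + ?h) - primitive (indicator S) t) \<le> ?c * ?h"
            using step(1)[of n] S by (intro mult_left_mono primitive_indicator_increment) (auto simp: S_def)
          finally have "(primitive (g (\<sigma> t)) (t + ?h) - primitive (g (\<sigma> t)) t) / ?h \<le>
             (F (t + ?h) - F t + \<kappa> * (primitive \<mu> (t + ?h) - primitive \<mu> t) + ?c * ?h) / ?h"
            using step(1)[of n] by (intro divide_right_mono) auto
          also have "\<dots> = diff_quot F n t + \<kappa> * diff_quot (primitive \<mu>) n t + ?c"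
            using step(1)[of n] by (simp add: diff_quot_def add_divide_distrib)
          finally show "indicator S t * diff_quot (primitive (g (\<sigma> t))) n t \<le>
              indicator S t * diff_quot F n t + \<kappa> * (indicator S t * diff_quot (primitive \<mu>) n t) + D t / \<kappa>\<^sup>2"
            using True by (simp add: D_def diff_quot_def[of "primitive (g (\<sigma> t))"])
        qed
      qed (simp add: D_def)
    qed
    have ineq: "(\<Sum>w\<in>?W. LINT t|lebesgue. indicator (A w) t * diff_quot (primitive (g w)) n t) \<le>
        (LINT t|lebesgue. indicator S t * diff_quot F n t) + \<kappa> * (LINT t|lebesgue. indicator S t * diff_quot (primitive \<mu>) n t) + \<kappa>" for n
    proof -
      have "(\<Sum>w\<in>?W. LINT t|lebesgue. indicator (A w) t * diff_quot (primitive (g w)) n t) =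
          (LINT t|lebesgue. indicator S t * diff_quot (primitive (g (\<sigma> t))) n t)"
        using iqg decomp[of _ "\<lambda>w t. diff_quot (primitive (g w)) n t"] by (simp add: Bochner_Integration.integral_sum)
      also have "\<dots> \<le> (LINT t|lebesgue. indicator S t * diff_quot F n t + \<kappa> * (indicator S t * diff_quot (primitive \<mu>) n t) + D t / \<kappa>\<^sup>2)"
      proof (rule integral_mono_AE)
        show "integrable lebesgue (\<lambda>t. indicator S t * diff_quot (primitive (g (\<sigma> t))) n t)"
          unfolding decomp[of _ "\<lambda>w t. diff_quot (primitive (g w)) n t"] by (intro Bochner_Integration.integrable_sum iqg)
        show "integrable lebesgue (\<lambda>t. indicator S t * diff_quot F n t + \<kappa> * (indicator S t * diff_quot (primitive \<mu>) n t) + D t / \<kappa>\<^sup>2)"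
          using iqF iq\<mu> D(1) by simp
        show "AE t in lebesgue. indicator S t * diff_quot (primitive (g (\<sigma> t))) n t \<le>
            indicator S t * diff_quot F n t + \<kappa> * (indicator S t * diff_quot (primitive \<mu>) n t) + D t / \<kappa>\<^sup>2"
          using point by eventually_elim blast
      qed
      also have "\<dots> = (LINT t|lebesgue. indicator S t * diff_quot F n t) + \<kappa> * (LINT t|lebesgue. indicator S t * diff_quot (primitive \<mu>) n t) + (LINT t|lebesgue. D t / \<kappa>\<^sup>2)"
        using iqF iq\<mu> D(1) by simp
      finally show ?thesis using D2 by linarith
    qed
    have "(\<Sum>w\<in>?W. LINT t|lebesgue. indicator (A w) t * g w t) \<le> (F T - F 0) + \<kappa> * (primitive \<mu> T - primitive \<mu> 0) + \<kappa>"
    proof (rule LIMSEQ_le)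
      show "(\<lambda>n. \<Sum>w\<in>?W. LINT t|lebesgue. indicator (A w) t * diff_quot (primitive (g w)) n t) \<longlonglongrightarrow>
          (\<Sum>w\<in>?W. LINT t|lebesgue. indicator (A w) t * g w t)"
        using conv[OF WX A] unfolding AS by (intro tendsto_sum) blast
      show "(\<lambda>n. (LINT t|lebesgue. indicator S t * diff_quot F n t) + \<kappa> * (LINT t|lebesgue. indicator S t * diff_quot (primitive \<mu>) n t) + \<kappa>)
          \<longlonglongrightarrow> (F T - F 0) + \<kappa> * (primitive \<mu> T - primitive \<mu> 0) + \<kappa>"
        unfolding S_def using T by (intro tendsto_intros integral_diff_quot_tendsto F c\<mu>) auto
    qed (use ineq in blast)
    moreover have "primitive \<mu> T - primitive \<mu> 0 \<le> I"
      unfolding primitive_diff[OF \<mu>i less_imp_le[OF T]] I_def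
      using \<mu>i \<mu>0 by (intro integral_mono integrable_indicator_times) (auto split: split_indicator)
    moreover have ig: "integrable lebesgue (\<lambda>t. indicator (A w) t * g w t)" if "w \<in> ?W" for w
      using that by (intro integrable_indicator_times gi WX A)
    moreover have "(\<Sum>w\<in>?W. LINT t|lebesgue. indicator (A w) t * g w t) = (LINT t|lebesgue. indicator S t * g (\<sigma> t) t)"
      using ig decomp[of _ g] by (simp add: Bochner_Integration.integral_sum)
    moreover have "(LINT t|lebesgue. indicator S t * l t (u t)) \<le> (LINT t|lebesgue. indicator S t * g (\<sigma> t) t + \<kappa> * \<mu> t + D t / \<kappa>\<^sup>2)"
    proof (rule integral_mono_AE[OF pi])
      show "integrable lebesgue (\<lambda>t. indicator S t * g (\<sigma> t) t + \<kappa> * \<mu> t + D t / \<kappa>\<^sup>2)"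
        unfolding decomp[of _ g] using ig \<mu>i D(1)
        by (intro Bochner_Integration.integrable_add Bochner_Integration.integrable_sum) auto
      show "AE t in lebesgue. indicator S t * l t (u t) \<le> indicator S t * g (\<sigma> t) t + \<kappa> * \<mu> t + D t / \<kappa>\<^sup>2"
        using lX uX
      proof eventually_elim
        case (elim t)
        show ?case
        proof (cases "t \<in> S")
          case True
          then have "\<bar>l t (\<sigma> t - u t)\<bar> \<le> \<kappa> * \<mu> t + N (\<sigma> t - u t) powr 3 / \<kappa>\<^sup>2"
            using elim \<sigma>(2) \<kappa> by (intro pair diff) auto
          moreover have "l t (\<sigma> t - u t) = l t (\<sigma> t) - l t (u t)"
            using elim True \<sigma>(2) by (intro dual_app_diff) auto
          ultimately have "l t (u t) \<le> l t (\<sigma> t) + (\<kappa> * \<mu> t + N (\<sigma> t - u t) powr 3 / \<kappa>\<^sup>2)" by linarith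
          then show ?thesis using True by (simp add: g_def D_def)
        qed (simp add: D_def \<mu>_def)
      qed
    qed
    moreover have "(LINT t|lebesgue. indicator S t * g (\<sigma> t) t + \<kappa> * \<mu> t + D t / \<kappa>\<^sup>2) =
        (LINT t|lebesgue. indicator S t * g (\<sigma> t) t) + \<kappa> * I + (LINT t|lebesgue. D t / \<kappa>\<^sup>2)"
    proof -
      have "integrable lebesgue (\<lambda>t. indicator S t * g (\<sigma> t) t)"
        unfolding decomp[of _ g] using ig by (intro Bochner_Integration.integrable_sum)
      then show ?thesis using \<mu>i D(1) by (simp add: I_def)
    qed
    moreover have "\<kappa> * (primitive \<mu> T - primitive \<mu> 0) \<le> \<kappa> * I"
      using calculation(2) \<kappa> by (intro mult_left_mono) auto
    ultimately show ?thesis using D2 by (simp add: algebra_simps)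
  qed
  show "(LINT t|?M. l t (u t)) \<le> F T - F 0"
  proof (rule field_le_epsilon)
    fix e :: real assume "e > 0"
    with I have "e / (2 * (I + 1)) > 0" "2 * (e / (2 * (I + 1))) * (I + 1) = e" by (auto simp: field_simps)
    with main[of "e / (2 * (I + 1))"] show "(LINT t|?M. l t (u t)) \<le> F T - F 0 + e"
      by (simp only: integral_lebesgue_on[OF S] real_scaleR_def)
  qed
qed

section \<open>Distributional derivatives in time\<close>

lemma flat_exp'_nonneg: "0 \<le> flat_exp' x"
  by (simp add: flat_exp'_def)

lemma flat_exp'_measurable [measurable]: "flat_exp' \<in> borel_measurable borel"
  unfolding flat_exp'_def[abs_def] by measurable

lemma flat_exp_measurable [measurable]: "flat_exp \<in> borel_measurable borel"
  unfolding flat_exp_def[abs_def] by measurable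

lemma continuous_flat_exp:
  "continuous_on UNIV flat_exp" "continuous_on UNIV flat_exp'"
proof -
  have "C_k 0 flat_exp" "C_k (Suc 0) flat_exp" by (rule C_k_flat_exp)+
  then have c: "continuous_on UNIV flat_exp"
    and d: "continuous_on UNIV (\<lambda>x. frechet_derivative flat_exp (at x) 1)" by auto
  have "frechet_derivative flat_exp (at x) = (*) (flat_exp' x)" for x
    using flat_exp_deriv[of x] by (intro frechet_derivative_at[symmetric]) (simp add: has_field_derivative_def)
  then show "continuous_on UNIV flat_exp" "continuous_on UNIV flat_exp'" using c d by simp_all
qed

lemma flat_exp_at_top: "(flat_exp \<longlongrightarrow> 1) at_top"
proof -
  have "((\<lambda>x::real. exp (- inverse x)) \<longlongrightarrow> exp (- 0)) at_top"
    by (intro tendsto_intros tendsto_inverse_0_at_top filterlim_ident)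
  then have "((\<lambda>x::real. exp (- inverse x)) \<longlongrightarrow> 1) at_top" by simp
  then show ?thesis
    by (rule Lim_transform_eventually)
      (auto intro: eventually_mono[OF eventually_gt_at_top[of 0]] simp: flat_exp_def inverse_eq_divide)
qed

lemma flat_exp'_integral: "has_bochner_integral lborel flat_exp' 1"
proof (rule has_bochner_integral_nn_integral)
  have "(\<integral>\<^sup>+ x. ennreal (flat_exp' x) * indicator {0..} x \<partial>lborel) = ennreal (1 - flat_exp 0)"
    by (rule nn_integral_FTC_atLeast) (auto simp: flat_exp_deriv flat_exp'_nonneg flat_exp_at_top)
  also have "(\<integral>\<^sup>+ x. ennreal (flat_exp' x) * indicator {0..} x \<partial>lborel) = (\<integral>\<^sup>+ x. ennreal (flat_exp' x) \<partial>lborel)"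
    by (intro nn_integral_cong) (auto simp: flat_exp'_def indicator_def)
  finally show "(\<integral>\<^sup>+ x. ennreal (flat_exp' x) \<partial>lborel) = ennreal 1" by (simp add: flat_exp_def)
qed (auto simp: flat_exp'_nonneg)

text \<open>The substitution $x = s + y/n$ turns the kernel into the density \<open>flat_exp'\<close> of total mass
  1, times a factor that tends to 1.\<close>

lemma left_edge_kernel:
  fixes c :: "real \<Rightarrow> real"
  assumes c: "continuous_on {s..t} c" and st: "s < t"
  shows "(\<lambda>n. LINT x|lborel. indicator {s..t} x * (c x * (real n * flat_exp' (real n * (x - s)) * flat_exp (real n * (t - x))))) \<longlonglongrightarrow> c s"
proof -
  \<comment> \<open>A bounded continuous extension, needed after the substitution; the kernel vanishes outside
    the interval.\<close>
  define k where "k = (\<lambda>x. c (max s (min t x)))"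
  have k: "continuous_on UNIV k"
    unfolding k_def by (rule continuous_on_compose2[OF c]) (use st in \<open>auto intro!: continuous_intros\<close>)
  have km [measurable]: "k \<in> borel_measurable borel" using k by (rule borel_measurable_continuous_onI)
  have "bounded (c ` {s..t})"
    using c by (intro compact_imp_bounded compact_continuous_image) auto
  then obtain B where B: "\<And>x. x \<in> {s..t} \<Longrightarrow> norm (c x) \<le> B" unfolding bounded_iff by blast
  have kB: "norm (k x) \<le> B" for x unfolding k_def using st by (intro B) auto
  have B0: "B \<ge> 0" using kB[of 0] norm_ge_zero order_trans by blast
  let ?f = "\<lambda>n x. real n * flat_exp' (real n * (x - s)) * flat_exp (real n * (t - x))"
  have eq: "(LINT x|lborel. indicator {s..t} x * (c x * ?f n x))
      = (LINT y|lborel. k (s + y / real n) * flat_exp' y * flat_exp (real n * (t - s) - y))" if n: "n > 0" for n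
  proof -
    have "(LINT x|lborel. indicator {s..t} x * (c x * ?f n x)) = (LINT x|lborel. k x * ?f n x)"
    proof (rule Bochner_Integration.integral_cong[OF refl])
      fix x
      show "indicator {s..t} x * (c x * ?f n x) = k x * ?f n x"
      proof (cases "x \<in> {s..t}")
        case True
        then show ?thesis by (simp add: k_def)
      next
        case False
        then have "flat_exp' (real n * (x - s)) = 0 \<or> flat_exp (real n * (t - x)) = 0"
          using n by (auto simp: flat_exp'_def flat_exp_def zero_less_mult_iff)
        then show ?thesis using False by auto
      qed
    qed
    also have "\<dots> = \<bar>1 / real n\<bar> *\<^sub>R (LINT y|lborel. k (s + 1 / real n * y) * ?f n (s + 1 / real n * y))"
      using n by (intro lborel_integral_real_affine) simp
    also have "\<dots> = (LINT y|lborel. \<bar>1 / real n\<bar> * (k (s + 1 / real n * y) * ?f n (s + 1 / real n * y)))"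
      by (simp only: real_scaleR_def integral_mult_right_zero)
    also have "\<dots> = (LINT y|lborel. k (s + y / real n) * flat_exp' y * flat_exp (real n * (t - s) - y))"
    proof (rule Bochner_Integration.integral_cong[OF refl])
      fix y
      have "real n * (t - (s + 1 / real n * y)) = real n * (t - s) - y" using n by (simp add: field_simps)
      then show "\<bar>1 / real n\<bar> * (k (s + 1 / real n * y) * ?f n (s + 1 / real n * y))
        = k (s + y / real n) * flat_exp' y * flat_exp (real n * (t - s) - y)"
        using n by simp
    qed
    finally show ?thesis .
  qed
  have "(\<lambda>n. LINT y|lborel. k (s + y / real n) * flat_exp' y * flat_exp (real n * (t - s) - y)) \<longlonglongrightarrow>
      (LINT y|lborel. k s * flat_exp' y * 1)"
  proof (rule integral_dominated_convergence)
    show "integrable lborel (\<lambda>y. B * flat_exp' y)"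
      using flat_exp'_integral by (simp add: has_bochner_integral_iff)
    show "AE y in lborel. (\<lambda>n. k (s + y / real n) * flat_exp' y * flat_exp (real n * (t - s) - y)) \<longlonglongrightarrow> k s * flat_exp' y * 1"
    proof (rule AE_I2)
      fix y
      have "(\<lambda>n. s + y * inverse (real n)) \<longlonglongrightarrow> s + y * 0"
        by (intro tendsto_intros lim_inverse_n)
      then have "(\<lambda>n. k (s + y / real n)) \<longlonglongrightarrow> k s"
        using k by (intro isCont_tendsto_compose[of s k]) (auto simp: continuous_on_eq_continuous_at divide_inverse)
      moreover have "filterlim (\<lambda>n. real n * (t - s) - y) at_top sequentially"
      proof -
        have "filterlim (\<lambda>n. - y + real n * (t - s)) at_top sequentially"
          using st by (intro filterlim_tendsto_add_at_top[OF tendsto_const]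
              filterlim_at_top_mult_tendsto_pos[OF tendsto_const] filterlim_real_sequentially) auto
        then show ?thesis by simp
      qed
      then have "(\<lambda>n. flat_exp (real n * (t - s) - y)) \<longlonglongrightarrow> 1"
        by (rule filterlim_compose[OF flat_exp_at_top])
      ultimately show "(\<lambda>n. k (s + y / real n) * flat_exp' y * flat_exp (real n * (t - s) - y)) \<longlonglongrightarrow> k s * flat_exp' y * 1"
        by (intro tendsto_mult tendsto_const)
    qed
    show "AE y in lborel. norm (k (s + y / real n) * flat_exp' y * flat_exp (real n * (t - s) - y)) \<le> B * flat_exp' y" for n
    proof (rule AE_I2)
      fix y
      have "\<bar>k (s + y / real n)\<bar> * flat_exp' y * flat_exp (real n * (t - s) - y) \<le> B * flat_exp' y * 1"
        using kB[of "s + y / real n"] B0 flat_exp'_nonneg flat_exp_bounds by (intro mult_mono) auto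
      then show "norm (k (s + y / real n) * flat_exp' y * flat_exp (real n * (t - s) - y)) \<le> B * flat_exp' y"
        using flat_exp'_nonneg[of y] flat_exp_bounds(1) by (simp add: abs_mult)
    qed
  qed measurable
  moreover have "(LINT y|lborel. k s * flat_exp' y * 1) = c s"
    using flat_exp'_integral st by (simp add: has_bochner_integral_iff k_def)
  ultimately have "(\<lambda>n. LINT y|lborel. k (s + y / real n) * flat_exp' y * flat_exp (real n * (t - s) - y)) \<longlonglongrightarrow> c s"
    by simp
  then show ?thesis
    by (rule Lim_transform_eventually) (auto simp: eq intro: eventually_mono[OF eventually_gt_at_top[of 0]])
qed

lemma right_edge_kernel:
  fixes c :: "real \<Rightarrow> real"
  assumes c: "continuous_on {s..t} c" and st: "s < t"
  shows "(\<lambda>n. LINT x|lborel. indicator {s..t} x * (c x * (real n * flat_exp (real n * (x - s)) * flat_exp' (real n * (t - x))))) \<longlonglongrightarrow> c t"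
proof -
  have "continuous_on {- t..- s} (\<lambda>x. c (- x))"
    by (rule continuous_on_compose2[OF c]) (auto intro!: continuous_intros)
  from left_edge_kernel[OF this]
  have "(\<lambda>n. LINT x|lborel. indicator {- t..- s} x * (c (- x) * (real n * flat_exp' (real n * (x - - t)) * flat_exp (real n * (- s - x))))) \<longlonglongrightarrow> c t"
    using st by simp
  moreover have "(LINT x|lborel. indicator {- t..- s} x * (c (- x) * (real n * flat_exp' (real n * (x - - t)) * flat_exp (real n * (- s - x)))))
     = (LINT x|lborel. indicator {s..t} x * (c x * (real n * flat_exp (real n * (x - s)) * flat_exp' (real n * (t - x)))))" for n
  proof -
    have "(LINT x|lborel. indicator {s..t} x * (c x * (real n * flat_exp (real n * (x - s)) * flat_exp' (real n * (t - x)))))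
      = \<bar>-1\<bar> *\<^sub>R (LINT x|lborel. indicator {s..t} (0 + -1 * x) * (c (0 + -1 * x) * (real n * flat_exp (real n * ((0 + -1 * x) - s)) * flat_exp' (real n * (t - (0 + -1 * x))))))"
      by (rule lborel_integral_real_affine) simp
    also have "\<dots> = (LINT x|lborel. indicator {- t..- s} x * (c (- x) * (real n * flat_exp' (real n * (x - - t)) * flat_exp (real n * (- s - x)))))"
    proof -
      have "real n * ((0 + -1 * x) - s) = real n * (- s - x)" "real n * (t - (0 + -1 * x)) = real n * (x - - t)" for x
        by (simp_all add: algebra_simps)
      moreover have "indicator {s..t} (0 + -1 * x) = (indicator {- t..- s} x :: real)" for x
        by (auto simp: indicator_def)
      ultimately show ?thesis
        by (simp only: abs_minus abs_one scaleR_one) (simp add: mult_ac)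
    qed
    finally show ?thesis by simp
  qed
  ultimately show ?thesis by simp
qed

lemma box_bump_real: "box_bump s t n x = flat_exp (real n * (x - s)) * flat_exp (real n * (t - x))" for x :: real
  by (simp add: box_bump_def)

lemma box_bump_real_deriv:
  "deriv (box_bump s t n) x = real n * flat_exp' (real n * (x - s)) * flat_exp (real n * (t - x))
     - real n * flat_exp (real n * (x - s)) * flat_exp' (real n * (t - x))" for x :: real
proof -
  have "((\<lambda>x. flat_exp (real n * (x - s))) has_real_derivative flat_exp' (real n * (x - s)) * real n) (at x)"
    by (rule DERIV_chain2[OF flat_exp_deriv]) (auto intro!: derivative_eq_intros)
  moreover have "((\<lambda>x. flat_exp (real n * (t - x))) has_real_derivative flat_exp' (real n * (t - x)) * (- real n)) (at x)"
    by (rule DERIV_chain2[OF flat_exp_deriv]) (auto intro!: derivative_eq_intros)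
  ultimately have "((\<lambda>x. flat_exp (real n * (x - s)) * flat_exp (real n * (t - x))) has_real_derivative
      flat_exp' (real n * (x - s)) * real n * flat_exp (real n * (t - x)) + flat_exp' (real n * (t - x)) * (- real n) * flat_exp (real n * (x - s))) (at x)"
    by (rule DERIV_mult)
  then show ?thesis
    unfolding box_bump_real[abs_def] by (simp add: DERIV_imp_deriv algebra_simps)
qed

text \<open>Test with bumps that tend to the indicator of the interval from \<open>s\<close> to \<open>t\<close>. Their
  derivatives concentrate positive unit mass at \<open>s\<close> and negative unit mass at \<open>t\<close>. The end points
  of the time interval follow by continuity.\<close>

lemma weak_derivative_increment:
  fixes c g :: "real \<Rightarrow> real" and T :: real
  defines "S \<equiv> {0<..<T}"
  assumes c: "continuous_on {0..T} c" and g: "integrable (lebesgue_on S) g"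
    and weak: "\<And>\<eta>. \<eta> \<in> test_functions S \<Longrightarrow>
      (LINT x|lebesgue_on S. c x * deriv \<eta> x) = - (LINT x|lebesgue_on S. g x * \<eta> x)"
    and st: "0 \<le> s" "s \<le> t" "t \<le> T"
  shows "c t - c s = primitive (\<lambda>x. indicator S x * g x) t - primitive (\<lambda>x. indicator S x * g x) s"
proof -
  have S: "S \<in> sets lebesgue" by (simp add: S_def)
  let ?G = "\<lambda>x. indicator S x * g x"
  have G: "integrable lebesgue ?G" using g by (simp add: integrable_lebesgue_on_iff[OF S])
  have inner: "c t - c s = primitive ?G t - primitive ?G s" if st: "0 < s" "s < t" "t < T" for s t
  proof -
    have test: "box_bump s t n \<in> test_functions S" for n
      using st by (intro box_bump_test_function) (auto simp: S_def)
    have "(\<lambda>n. - (LINT x|lebesgue. ?G x * box_bump s t n x)) \<longlonglongrightarrow> - (LINT x|lebesgue. ?G x * indicator (box s t) x)"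
    proof (intro tendsto_minus integral_dominated_convergence[where w="\<lambda>x. norm (?G x)"])
      have m: "box_bump s t n \<in> borel_measurable lebesgue" for n
        using C_k_imp_continuous[OF C_k_box_bump[of 0 s t n]]
        by (intro measurable_completion) (simp add: borel_measurable_continuous_onI)
      show "(\<lambda>x. ?G x * box_bump s t n x) \<in> borel_measurable lebesgue" for n
        by (rule borel_measurable_times[OF borel_measurable_integrable[OF G] m])
      show "(\<lambda>x. ?G x * indicator (box s t) x) \<in> borel_measurable lebesgue"
        by (rule borel_measurable_times[OF borel_measurable_integrable[OF G]]) (intro borel_measurable_indicator, simp)
      show "AE x in lebesgue. (\<lambda>n. ?G x * box_bump s t n x) \<longlonglongrightarrow> ?G x * indicator (box s t) x"
        by (intro AE_I2 tendsto_intros box_bump_tendsto)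
      show "AE x in lebesgue. norm (?G x * box_bump s t n x) \<le> norm (?G x)" for n
        using box_bump_bounds[of s t n] by (intro AE_I2) (simp add: abs_mult mult_left_le)
    qed (use G in simp)
    moreover have "(LINT x|lebesgue. ?G x * indicator (box s t) x) = primitive ?G t - primitive ?G s"
    proof -
      have "AE x in lebesgue. x \<noteq> t" using AE_lborel_singleton[of t] by (rule AE_completion)
      then have "AE x in lebesgue. ?G x * indicator (box s t) x = indicator {s<..t} x * ?G x"
        by eventually_elim (auto simp: indicator_def box_real)
      moreover have "(\<lambda>x. ?G x * indicator (box s t) x) \<in> borel_measurable lebesgue"
        by (rule borel_measurable_times[OF borel_measurable_integrable[OF G]]) (intro borel_measurable_indicator, simp)
      moreover have "(\<lambda>x. indicator {s<..t} x * ?G x) \<in> borel_measurable lebesgue"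
        by (intro borel_measurable_integrable integrable_indicator_times G) auto
      ultimately have "(LINT x|lebesgue. ?G x * indicator (box s t) x) = (LINT x|lebesgue. indicator {s<..t} x * ?G x)"
        by (intro integral_cong_AE)
      then show ?thesis using st by (simp add: primitive_diff[OF G])
    qed
    moreover have "- (LINT x|lebesgue. ?G x * box_bump s t n x) = (LINT x|lborel. indicator {s..t} x * (c x * deriv (box_bump s t n) x))" for n
    proof -
      have cont: "continuous_on UNIV (deriv (box_bump s t n))"
      proof -
        have "continuous_on UNIV (\<lambda>x. flat_exp (real n * (x - s)))" "continuous_on UNIV (\<lambda>x. flat_exp' (real n * (x - s)))"
          "continuous_on UNIV (\<lambda>x. flat_exp (real n * (t - x)))" "continuous_on UNIV (\<lambda>x. flat_exp' (real n * (t - x)))"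
          by (auto intro!: continuous_intros continuous_on_compose2[OF continuous_flat_exp(1)] continuous_on_compose2[OF continuous_flat_exp(2)])
        then show ?thesis
          unfolding box_bump_real_deriv by (intro continuous_on_diff continuous_on_mult continuous_on_const)
      qed
      have zero: "deriv (box_bump s t n) x = 0" if "x \<notin> {s..t}" for x
        using that unfolding box_bump_real_deriv by (auto simp: flat_exp'_def flat_exp_def zero_less_mult_iff)
      have eq: "indicator S x * (c x * deriv (box_bump s t n) x) = indicator {s..t} x * (c x * deriv (box_bump s t n) x)" for x
        using st zero[of x] by (cases "x \<in> {s..t}") (auto simp: S_def indicator_def)
      have m: "(\<lambda>x. indicator {s..t} x *\<^sub>R (c x * deriv (box_bump s t n) x)) \<in> borel_measurable borel"
        using st by (intro borel_measurable_continuous_on_indicator continuous_on_mult)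
          (auto intro: continuous_on_subset[OF c] continuous_on_subset[OF cont])
      have "(LINT x|lborel. indicator {s..t} x * (c x * deriv (box_bump s t n) x)) = (LINT x|lebesgue. indicator {s..t} x * (c x * deriv (box_bump s t n) x))"
        using m by (intro integral_completion[symmetric]) simp
      also have "\<dots> = (LINT x|lebesgue_on S. c x * deriv (box_bump s t n) x)"
        unfolding integral_lebesgue_on[OF S] by (simp add: eq)
      also have "\<dots> = - (LINT x|lebesgue. ?G x * box_bump s t n x)"
        unfolding weak[OF test] integral_lebesgue_on[OF S] by (simp add: mult.assoc)
      finally show ?thesis by simp
    qed
    moreover have "(\<lambda>n. LINT x|lborel. indicator {s..t} x * (c x * deriv (box_bump s t n) x)) \<longlonglongrightarrow> c s - c t"
    proof -
      have c': "continuous_on {s..t} c" using st by (intro continuous_on_subset[OF c]) auto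
      have i: "integrable lborel (\<lambda>x. indicator {s..t} x *\<^sub>R (c x * (real n * flat_exp' (real n * (x - s)) * flat_exp (real n * (t - x)))))"
        "integrable lborel (\<lambda>x. indicator {s..t} x *\<^sub>R (c x * (real n * flat_exp (real n * (x - s)) * flat_exp' (real n * (t - x)))))" for n
        by (intro borel_integrable_compact continuous_on_mult continuous_on_const c'
            continuous_on_compose2[OF continuous_flat_exp(1)] continuous_on_compose2[OF continuous_flat_exp(2)];
            auto intro!: continuous_intros)+
      have "(LINT x|lborel. indicator {s..t} x * (c x * deriv (box_bump s t n) x)) =
         (LINT x|lborel. indicator {s..t} x * (c x * (real n * flat_exp' (real n * (x - s)) * flat_exp (real n * (t - x)))))
         - (LINT x|lborel. indicator {s..t} x * (c x * (real n * flat_exp (real n * (x - s)) * flat_exp' (real n * (t - x)))))" for n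
        using i[of n] by (simp add: box_bump_real_deriv right_diff_distrib)
      then show ?thesis
        using tendsto_diff[OF left_edge_kernel[OF c' st(2)] right_edge_kernel[OF c' st(2)]] by simp
    qed
    ultimately have "c s - c t = - (primitive ?G t - primitive ?G s)"
      using LIMSEQ_unique by fastforce
    then show ?thesis by simp
  qed
  show ?thesis
  proof (cases "T > 0")
    case True
    define E where "E = (\<lambda>x. c x - primitive ?G x)"
    have cl: "closure S = {0..T}" using True by (simp add: S_def)
    have "continuous_on {0..T} E"
      unfolding E_def using continuous_on_subset[OF continuous_primitive[OF G]] by (intro continuous_on_diff c) auto
    then have "continuous_on (closure S) E" by (simp add: cl)
    moreover have "E x = E (T/2)" if "x \<in> S" for x
      using inner[of x "T/2"] inner[of "T/2" x] that True
      by (cases "x < T/2"; cases "x = T/2") (auto simp: E_def S_def)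
    ultimately have "E x = E (T/2)" if "x \<in> closure S" for x
      using that by (rule continuous_constant_on_closure)
    from this[of s] this[of t] have "E s = E t" using st by (simp add: cl)
    then show ?thesis by (simp add: E_def)
  next
    case False
    then have "s = t" using st by simp
    then show ?thesis by simp
  qed
qed

section \<open>The kinetic energy\<close>

lemma integrable_AE_eq_lebesgue_on:
  fixes f g :: "'a::euclidean_space \<Rightarrow> real"
  assumes S: "S \<in> sets lebesgue" and f: "integrable (lebesgue_on S) f" and eq: "AE x in lebesgue_on S. f x = g x"
  shows "integrable (lebesgue_on S) g" "integral\<^sup>L (lebesgue_on S) g = integral\<^sup>L (lebesgue_on S) f"
proof -
  have fm: "f \<in> borel_measurable (lebesgue_on S)" using f by (rule borel_measurable_integrable)
  have gm: "g \<in> borel_measurable (lebesgue_on S)"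
    by (rule borel_measurable_AE_lebesgue_on[OF S fm eq])
  show "integrable (lebesgue_on S) g"
    using integrable_cong_AE[OF fm gm eq] f by simp
  show "integral\<^sup>L (lebesgue_on S) g = integral\<^sup>L (lebesgue_on S) f"
    using integral_cong_AE[OF fm gm eq] by simp
qed

lemma Lp_2_iff: "f \<in> Lp 2 \<Omega> \<longleftrightarrow> f \<in> borel_measurable (lebesgue_on \<Omega>) \<and> integrable (lebesgue_on \<Omega>) (\<lambda>x. (norm (f x))\<^sup>2)"
  by (simp add: Lp_def)

lemma Lp_norm_2: "Lp_norm 2 \<Omega> f = sqrt (LINT x|lebesgue_on \<Omega>. (norm (f x))\<^sup>2)"
proof -
  have "0 \<le> (LINT x|lebesgue_on \<Omega>. (norm (f x))\<^sup>2)" by (intro integral_nonneg_AE) auto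
  then show ?thesis by (simp add: Lp_norm_def powr_half_sqrt)
qed

lemma L2_inner_integrable:
  fixes f g :: "'a::euclidean_space \<Rightarrow> 'b::euclidean_space"
  assumes "f \<in> Lp 2 \<Omega>" "g \<in> Lp 2 \<Omega>"
  shows "integrable (lebesgue_on \<Omega>) (\<lambda>x. f x \<bullet> g x)"
proof (rule Bochner_Integration.integrable_bound)
  have [measurable]: "f \<in> borel_measurable (lebesgue_on \<Omega>)" "g \<in> borel_measurable (lebesgue_on \<Omega>)"
    using assms by (auto simp: Lp_2_iff)
  show "integrable (lebesgue_on \<Omega>) (\<lambda>x. (norm (f x))\<^sup>2 + (norm (g x))\<^sup>2)"
    using assms by (auto simp: Lp_2_iff)
  show "(\<lambda>x. f x \<bullet> g x) \<in> borel_measurable (lebesgue_on \<Omega>)" by measurable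
  show "AE x in lebesgue_on \<Omega>. norm (f x \<bullet> g x) \<le> norm ((norm (f x))\<^sup>2 + (norm (g x))\<^sup>2)"
  proof (rule AE_I2)
    fix x
    have "\<bar>f x \<bullet> g x\<bar> \<le> norm (f x) * norm (g x)" by (rule Cauchy_Schwarz_ineq2)
    also have "\<dots> \<le> (norm (f x))\<^sup>2 + (norm (g x))\<^sup>2"
    proof -
      have "0 \<le> norm (f x) * norm (g x)" by simp
      then show ?thesis
        using sum_squares_bound[of "norm (f x)" "norm (g x)"] unfolding mult.assoc by linarith
    qed
    finally show "norm (f x \<bullet> g x) \<le> norm ((norm (f x))\<^sup>2 + (norm (g x))\<^sup>2)" by simp
  qed
qed

lemma L2_expand:
  fixes f g :: "'a::euclidean_space \<Rightarrow> 'b::euclidean_space"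
  assumes "f \<in> Lp 2 \<Omega>" "g \<in> Lp 2 \<Omega>"
  shows "(LINT x|lebesgue_on \<Omega>. (norm (f x + r *\<^sub>R g x))\<^sup>2) =
    (LINT x|lebesgue_on \<Omega>. (norm (f x))\<^sup>2) + 2 * r * (LINT x|lebesgue_on \<Omega>. f x \<bullet> g x) + r\<^sup>2 * (LINT x|lebesgue_on \<Omega>. (norm (g x))\<^sup>2)"
proof -
  have "(norm (f x + r *\<^sub>R g x))\<^sup>2 = (norm (f x))\<^sup>2 + (2 * r) * (f x \<bullet> g x) + r\<^sup>2 * (norm (g x))\<^sup>2" for x
    unfolding power2_norm_eq_inner
    by (simp only: inner_add_left inner_add_right inner_scaleR_left inner_scaleR_right
        inner_commute[of "g x" "f x"] power2_eq_square) (simp add: algebra_simps)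
  then show ?thesis
    using L2_inner_integrable[OF assms] assms by (simp add: Lp_2_iff)
qed

text \<open>The quadratic polynomial $r \mapsto \int |f + r g|^2$ is nonnegative.\<close>

lemma L2_cauchy_schwarz:
  fixes f g :: "'a::euclidean_space \<Rightarrow> 'b::euclidean_space"
  assumes "f \<in> Lp 2 \<Omega>" "g \<in> Lp 2 \<Omega>"
  shows "\<bar>LINT x|lebesgue_on \<Omega>. f x \<bullet> g x\<bar> \<le> Lp_norm 2 \<Omega> f * Lp_norm 2 \<Omega> g"
proof -
  let ?A = "LINT x|lebesgue_on \<Omega>. (norm (f x))\<^sup>2" and ?B = "LINT x|lebesgue_on \<Omega>. (norm (g x))\<^sup>2"
    and ?c = "LINT x|lebesgue_on \<Omega>. f x \<bullet> g x"
  have quad: "0 \<le> ?A + 2 * r * ?c + r\<^sup>2 * ?B" for r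
    unfolding L2_expand[OF assms, symmetric] by (intro integral_nonneg_AE) auto
  have B: "0 \<le> ?B" "0 \<le> ?A" by (intro integral_nonneg_AE; simp)+
  have "?c\<^sup>2 \<le> ?A * ?B"
  proof (cases "?B = 0")
    case True
    have "?c = 0"
    proof (rule ccontr)
      assume "?c \<noteq> 0"
      then show False using quad[of "- (?A + 1) / (2 * ?c)"] True by (simp add: field_simps)
    qed
    then show ?thesis using True by simp
  next
    case False
    have "0 \<le> ?A + 2 * (- ?c / ?B) * ?c + (- ?c / ?B)\<^sup>2 * ?B" by (rule quad)
    also have "\<dots> = ?A - ?c\<^sup>2 / ?B" using False by (simp add: power2_eq_square field_simps)
    finally have "?c\<^sup>2 / ?B \<le> ?A" by simp
    then show ?thesis using False B by (simp add: pos_divide_le_eq)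
  qed
  then have "sqrt (?c\<^sup>2) \<le> sqrt (?A * ?B)" by (rule real_sqrt_le_mono)
  then show ?thesis by (simp only: real_sqrt_abs Lp_norm_2 real_sqrt_mult)
qed

text \<open>On a set of finite measure $|f|^r \le 1 + |f|^q$. It makes elements of \<open>W1_0 3 \<Omega>\<close> square
  integrable, so that they pair with \<open>v t\<close>.\<close>

lemma Lp_mono_bounded:
  fixes f :: "'a::euclidean_space \<Rightarrow> 'b::euclidean_space"
  assumes "bounded \<Omega>" "\<Omega> \<in> sets lebesgue" "0 < r" "r \<le> q" "f \<in> Lp q \<Omega>"
  shows "f \<in> Lp r \<Omega>"
proof -
  have [measurable]: "f \<in> borel_measurable (lebesgue_on \<Omega>)" using assms(5) by (simp add: Lp_def)
  have "integrable (lebesgue_on \<Omega>) (\<lambda>x. 1 + norm (f x) powr q)"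
  proof (intro Bochner_Integration.integrable_add)
    show "integrable (lebesgue_on \<Omega>) (\<lambda>x. 1::real)"
      using bounded_set_imp_lmeasurable[OF assms(1,2)]
      by (simp add: integrable_lebesgue_on_iff[OF assms(2)] lmeasurable_iff_integrable)
    show "integrable (lebesgue_on \<Omega>) (\<lambda>x. norm (f x) powr q)" using assms(5) by (simp add: Lp_def)
  qed
  then have "integrable (lebesgue_on \<Omega>) (\<lambda>x. norm (f x) powr r)"
  proof (rule Bochner_Integration.integrable_bound)
    show "AE x in lebesgue_on \<Omega>. norm (norm (f x) powr r) \<le> norm (1 + norm (f x) powr q)"
    proof (rule AE_I2)
      fix x
      have "norm (f x) powr r \<le> 1 + norm (f x) powr q"
      proof (cases "norm (f x) \<le> 1")
        case True
        then have "norm (f x) powr r \<le> 1 powr r" using assms(3) by (intro powr_mono2) auto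
        then show ?thesis by (simp add: add_increasing2)
      next
        case False
        then have "norm (f x) powr r \<le> norm (f x) powr q" using assms(4) by (intro powr_mono) auto
        then show ?thesis by simp
      qed
      then show "norm (norm (f x) powr r) \<le> norm (1 + norm (f x) powr q)" by simp
    qed
  qed measurable
  then show ?thesis by (simp add: Lp_def)
qed

text \<open>The scalar function $t \mapsto (v(t), w)$ is continuous by Cauchy-Schwarz, and its
  distributional derivative is $\langle\partial_t u, w\rangle$.\<close>

lemma time_derivative_increment:
  fixes T :: real
  defines "S \<equiv> {0<..<T}"
  assumes "open \<Omega>" "bounded \<Omega>" "T > 0"
    and du: "du \<in> L32_dual T \<Omega>" and der: "is_time_derivative T \<Omega> u du"
    and v: "continuous_L2_rep T \<Omega> u v" and w: "w \<in> W1_0 3 \<Omega>"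
    and st: "0 \<le> s" "s \<le> t" "t \<le> T"
  shows "(LINT x|lebesgue_on \<Omega>. (v t - v s) x \<bullet> w x) =
    primitive (\<lambda>\<tau>. indicator S \<tau> * du \<tau> w) t - primitive (\<lambda>\<tau>. indicator S \<tau> * du \<tau> w) s"
proof -
  interpret W: seminormed "W1_0 3 \<Omega>" "W1_norm 3 \<Omega>"
    using assms(2) by (rule W1_0_seminormed) simp
  have duals: "W1_0_dual 3 \<Omega> = W.dual" "W1_0_dual_norm 3 \<Omega> = W.dual_norm"
    using W1_0_dual_eq[OF W.seminormed_axioms] by auto
  have S: "S \<in> sets lebesgue" by (simp add: S_def)
  have \<Omega>: "\<Omega> \<in> sets lebesgue" using assms(2) by (intro sets_completionI_sets) simp
  have w2: "w \<in> Lp 2 \<Omega>"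
    using w by (intro Lp_mono_bounded[OF assms(3) \<Omega>, of 2 3]) (auto simp: W1_0_def W1_def)
  have v2: "v t \<in> Lp 2 \<Omega>" if "t \<in> {0..T}" for t using v that by (simp add: continuous_L2_rep_def)
  have dv2: "v t - v s \<in> Lp 2 \<Omega>" if "t \<in> {0..T}" "s \<in> {0..T}" for s t
    using Lp_lin[of 2 "v t" \<Omega> "v s" 1 "-1"] v2 that by (simp add: fun_diff_def)
  define c where "c = (\<lambda>t. LINT x|lebesgue_on \<Omega>. v t x \<bullet> w x)"
  have cdiff: "c t - c s = (LINT x|lebesgue_on \<Omega>. (v t - v s) x \<bullet> w x)" if "t \<in> {0..T}" "s \<in> {0..T}" for s t
    unfolding c_def using L2_inner_integrable[OF v2[OF that(1)] w2] L2_inner_integrable[OF v2[OF that(2)] w2]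
    by (simp add: inner_diff_left)
  have c: "continuous_on {0..T} c"
    unfolding continuous_on_def
  proof
    fix t assume t: "t \<in> {0..T}"
    have "((\<lambda>s. Lp_norm 2 \<Omega> (v s - v t) * Lp_norm 2 \<Omega> w) \<longlongrightarrow> 0 * Lp_norm 2 \<Omega> w) (at t within {0..T})"
      using v t by (intro tendsto_mult tendsto_const) (auto simp: continuous_L2_rep_def)
    then have lim0: "((\<lambda>s. Lp_norm 2 \<Omega> (v s - v t) * Lp_norm 2 \<Omega> w) \<longlongrightarrow> 0) (at t within {0..T})" by simp
    have "((\<lambda>s. c s - c t) \<longlongrightarrow> 0) (at t within {0..T})"
    proof (rule Lim_null_comparison[OF _ lim0])
      show "\<forall>\<^sub>F s in at t within {0..T}. norm (c s - c t) \<le> Lp_norm 2 \<Omega> (v s - v t) * Lp_norm 2 \<Omega> w"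
        unfolding eventually_at_filter
        by (rule always_eventually) (use cdiff t L2_cauchy_schwarz[OF dv2 w2] in simp)
    qed
    then show "(c \<longlongrightarrow> c t) (at t within {0..T})" by (simp add: LIM_zero_iff)
  qed
  have g: "integrable (lebesgue_on S) (\<lambda>\<tau>. du \<tau> w)"
  proof (rule Bochner_Integration.integrable_bound)
    have du': "du \<in> bochner_Lp (3/2) (lebesgue_on S) W.dual W.dual_norm"
      using du by (simp add: duals S_def)
    show "(\<lambda>\<tau>. du \<tau> w) \<in> borel_measurable (lebesgue_on S)"
      by (rule W.measurable_dual_app[OF S du' w])
    have "integrable (lebesgue_on S) (\<lambda>x. 1::real)"
      using integrable_indicator_bounded[OF _ S] by (simp add: integrable_lebesgue_on_iff[OF S]) (simp add: S_def)
    then show "integrable (lebesgue_on S) (\<lambda>\<tau>. 1 * W.dual_norm (du \<tau>) powr (3/2) + W1_norm 3 \<Omega> w powr 3 / 1\<^sup>2 * 1)"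
      using du' by (intro Bochner_Integration.integrable_add integrable_mult_right) (simp_all add: bochner_Lp_def)
    have "AE \<tau> in lebesgue_on S. du \<tau> \<in> W.dual" using du' by (simp add: bochner_Lp_def)
    then show "AE \<tau> in lebesgue_on S. norm (du \<tau> w) \<le> norm (1 * W.dual_norm (du \<tau>) powr (3/2) + W1_norm 3 \<Omega> w powr 3 / 1\<^sup>2 * 1)"
    proof eventually_elim
      case (elim \<tau>)
      show ?case
        using W.dual_norm_bound[OF elim w] young_3_2[of "W.dual_norm (du \<tau>)" "W1_norm 3 \<Omega> w" 1]
          W.dual_norm_nonneg[OF elim] W.nonneg[of w] by simp
    qed
  qed
  have weak: "(LINT t|lebesgue_on S. c t * deriv \<eta> t) = - (LINT t|lebesgue_on S. du t w * \<eta> t)"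
    if \<eta>: "\<eta> \<in> test_functions S" for \<eta>
  proof -
    have eq: "AE t in lebesgue_on S. c t * deriv \<eta> t = (LINT x|lebesgue_on \<Omega>. u t x \<bullet> w x) * deriv \<eta> t"
    proof -
      have "AE t in lebesgue_on S. AE x in lebesgue_on \<Omega>. v t x = u t x"
        using v unfolding continuous_L2_rep_def S_def by blast
      then show ?thesis
        using AE_space
      proof eventually_elim
        case (elim t)
        have "v t \<in> Lp 2 \<Omega>" using elim(2) by (intro v2) (auto simp: S_def)
        moreover have "AE x in lebesgue_on \<Omega>. v t x \<bullet> w x = u t x \<bullet> w x"
          using elim(1) by (rule eventually_mono) simp
        ultimately have "(LINT x|lebesgue_on \<Omega>. u t x \<bullet> w x) = c t"
          unfolding c_def by (intro integrable_AE_eq_lebesgue_on(2)[OF \<Omega>] L2_inner_integrable w2)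
        then show ?case by simp
      qed
    qed
    have \<eta>': "continuous_on UNIV (deriv \<eta>)"
    proof -
      have "C_k (Suc 0) \<eta>" using \<eta> unfolding test_functions_def by blast
      then have d: "\<And>x. \<eta> differentiable (at x)" and cd: "continuous_on UNIV (\<lambda>x. frechet_derivative \<eta> (at x) 1)" by auto
      have "frechet_derivative \<eta> (at x) 1 = deriv \<eta> x" for x
      proof -
        obtain D where D: "(\<eta> has_real_derivative D) (at x)" using d[of x] real_differentiableE by blast
        then have "frechet_derivative \<eta> (at x) = (*) D"
          by (intro frechet_derivative_at[symmetric]) (simp add: has_field_derivative_def)
        then show ?thesis using DERIV_imp_deriv[OF D] by simp
      qed
      with cd show ?thesis by simp
    qed
    have m: "(\<lambda>t. c t * deriv \<eta> t) \<in> borel_measurable (lebesgue_on S)"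
    proof -
      have "continuous_on S (\<lambda>t. c t * deriv \<eta> t)"
        by (intro continuous_on_mult continuous_on_subset[OF c] continuous_on_subset[OF \<eta>']) (auto simp: S_def)
      then show ?thesis
        by (intro continuous_imp_measurable_on_sets_lebesgue S)
    qed
    have "(LINT t|lebesgue_on S. c t * deriv \<eta> t) = (LINT t|lebesgue_on S. (LINT x|lebesgue_on \<Omega>. u t x \<bullet> w x) * deriv \<eta> t)"
      by (rule integral_cong_AE[OF m borel_measurable_AE_lebesgue_on[OF S m eq] eq])
    also have "\<dots> = - (LINT t|lebesgue_on S. du t w * \<eta> t)"
      using der \<eta> w by (simp add: is_time_derivative_def S_def)
    finally show ?thesis .
  qed
  have "c t - c s = primitive (\<lambda>\<tau>. indicator S \<tau> * du \<tau> w) t - primitive (\<lambda>\<tau>. indicator S \<tau> * du \<tau> w) s"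
    using weak_derivative_increment[OF c, of "\<lambda>\<tau>. du \<tau> w" s t] g weak st by (simp add: S_def)
  then show ?thesis using cdiff[of t s] st by simp
qed

text \<open>Half of the chain rule for the kinetic energy $\frac12\int|v(t)|^2$. Its increment from \<open>t\<close>
  to \<open>r\<close> is $(v(r) - v(t), v(t)) + \frac12\int|v(r) - v(t)|^2$; dropping the square and writing
  the inner product through \<open>time_derivative_increment\<close> with $w = u(t)$ gives the hypothesis of
  \<open>energy_gain\<close>.\<close>

theorem time_derivative_energy:
  fixes T :: real
  assumes "open \<Omega>" "bounded \<Omega>" and T: "T > 0"
    and u: "u \<in> L3_W1_0 T \<Omega>" and du: "du \<in> L32_dual T \<Omega>" and der: "is_time_derivative T \<Omega> u du"
    and v: "continuous_L2_rep T \<Omega> u v"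
  shows "integrable (lebesgue_on {0<..<T}) (\<lambda>t. du t (u t))"
    and "(LINT t|lebesgue_on {0<..<T}. du t (u t)) \<le>
      1/2 * (LINT x|lebesgue_on \<Omega>. (norm (v T x))\<^sup>2) - 1/2 * (LINT x|lebesgue_on \<Omega>. (norm (v 0 x))\<^sup>2)"
proof -
  let ?S = "{0<..<T}"
  interpret W: seminormed "W1_0 3 \<Omega>" "W1_norm 3 \<Omega>"
    using assms(1) by (rule W1_0_seminormed) simp
  have duals: "W1_0_dual 3 \<Omega> = W.dual" "W1_0_dual_norm 3 \<Omega> = W.dual_norm"
    using W1_0_dual_eq[OF W.seminormed_axioms] by auto
  have S: "?S \<in> sets lebesgue" by simp
  have \<Omega>: "\<Omega> \<in> sets lebesgue" using assms(1) by (intro sets_completionI_sets) simp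
  have v2: "v t \<in> Lp 2 \<Omega>" if "t \<in> {0..T}" for t using v that by (simp add: continuous_L2_rep_def)
  have dv2: "v t - v s \<in> Lp 2 \<Omega>" if "t \<in> {0..T}" "s \<in> {0..T}" for s t
    using Lp_lin[of 2 "v t" \<Omega> "v s" 1 "-1"] v2 that by (simp add: fun_diff_def)
  define E where "E = (\<lambda>t. 1/2 * (LINT x|lebesgue_on \<Omega>. (norm (v t x))\<^sup>2))"
  have Ediff: "E s - E t = (LINT x|lebesgue_on \<Omega>. (v s - v t) x \<bullet> v t x) + 1/2 * (Lp_norm 2 \<Omega> (v s - v t))\<^sup>2"
    if "t \<in> {0..T}" "s \<in> {0..T}" for s t
  proof -
    have "(LINT x|lebesgue_on \<Omega>. (norm (v t x + 1 *\<^sub>R (v s - v t) x))\<^sup>2) = (LINT x|lebesgue_on \<Omega>. (norm (v s x))\<^sup>2)"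
      by simp
    moreover have "(LINT x|lebesgue_on \<Omega>. v t x \<bullet> (v s - v t) x) = (LINT x|lebesgue_on \<Omega>. (v s - v t) x \<bullet> v t x)"
      by (simp only: inner_commute)
    moreover have "(Lp_norm 2 \<Omega> (v s - v t))\<^sup>2 = (LINT x|lebesgue_on \<Omega>. (norm ((v s - v t) x))\<^sup>2)"
      unfolding Lp_norm_2 by (rule real_sqrt_pow2) (intro integral_nonneg_AE, simp)
    ultimately show ?thesis
      using L2_expand[OF v2[OF that(1)] dv2[OF that(2,1)], of 1] unfolding E_def by (simp add: field_simps)
  qed
  have cE: "continuous_on {0..T} E"
    unfolding continuous_on_def
  proof
    fix t assume t: "t \<in> {0..T}"
    let ?n = "\<lambda>s. Lp_norm 2 \<Omega> (v s - v t)"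
    have n: "(?n \<longlongrightarrow> 0) (at t within {0..T})" using v t by (auto simp: continuous_L2_rep_def)
    have "((\<lambda>s. ?n s * Lp_norm 2 \<Omega> (v t) + 1/2 * (?n s)\<^sup>2) \<longlongrightarrow> 0 * Lp_norm 2 \<Omega> (v t) + 1/2 * 0\<^sup>2) (at t within {0..T})"
      by (intro tendsto_intros n)
    then have lim0: "((\<lambda>s. ?n s * Lp_norm 2 \<Omega> (v t) + 1/2 * (?n s)\<^sup>2) \<longlongrightarrow> 0) (at t within {0..T})" by simp
    have "((\<lambda>s. E s - E t) \<longlongrightarrow> 0) (at t within {0..T})"
    proof (rule Lim_null_comparison[OF _ lim0])
      have "norm (E s - E t) \<le> ?n s * Lp_norm 2 \<Omega> (v t) + 1/2 * (?n s)\<^sup>2" if "s \<in> {0..T}" for s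
      proof -
        have "0 \<le> (?n s)\<^sup>2" by simp
        then show ?thesis
          using Ediff[OF t that] L2_cauchy_schwarz[OF dv2[OF that t] v2[OF t]] unfolding real_norm_def by linarith
      qed
      then show "\<forall>\<^sub>F s in at t within {0..T}. norm (E s - E t) \<le> ?n s * Lp_norm 2 \<Omega> (v t) + 1/2 * (?n s)\<^sup>2"
        unfolding eventually_at_filter by (intro always_eventually) blast
    qed
    then show "(E \<longlongrightarrow> E t) (at t within {0..T})" by (simp add: LIM_zero_iff)
  qed
  \<comment> \<open>The energy is continued by constants, to match the primitive, which is constant outside
    \<open>?S\<close>.\<close>
  define F where "F = (\<lambda>t. E (max 0 (min T t)))"
  have F: "continuous_on UNIV F"
    unfolding F_def by (rule continuous_on_compose2[OF cE]) (use T in \<open>auto intro!: continuous_intros\<close>)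
  have key: "AE t in lebesgue_on ?S. \<forall>h>0.
      primitive (\<lambda>\<tau>. indicator ?S \<tau> * du \<tau> (u t)) (t + h) - primitive (\<lambda>\<tau>. indicator ?S \<tau> * du \<tau> (u t)) t \<le> F (t + h) - F t"
  proof -
    have "AE t in lebesgue_on ?S. u t \<in> W1_0 3 \<Omega>" using u by (simp add: bochner_Lp_def)
    moreover have "AE t in lebesgue_on ?S. AE x in lebesgue_on \<Omega>. v t x = u t x"
      using v by (simp add: continuous_L2_rep_def)
    ultimately show ?thesis
      using AE_space
    proof eventually_elim
      case (elim t)
      let ?G = "\<lambda>\<tau>. indicator ?S \<tau> * du \<tau> (u t)"
      show ?case
      proof (intro allI impI)
        fix h :: real assume h: "h > 0"
        let ?r = "min T (t + h)"
        have t: "t \<in> {0..T}" "?r \<in> {0..T}" "t \<le> ?r" using elim(3) h by auto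
        have beyond: "primitive ?G (t + h) = primitive ?G ?r"
          unfolding primitive_def by (intro Bochner_Integration.integral_cong) (auto simp: indicator_def)
        have "primitive ?G ?r - primitive ?G t = (LINT x|lebesgue_on \<Omega>. (v ?r - v t) x \<bullet> u t x)"
          using t by (intro time_derivative_increment[OF assms(1,2) T du der v elim(1), symmetric]) auto
        also have "\<dots> = (LINT x|lebesgue_on \<Omega>. (v ?r - v t) x \<bullet> v t x)"
          by (rule integrable_AE_eq_lebesgue_on(2)[OF \<Omega> L2_inner_integrable[OF dv2[OF t(2,1)] v2[OF t(1)]]])
            (use elim(2) in eventually_elim, simp)
        also have "\<dots> \<le> E ?r - E t" unfolding Ediff[OF t(1,2)] by simp
        also have "\<dots> = F (t + h) - F t" using t h by (simp add: F_def)
        finally show "primitive ?G (t + h) - primitive ?G t \<le> F (t + h) - F t" by (simp add: beyond)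
      qed
    qed
  qed
  have du': "du \<in> bochner_Lp (3/2) (lebesgue_on ?S) W.dual W.dual_norm"
    using du by (simp add: duals)
  note gain = W.energy_gain[OF T du' u F key]
  show "integrable (lebesgue_on ?S) (\<lambda>t. du t (u t))" by (rule gain(1))
  show "(LINT t|lebesgue_on ?S. du t (u t)) \<le>
      1/2 * (LINT x|lebesgue_on \<Omega>. (norm (v T x))\<^sup>2) - 1/2 * (LINT x|lebesgue_on \<Omega>. (norm (v 0 x))\<^sup>2)"
    using gain(2) T by (simp add: F_def E_def)
qed

section \<open>Integration over space-time\<close>

lemma AE_lebesgue_pair:
  fixes P :: "'a::euclidean_space \<times> 'b::euclidean_space \<Rightarrow> bool"
  assumes "AE z in lebesgue. P z"
  shows "AE x in lebesgue. AE y in lebesgue. P (x, y)"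
proof -
  have "AE z in lborel \<Otimes>\<^sub>M lborel. P z"
    using assms unfolding lborel_prod AE_completion_iff .
  from lborel_pair.AE_pair[OF this] show ?thesis
    by (simp add: AE_completion_iff)
qed

text \<open>Lebesgue measure on a product is the completion of the product of the Borel measures. So \<open>f\<close>
  is replaced by a Borel function, almost all of whose sections agree almost everywhere with those
  of \<open>f\<close>.\<close>

lemma lebesgue_Fubini:
  fixes f :: "'a::euclidean_space \<times> 'b::euclidean_space \<Rightarrow> real"
  assumes f: "integrable lebesgue f"
  shows "AE x in lebesgue. integrable lebesgue (\<lambda>y. f (x, y))"
    and "integrable lebesgue (\<lambda>x. LINT y|lebesgue. f (x, y))"
    and "(LINT x|lebesgue. LINT y|lebesgue. f (x, y)) = integral\<^sup>L lebesgue f"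
proof -
  note AE_eq = integrable_AE_eq_lebesgue_on[where S=UNIV, unfolded lebesgue_on_UNIV_eq]
  obtain f' where f'[measurable]: "f' \<in> borel_measurable lborel" and eq: "AE z in lborel. f z = f' z"
    using completion_ex_borel_measurable_real[OF borel_measurable_integrable[OF f]] by blast
  have eq': "AE z in lebesgue. f z = f' z" using eq by (rule AE_completion)
  have "integrable lebesgue f'" "integral\<^sup>L lebesgue f' = integral\<^sup>L lebesgue f"
    using AE_eq[OF _ f eq'] by simp_all
  then have f'i: "integrable (lborel \<Otimes>\<^sub>M lborel) f'" "integral\<^sup>L (lborel \<Otimes>\<^sub>M lborel) f' = integral\<^sup>L lebesgue f"
    using f' by (simp_all add: integrable_completion integral_completion lborel_prod)
  have sec: "AE x in lebesgue. AE y in lebesgue. f' (x, y) = f (x, y)"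
    using eq' by (intro AE_lebesgue_pair) (auto elim!: eventually_mono)
  have int': "AE x in lebesgue. integrable lebesgue (\<lambda>y. f' (x, y)) \<and> (LINT y|lebesgue. f' (x, y)) = (LINT y|lborel. f' (x, y))"
    using AE_completion[OF lborel_pair.AE_integrable_fst'[OF f'i(1)]]
    by eventually_elim (simp add: integrable_completion integral_completion borel_measurable_integrable)
  have both: "AE x in lebesgue. integrable lebesgue (\<lambda>y. f (x, y)) \<and> (LINT y|lborel. f' (x, y)) = (LINT y|lebesgue. f (x, y))"
    using sec int'
  proof eventually_elim
    case (elim x)
    then show ?case using AE_eq[of "\<lambda>y. f' (x, y)" "\<lambda>y. f (x, y)"] by simp
  qed
  then show "AE x in lebesgue. integrable lebesgue (\<lambda>y. f (x, y))" by eventually_elim blast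
  have i: "integrable lebesgue (\<lambda>x. LINT y|lborel. f' (x, y))"
    "(LINT x|lebesgue. LINT y|lborel. f' (x, y)) = integral\<^sup>L lebesgue f"
    using lborel_pair.integrable_fst'[OF f'i(1)] lborel_pair.integral_fst'[OF f'i(1)] f'i(2)
    by (simp_all add: integrable_completion integral_completion borel_measurable_integrable)
  have "AE x in lebesgue. (LINT y|lborel. f' (x, y)) = (LINT y|lebesgue. f (x, y))"
    using both by eventually_elim blast
  from AE_eq[OF _ i(1) this] i(2) show "integrable lebesgue (\<lambda>x. LINT y|lebesgue. f (x, y))"
    "(LINT x|lebesgue. LINT y|lebesgue. f (x, y)) = integral\<^sup>L lebesgue f" by simp_all
qed

lemma lebesgue_Tonelli:
  fixes f :: "'a::euclidean_space \<times> 'b::euclidean_space \<Rightarrow> real"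
  assumes f: "f \<in> borel_measurable lebesgue" and pos: "\<And>z. 0 \<le> f z"
    and sections: "AE x in lebesgue. integrable lebesgue (\<lambda>y. f (x, y)) \<and> (LINT y|lebesgue. f (x, y)) \<le> h x"
    and h: "integrable lebesgue h"
  shows "integrable lebesgue f"
proof -
  note AE_eq = integrable_AE_eq_lebesgue_on[where S=UNIV, unfolded lebesgue_on_UNIV_eq]
  obtain f' where f'[measurable]: "f' \<in> borel_measurable lborel" and eq: "AE z in lborel. f z = f' z"
    using completion_ex_borel_measurable_real[OF f] by blast
  have eq': "AE z in lebesgue. f z = f' z" using eq by (rule AE_completion)
  have sec: "AE x in lebesgue. AE y in lebesgue. f (x, y) = f' (x, y)"
    using eq' by (rule AE_lebesgue_pair)
  have m: "f' \<in> borel_measurable (lborel \<Otimes>\<^sub>M lborel)" using f' by (simp add: lborel_prod)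
  have s: "AE x in lebesgue. integrable lborel (\<lambda>y. f' (x, y)) \<and> (LINT y|lborel. norm (f' (x, y))) \<le> h x"
    using sec sections
  proof eventually_elim
    case (elim x)
    have mx: "(\<lambda>y. f' (x, y)) \<in> borel_measurable lborel"
      using measurable_compose[OF measurable_Pair1' m] by simp
    have i: "integrable lebesgue (\<lambda>y. f' (x, y))" using AE_eq(1)[OF _ _ elim(1)] elim(2) by simp
    have eqn: "AE y in lebesgue. f (x, y) = norm (f' (x, y))"
      using elim(1) by eventually_elim (use pos[of "(x, _)"] in \<open>simp\<close>, metis abs_of_nonneg pos)
    have "(LINT y|lebesgue. norm (f' (x, y))) = (LINT y|lebesgue. f (x, y))"
      using AE_eq(2)[OF _ _ eqn] elim(2) by simp
    then show ?case
      using elim(2) i mx by (simp add: integrable_completion integral_completion)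
  qed
  have "integrable (lborel \<Otimes>\<^sub>M lborel) f'"
  proof (rule lborel_pair.Fubini_integrable[OF m])
    show "AE x in lborel. integrable lborel (\<lambda>y. f' (x, y))"
      using s unfolding AE_completion_iff by eventually_elim blast
    have mi: "(\<lambda>x. LINT y|lborel. norm (f' (x, y))) \<in> borel_measurable lborel"
      using m by measurable
    have "integrable lebesgue (\<lambda>x. LINT y|lborel. norm (f' (x, y)))"
    proof (rule Bochner_Integration.integrable_bound[OF h])
      show "(\<lambda>x. LINT y|lborel. norm (f' (x, y))) \<in> borel_measurable lebesgue"
        using mi by (rule measurable_completion)
      show "AE x in lebesgue. norm (LINT y|lborel. norm (f' (x, y))) \<le> norm (h x)"
        using s
      proof eventually_elim
        case (elim x)
        have "0 \<le> (LINT y|lborel. norm (f' (x, y)))" by (intro integral_nonneg_AE) auto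
        with elim show ?case by (metis abs_ge_self abs_of_nonneg order_trans real_norm_def)
      qed
    qed
    then show "integrable lborel (\<lambda>x. LINT y|lborel. norm (f' (x, y)))"
      using mi by (simp add: integrable_completion)
  qed
  then have "integrable lebesgue f'" using f' by (simp add: lborel_prod integrable_completion)
  moreover have "AE z in lebesgue. f' z = f z" using eq' by eventually_elim simp
  ultimately show ?thesis using AE_eq(1)[of f' f] by simp
qed

context
  fixes A :: "'a::euclidean_space set" and B :: "'b::euclidean_space set"
  assumes A: "A \<in> sets lebesgue" and B: "B \<in> sets lebesgue" and AB: "A \<times> B \<in> sets lebesgue"
begin

lemma AE_lebesgue_on_Times:
  assumes "AE z in lebesgue_on (A \<times> B). P z"
  shows "AE x in lebesgue_on A. AE y in lebesgue_on B. P (x, y)"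
  using AE_lebesgue_pair[OF assms[unfolded AE_lebesgue_on_iff[OF AB]]]
  unfolding AE_lebesgue_on_iff[OF A] AE_lebesgue_on_iff[OF B]
  by eventually_elim (auto elim!: eventually_mono)

lemma section_indicator:
  fixes f :: "'a \<times> 'b \<Rightarrow> real"
  shows "(\<lambda>y. indicator (A \<times> B) (x, y) *\<^sub>R f (x, y)) = (\<lambda>y. indicator A x *\<^sub>R (indicator B y *\<^sub>R f (x, y)))"
  by (auto simp: indicator_def fun_eq_iff)

lemma lebesgue_on_Fubini:
  fixes f :: "'a \<times> 'b \<Rightarrow> real"
  assumes f: "integrable (lebesgue_on (A \<times> B)) f"
  shows "AE x in lebesgue_on A. integrable (lebesgue_on B) (\<lambda>y. f (x, y))"
    and "integrable (lebesgue_on A) (\<lambda>x. LINT y|lebesgue_on B. f (x, y))"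
    and "(LINT x|lebesgue_on A. LINT y|lebesgue_on B. f (x, y)) = integral\<^sup>L (lebesgue_on (A \<times> B)) f"
proof -
  note F = lebesgue_Fubini[OF f[unfolded integrable_lebesgue_on_iff[OF AB]], unfolded section_indicator]
  show "AE x in lebesgue_on A. integrable (lebesgue_on B) (\<lambda>y. f (x, y))"
    unfolding AE_lebesgue_on_iff[OF A] integrable_lebesgue_on_iff[OF B]
    using F(1) by eventually_elim (auto simp: indicator_def)
  have *: "(LINT y|lebesgue. indicator A x *\<^sub>R (indicator B y *\<^sub>R f (x, y))) = indicator A x *\<^sub>R (LINT y|lebesgue_on B. f (x, y))" for x
    unfolding integral_lebesgue_on[OF B] by simp
  show "integrable (lebesgue_on A) (\<lambda>x. LINT y|lebesgue_on B. f (x, y))"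
    unfolding integrable_lebesgue_on_iff[OF A] using F(2) unfolding * .
  show "(LINT x|lebesgue_on A. LINT y|lebesgue_on B. f (x, y)) = integral\<^sup>L (lebesgue_on (A \<times> B)) f"
    unfolding integral_lebesgue_on[OF A] integral_lebesgue_on[OF AB] using F(3) unfolding * .
qed

lemma lebesgue_on_Tonelli:
  fixes f :: "'a \<times> 'b \<Rightarrow> real"
  assumes f: "f \<in> borel_measurable (lebesgue_on (A \<times> B))" and pos: "\<And>z. 0 \<le> f z"
    and sections: "AE x in lebesgue_on A. integrable (lebesgue_on B) (\<lambda>y. f (x, y)) \<and> (LINT y|lebesgue_on B. f (x, y)) \<le> h x"
    and h: "integrable (lebesgue_on A) h"
  shows "integrable (lebesgue_on (A \<times> B)) f"
  unfolding integrable_lebesgue_on_iff[OF AB]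
proof (rule lebesgue_Tonelli)
  show "(\<lambda>z. indicator (A \<times> B) z *\<^sub>R f z) \<in> borel_measurable lebesgue"
    using borel_measurable_indicator_times[OF AB f] by simp
  show "integrable lebesgue (\<lambda>x. indicator A x *\<^sub>R h x)"
    using h by (simp only: integrable_lebesgue_on_iff[OF A])
  show "AE x in lebesgue. integrable lebesgue (\<lambda>y. indicator (A \<times> B) (x, y) *\<^sub>R f (x, y)) \<and>
      (LINT y|lebesgue. indicator (A \<times> B) (x, y) *\<^sub>R f (x, y)) \<le> indicator A x *\<^sub>R h x"
    unfolding section_indicator
    using sections[unfolded AE_lebesgue_on_iff[OF A] integrable_lebesgue_on_iff[OF B] integral_lebesgue_on[OF B]]
    by eventually_elim (auto simp: indicator_def[of A])
qed (simp add: pos)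

end

section \<open>Matrices\<close>

text \<open>Hence $|A : B| \le 2|A||B|$ in the normalisation of \<^const>\<open>mnorm\<close>, the inequality whose
  equality case is at stake.\<close>

lemma frob_inner: "frob A B = A \<bullet> B"
proof -
  have "frob A B = (\<Sum>i\<in>UNIV. \<Sum>k\<in>UNIV. A $ k $ i * B $ k $ i)"
    by (simp add: frob_def trace_def matrix_matrix_mult_def transpose_def)
  also have "\<dots> = (\<Sum>k\<in>UNIV. \<Sum>i\<in>UNIV. A $ k $ i * B $ k $ i)" by (rule sum.swap)
  finally show ?thesis by (simp add: inner_vec_def)
qed

lemma mnorm_norm: "mnorm A = norm A / sqrt 2"
  by (simp add: mnorm_def frob_inner norm_eq_sqrt_inner real_sqrt_divide)

lemma mnorm_nonneg: "0 \<le> mnorm A"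
  by (simp add: mnorm_norm)

lemma mnorm_le_norm: "mnorm A \<le> norm A"
proof -
  have "1 \<le> sqrt 2" by simp
  then have "norm A * 1 \<le> norm A * sqrt 2" by (intro mult_left_mono) auto
  then show ?thesis by (simp add: mnorm_norm divide_le_eq)
qed

lemma frob_self: "frob A A = 2 * (mnorm A)\<^sup>2"
  by (simp add: frob_inner mnorm_norm power_divide power2_norm_eq_inner)

lemma frob_le: "\<bar>frob A B\<bar> \<le> 2 * mnorm A * mnorm B"
proof -
  have "\<bar>A \<bullet> B\<bar> \<le> norm A * norm B" by (rule Cauchy_Schwarz_ineq2)
  also have "\<dots> = 2 * mnorm A * mnorm B" by (simp add: mnorm_norm)
  finally show ?thesis by (simp add: frob_inner)
qed

lemma bounded_linear_parts: "bounded_linear sym_part" "bounded_linear dev_part"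
proof -
  have "linear sym_part"
    by (rule linearI) (simp_all add: sym_part_def transpose_def vec_eq_iff algebra_simps)
  moreover have "trace (r *\<^sub>R G) = r * trace G" for r and G :: "real^3^3"
    by (simp add: trace_def sum_distrib_left)
  ultimately have "linear dev_part" "linear sym_part"
    by (auto intro!: linearI simp: dev_part_def linear_add linear_scale trace_add add_divide_distrib algebra_simps)
  then show "bounded_linear sym_part" "bounded_linear dev_part"
    by (simp_all add: linear_conv_bounded_linear)
qed

lemma parts_measurable [measurable]:
  "sym_part \<in> borel_measurable borel" "dev_part \<in> borel_measurable borel" "mnorm \<in> borel_measurable borel"
  using bounded_linear_parts
  by (auto intro!: borel_measurable_continuous_onI linear_continuous_on continuous_intros simp: mnorm_norm[abs_def])

lemma parts_bound:
  obtains K where "K > 0" "\<And>G. mnorm (sym_part G) \<le> K * norm G" "\<And>G. mnorm (dev_part G) \<le> K * norm G"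
proof -
  obtain K1 where K1: "K1 > 0" "\<And>G. norm (sym_part G) \<le> norm G * K1"
    using bounded_linear.pos_bounded[OF bounded_linear_parts(1)] by blast
  obtain K2 where K2: "K2 > 0" "\<And>G. norm (dev_part G) \<le> norm G * K2"
    using bounded_linear.pos_bounded[OF bounded_linear_parts(2)] by blast
  show ?thesis
  proof (rule that[of "K1 + K2"])
    fix G :: "real^3^3"
    have "norm G * K1 \<le> (K1 + K2) * norm G" "norm G * K2 \<le> (K1 + K2) * norm G"
      using K1(1) K2(1) by (auto simp: algebra_simps)
    then show "mnorm (sym_part G) \<le> (K1 + K2) * norm G" "mnorm (dev_part G) \<le> (K1 + K2) * norm G"
      using K1(2)[of G] K2(2)[of G] mnorm_le_norm[of "sym_part G"] mnorm_le_norm[of "dev_part G"] by linarith+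
  qed (use K1 K2 in auto)
qed

section \<open>The energy balance\<close>

lemma W1_energy_eq_powr: "q > 0 \<Longrightarrow> W1_norm q \<Omega> u powr q = W1_energy q \<Omega> u"
  by (simp add: W1_norm_energy powr_powr W1_energy_nonneg)

text \<open>For almost every time the section of \<open>G\<close> is the weak gradient of \<open>u t\<close>, so the integral of
  its cubed norm is at most the cube of the norm of \<open>u t\<close>.\<close>

lemma spacetime_gradient_integrable:
  assumes "open \<Omega>" and u: "u \<in> L3_W1_0 T \<Omega>" and G: "is_spacetime_gradient T \<Omega> u G"
  shows "integrable (lebesgue_on ({0<..<T} \<times> \<Omega>)) (\<lambda>z. norm (G (fst z) (snd z)) powr 3)"
proof (rule lebesgue_on_Tonelli)
  let ?S = "{0<..<T}"
  show "?S \<in> sets lebesgue" by simp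
  show \<Omega>: "\<Omega> \<in> sets lebesgue" using assms(1) by (intro sets_completionI_sets) simp
  show "?S \<times> \<Omega> \<in> sets lebesgue"
    using assms(1) by (intro sets_completionI_sets) (simp add: open_Times)
  have [measurable]: "(\<lambda>z. G (fst z) (snd z)) \<in> borel_measurable (lebesgue_on (?S \<times> \<Omega>))"
    using G by (simp add: is_spacetime_gradient_def case_prod_beta')
  show "(\<lambda>z. norm (G (fst z) (snd z)) powr 3) \<in> borel_measurable (lebesgue_on (?S \<times> \<Omega>))"
    by measurable
  show "integrable (lebesgue_on ?S) (\<lambda>t. W1_norm 3 \<Omega> (u t) powr 3)"
    using u by (simp add: bochner_Lp_def)
  have "AE t in lebesgue_on ?S. u t \<in> W1_0 3 \<Omega>" using u by (simp add: bochner_Lp_def)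
  moreover have "AE t in lebesgue_on ?S. is_weak_gradient \<Omega> (u t) (G t)"
    using G by (simp add: is_spacetime_gradient_def)
  ultimately show "AE t in lebesgue_on ?S. integrable (lebesgue_on \<Omega>) (\<lambda>x. norm (G (fst (t, x)) (snd (t, x))) powr 3) \<and>
      (LINT x|lebesgue_on \<Omega>. norm (G (fst (t, x)) (snd (t, x))) powr 3) \<le> W1_norm 3 \<Omega> (u t) powr 3"
  proof eventually_elim
    case (elim t)
    then have "u t \<in> W1 3 \<Omega>" by (simp add: W1_0_def)
    note wg = W1_weak_grad[OF assms(1) this]
    note cong = Lp_AE_cong[OF \<Omega> wg(2) weak_grad_AE_eq[OF assms(1) elim(2)]]
    have "(LINT x|lebesgue_on \<Omega>. norm (G t x) powr 3) \<le> W1_energy 3 \<Omega> (u t)"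
      unfolding cong(2) W1_energy_def by simp
    with cong(1) show ?case by (simp add: Lp_def W1_energy_eq_powr)
  qed
qed simp

theorem proposition1:
  fixes T :: real and \<Omega> :: "(real^3) set"
    and u_init :: "real^3 \<Rightarrow> real^3" and f :: "real \<Rightarrow> (real^3 \<Rightarrow> real^3) \<Rightarrow> real"
    and u :: "real \<Rightarrow> real^3 \<Rightarrow> real^3" and p :: "real \<Rightarrow> real^3 \<Rightarrow> real"
    and \<sigma> :: "real \<Rightarrow> real^3 \<Rightarrow> real^3^3" and G :: "real \<Rightarrow> real^3 \<Rightarrow> real^3^3"
  assumes "T > 0"
    and "open \<Omega>" and "connected \<Omega>" and "\<Omega> \<noteq> {}" and "bounded \<Omega>" and "C2_boundary \<Omega>"
    and "u_init \<in> Lp 2 \<Omega>"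
    and "f \<in> L32_dual T \<Omega>"
    and "weak_solution T \<Omega> u_init f u p \<sigma>"
    and "is_spacetime_gradient T \<Omega> u G"
  shows "AE (t, x) in lebesgue_on ({0<..<T} \<times> \<Omega>).
           frob (\<sigma> t x) (dev_part (G t x)) = 2 * p t x * mnorm (dev_part (G t x)) \<and>
           mnorm (\<sigma> t x) \<le> p t x \<and> \<sigma> t x = transpose (\<sigma> t x) \<and> trace (\<sigma> t x) = 0"
proof -
  let ?S = "{0<..<T}"
  let ?Q = "?S \<times> \<Omega>"
  have S: "?S \<in> sets lebesgue" by simp
  have \<Omega>: "\<Omega> \<in> sets lebesgue" using \<open>open \<Omega>\<close> by (intro sets_completionI_sets) simp
  have Q: "?Q \<in> sets lebesgue"
    using \<open>open \<Omega>\<close> by (intro sets_completionI_sets) (simp add: open_Times)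
  note sol = \<open>weak_solution T \<Omega> u_init f u p \<sigma>\<close>[unfolded weak_solution_def]
  have u: "u \<in> L3_W1_0 T \<Omega>"
    and p: "(\<lambda>(t, x). p t x) \<in> Lp (3/2) ?Q" and p0: "AE (t, x) in lebesgue_on ?Q. p t x \<ge> 0"
    and \<sigma>: "(\<lambda>(t, x). \<sigma> t x) \<in> Lp (3/2) ?Q"
    and \<sigma>p: "AE (t, x) in lebesgue_on ?Q. mnorm (\<sigma> t x) \<le> p t x \<and> \<sigma> t x = transpose (\<sigma> t x) \<and> trace (\<sigma> t x) = 0"
    using sol by (auto simp only:)
  obtain du where du: "du \<in> L32_dual T \<Omega>" "is_time_derivative T \<Omega> u du"
    and eqs: "\<And>\<phi> \<psi>. \<phi> \<in> L3_W1_0 T \<Omega> \<Longrightarrow> (\<lambda>(t, x). \<psi> t x) \<in> Lp (3/2) ?Q \<Longrightarrow>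
           AE t in lebesgue_on ?S.
              du t (\<phi> t)
              - (LINT x|lebesgue_on \<Omega>. p t x * trace (weak_grad \<Omega> (\<phi> t) x))
              + (LINT x|lebesgue_on \<Omega>. 2 * mnorm (sym_part (weak_grad \<Omega> (u t) x)) *
                   frob (sym_part (weak_grad \<Omega> (u t) x)) (sym_part (weak_grad \<Omega> (\<phi> t) x)))
              + (LINT x|lebesgue_on \<Omega>. frob (\<sigma> t x) (dev_part (weak_grad \<Omega> (\<phi> t) x)))
              = f t (\<phi> t) \<and>
              (LINT x|lebesgue_on \<Omega>. \<psi> t x * trace (weak_grad \<Omega> (u t) x))
              - (LINT x|lebesgue_on \<Omega>. 2 * \<psi> t x * mnorm (dev_part (weak_grad \<Omega> (u t) x)))
              + (LINT x|lebesgue_on \<Omega>. \<psi> t x * sqrt (p t x)) = 0"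
    using sol by blast
  obtain v where v: "continuous_L2_rep T \<Omega> u v" "AE x in lebesgue_on \<Omega>. v 0 x = u_init x"
    and energy: "1/2 * (LINT x|lebesgue_on \<Omega>. (norm (v T x))\<^sup>2)
        + 4 * (LINT t|lebesgue_on ?S. LINT x|lebesgue_on \<Omega>.
                 mnorm (sym_part (weak_grad \<Omega> (u t) x)) ^ 3)
        + (LINT t|lebesgue_on ?S. LINT x|lebesgue_on \<Omega>. \<bar>p t x\<bar> powr (3/2))
        \<le> 1/2 * (LINT x|lebesgue_on \<Omega>. (norm (u_init x))\<^sup>2)
        + (LINT t|lebesgue_on ?S. f t (u t))"
    using sol by blast
  note gain = time_derivative_energy[OF \<open>open \<Omega>\<close> \<open>bounded \<Omega>\<close> \<open>T > 0\<close> u du v(1)]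
  define g where "g = (\<lambda>z. G (fst z) (snd z))"
  define \<pi> where "\<pi> = (\<lambda>z. p (fst z) (snd z))"
  define s where "s = (\<lambda>z. \<sigma> (fst z) (snd z))"
  have [measurable]: "g \<in> borel_measurable (lebesgue_on ?Q)" "\<pi> \<in> borel_measurable (lebesgue_on ?Q)"
    "s \<in> borel_measurable (lebesgue_on ?Q)"
    using \<open>is_spacetime_gradient T \<Omega> u G\<close> p \<sigma>
    by (simp_all add: g_def \<pi>_def s_def is_spacetime_gradient_def Lp_def case_prod_beta')
  have [measurable]: "(\<lambda>z. sym_part (g z)) \<in> borel_measurable (lebesgue_on ?Q)"
    "(\<lambda>z. dev_part (g z)) \<in> borel_measurable (lebesgue_on ?Q)"
    by measurable
  have [measurable]: "(\<lambda>z. mnorm (sym_part (g z))) \<in> borel_measurable (lebesgue_on ?Q)"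
    "(\<lambda>z. mnorm (dev_part (g z))) \<in> borel_measurable (lebesgue_on ?Q)"
    by measurable
  have gi: "integrable (lebesgue_on ?Q) (\<lambda>z. norm (g z) powr 3)"
    unfolding g_def by (rule spacetime_gradient_integrable[OF \<open>open \<Omega>\<close> u assms(10)])
  have pi: "integrable (lebesgue_on ?Q) (\<lambda>z. \<bar>\<pi> z\<bar> powr (3/2))"
    using p by (simp add: Lp_def \<pi>_def case_prod_beta')
  have si: "integrable (lebesgue_on ?Q) (\<lambda>z. norm (s z) powr (3/2))"
    using \<sigma> by (simp add: Lp_def s_def case_prod_beta')
  obtain K where K: "K > 0" "\<And>G. mnorm (sym_part G) \<le> K * norm G" "\<And>G. mnorm (dev_part G) \<le> K * norm G"
    by (rule parts_bound) (rule that; assumption)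
  \<comment> \<open>Viscous dissipation density, and the two sides \<open>P\<close> and \<open>R\<close> of the claimed equality.\<close>
  define D where "D = (\<lambda>z. mnorm (sym_part (g z)) ^ 3)"
  define P where "P = (\<lambda>z. 2 * \<pi> z * mnorm (dev_part (g z)))"
  define R where "R = (\<lambda>z. frob (s z) (dev_part (g z)))"
  have cube: "mnorm (dev_part (g z)) powr 3 \<le> K powr 3 * norm (g z) powr 3"
    "mnorm (sym_part (g z)) powr 3 \<le> K powr 3 * norm (g z) powr 3" for z
    using powr_mono2[OF _ mnorm_nonneg K(3)[of "g z"], of 3] powr_mono2[OF _ mnorm_nonneg K(2)[of "g z"], of 3] K(1)
    by (simp_all add: powr_mult)
  have Di: "integrable (lebesgue_on ?Q) D"
  proof (rule Bochner_Integration.integrable_bound)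
    show "integrable (lebesgue_on ?Q) (\<lambda>z. K powr 3 * norm (g z) powr 3)" using gi by simp
    show "D \<in> borel_measurable (lebesgue_on ?Q)" unfolding D_def by measurable
    show "AE z in lebesgue_on ?Q. norm (D z) \<le> norm (K powr 3 * norm (g z) powr 3)"
      using cube(2) mnorm_nonneg by (intro AE_I2) (simp add: D_def powr_numeral)
  qed
  have Pi: "integrable (lebesgue_on ?Q) P"
  proof (rule Bochner_Integration.integrable_bound)
    show "integrable (lebesgue_on ?Q) (\<lambda>z. 2 * (\<bar>\<pi> z\<bar> powr (3/2) + K powr 3 * norm (g z) powr 3))"
      using gi pi by simp
    show "P \<in> borel_measurable (lebesgue_on ?Q)" unfolding P_def by measurable
    show "AE z in lebesgue_on ?Q. norm (P z) \<le> norm (2 * (\<bar>\<pi> z\<bar> powr (3/2) + K powr 3 * norm (g z) powr 3))"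
    proof (rule AE_I2)
      fix z
      have "\<bar>\<pi> z\<bar> * mnorm (dev_part (g z)) \<le> 1 * \<bar>\<pi> z\<bar> powr (3/2) + mnorm (dev_part (g z)) powr 3 / 1\<^sup>2"
        by (intro young_3_2 mnorm_nonneg) auto
      then show "norm (P z) \<le> norm (2 * (\<bar>\<pi> z\<bar> powr (3/2) + K powr 3 * norm (g z) powr 3))"
        using cube(1)[of z] mnorm_nonneg[of "dev_part (g z)"] by (simp add: P_def abs_mult)
    qed
  qed
  have Ri: "integrable (lebesgue_on ?Q) R"
  proof (rule Bochner_Integration.integrable_bound)
    show "integrable (lebesgue_on ?Q) (\<lambda>z. 2 * (norm (s z) powr (3/2) + K powr 3 * norm (g z) powr 3))"
      using gi si by simp
    show "R \<in> borel_measurable (lebesgue_on ?Q)" unfolding R_def frob_inner by measurable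
    show "AE z in lebesgue_on ?Q. norm (R z) \<le> norm (2 * (norm (s z) powr (3/2) + K powr 3 * norm (g z) powr 3))"
    proof (rule AE_I2)
      fix z
      have "norm (s z) * mnorm (dev_part (g z)) \<le> 1 * norm (s z) powr (3/2) + mnorm (dev_part (g z)) powr 3 / 1\<^sup>2"
        by (intro young_3_2 mnorm_nonneg) auto
      moreover have "\<bar>R z\<bar> \<le> 2 * mnorm (s z) * mnorm (dev_part (g z))" unfolding R_def by (rule frob_le)
      moreover have "mnorm (s z) * mnorm (dev_part (g z)) \<le> norm (s z) * mnorm (dev_part (g z))"
        by (intro mult_right_mono mnorm_le_norm mnorm_nonneg)
      ultimately show "norm (R z) \<le> norm (2 * (norm (s z) powr (3/2) + K powr 3 * norm (g z) powr 3))"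
        using cube(1)[of z] by simp
    qed
  qed
  note Fub = lebesgue_on_Fubini[OF S \<Omega> Q]
  note FD = Fub[OF Di] and FP = Fub[OF Pi] and FR = Fub[OF Ri] and Fp = Fub[OF pi]
  \<comment> \<open>Cauchy-Schwarz and the bound on \<open>\<sigma>\<close> give one inequality pointwise.\<close>
  have pos: "AE z in lebesgue_on ?Q. 0 \<le> P z - R z"
    using \<sigma>p
  proof eventually_elim
    case (elim z)
    have "R z \<le> 2 * mnorm (s z) * mnorm (dev_part (g z))"
      using frob_le[of "s z" "dev_part (g z)"] by (simp add: R_def)
    also have "\<dots> \<le> 2 * \<pi> z * mnorm (dev_part (g z))"
      using elim mnorm_nonneg[of "dev_part (g z)"]
      by (intro mult_right_mono) (auto simp: s_def \<pi>_def case_prod_beta')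
    finally show ?case by (simp add: P_def)
  qed
  \<comment> \<open>Test the momentum equation with \<open>u\<close>, the other equation with \<open>p\<close>, and add: the terms with the
    divergence of \<open>u\<close> cancel.\<close>
  have balance: "AE t in lebesgue_on ?S.
      (LINT x|lebesgue_on \<Omega>. mnorm (sym_part (weak_grad \<Omega> (u t) x)) ^ 3) = (LINT x|lebesgue_on \<Omega>. D (t, x)) \<and>
      du t (u t) + 4 * (LINT x|lebesgue_on \<Omega>. D (t, x)) + (LINT x|lebesgue_on \<Omega>. \<bar>\<pi> (t, x)\<bar> powr (3/2))
        - ((LINT x|lebesgue_on \<Omega>. P (t, x)) - (LINT x|lebesgue_on \<Omega>. R (t, x))) = f t (u t)"
  proof -
    have "AE t in lebesgue_on ?S. is_weak_gradient \<Omega> (u t) (G t)"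
      using assms(10) by (simp add: is_spacetime_gradient_def)
    moreover have "AE t in lebesgue_on ?S. AE x in lebesgue_on \<Omega>. p t x \<ge> 0"
      using AE_lebesgue_on_Times[OF S \<Omega> Q p0] by simp
    ultimately show ?thesis
      using eqs[OF u p] FD(1) FP(1) FR(1) Fp(1)
    proof eventually_elim
      case (elim t)
      have wg: "AE x in lebesgue_on \<Omega>. weak_grad \<Omega> (u t) x = g (t, x)"
        using weak_grad_AE_eq[OF \<open>open \<Omega>\<close> elim(1)] by (simp add: g_def)
      note cong = integrable_AE_eq_lebesgue_on(2)[OF \<Omega>]
      have 1: "(LINT x|lebesgue_on \<Omega>. mnorm (sym_part (weak_grad \<Omega> (u t) x)) ^ 3) = (LINT x|lebesgue_on \<Omega>. D (t, x))"
        by (rule cong[OF elim(4)]) (use wg in eventually_elim, simp add: D_def)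
      have 2: "(LINT x|lebesgue_on \<Omega>. 2 * mnorm (sym_part (weak_grad \<Omega> (u t) x)) *
                   frob (sym_part (weak_grad \<Omega> (u t) x)) (sym_part (weak_grad \<Omega> (u t) x))) = (LINT x|lebesgue_on \<Omega>. 4 * D (t, x))"
        by (rule cong) (use elim(4) in simp, use wg in eventually_elim, simp add: D_def frob_self power2_eq_square power3_eq_cube)
      have 3: "(LINT x|lebesgue_on \<Omega>. frob (\<sigma> t x) (dev_part (weak_grad \<Omega> (u t) x))) = (LINT x|lebesgue_on \<Omega>. R (t, x))"
        by (rule cong[OF elim(6)]) (use wg in eventually_elim, simp add: R_def s_def)
      have 4: "(LINT x|lebesgue_on \<Omega>. 2 * p t x * mnorm (dev_part (weak_grad \<Omega> (u t) x))) = (LINT x|lebesgue_on \<Omega>. P (t, x))"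
        by (rule cong[OF elim(5)]) (use wg in eventually_elim, simp add: P_def \<pi>_def)
      have 5: "(LINT x|lebesgue_on \<Omega>. p t x * sqrt (p t x)) = (LINT x|lebesgue_on \<Omega>. \<bar>\<pi> (t, x)\<bar> powr (3/2))"
      proof (rule cong[OF elim(7)])
        show "AE x in lebesgue_on \<Omega>. \<bar>\<pi> (t, x)\<bar> powr (3/2) = p t x * sqrt (p t x)"
          using elim(2)
        proof eventually_elim
          case (elim x)
          have "p t x powr (3/2) = \<bar>p t x\<bar> * p t x powr (1/2)"
            using powr_add[of "p t x" 1 "1/2"] by simp
          then show ?case using elim by (simp add: \<pi>_def powr_half_sqrt)
        qed
      qed
      show ?case using elim(3) unfolding 1 2 3 4 5 by simp
    qed
  qed
  define H where "H = (\<lambda>t. du t (u t) + 4 * (LINT x|lebesgue_on \<Omega>. D (t, x)) + (LINT x|lebesgue_on \<Omega>. \<bar>\<pi> (t, x)\<bar> powr (3/2))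
        - ((LINT x|lebesgue_on \<Omega>. P (t, x)) - (LINT x|lebesgue_on \<Omega>. R (t, x))))"
  have Hi: "integrable (lebesgue_on ?S) H"
    unfolding H_def using gain(1) FD(2) Fp(2) FP(2) FR(2) by simp
  have "(LINT t|lebesgue_on ?S. f t (u t)) = integral\<^sup>L (lebesgue_on ?S) H"
    by (rule integrable_AE_eq_lebesgue_on(2)[OF S Hi]) (use balance in eventually_elim, simp add: H_def)
  also have "\<dots> = (LINT t|lebesgue_on ?S. du t (u t)) + 4 * (LINT t|lebesgue_on ?S. LINT x|lebesgue_on \<Omega>. D (t, x))
      + (LINT t|lebesgue_on ?S. LINT x|lebesgue_on \<Omega>. \<bar>\<pi> (t, x)\<bar> powr (3/2))
      - ((LINT t|lebesgue_on ?S. LINT x|lebesgue_on \<Omega>. P (t, x)) - (LINT t|lebesgue_on ?S. LINT x|lebesgue_on \<Omega>. R (t, x)))"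
    unfolding H_def using gain(1) FD(2) Fp(2) FP(2) FR(2) by simp
  finally have fu: "(LINT t|lebesgue_on ?S. f t (u t)) = (LINT t|lebesgue_on ?S. du t (u t)) + 4 * (LINT t|lebesgue_on ?S. LINT x|lebesgue_on \<Omega>. D (t, x))
      + (LINT t|lebesgue_on ?S. LINT x|lebesgue_on \<Omega>. \<bar>\<pi> (t, x)\<bar> powr (3/2))
      - (integral\<^sup>L (lebesgue_on ?Q) P - integral\<^sup>L (lebesgue_on ?Q) R)"
    unfolding FP(3) FR(3) .
  have dissipation: "(LINT t|lebesgue_on ?S. LINT x|lebesgue_on \<Omega>. mnorm (sym_part (weak_grad \<Omega> (u t) x)) ^ 3)
      = (LINT t|lebesgue_on ?S. LINT x|lebesgue_on \<Omega>. D (t, x))"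
    by (rule integrable_AE_eq_lebesgue_on(2)[OF S FD(2)]) (use balance in eventually_elim, simp)
  have init: "(LINT x|lebesgue_on \<Omega>. (norm (u_init x))\<^sup>2) = (LINT x|lebesgue_on \<Omega>. (norm (v 0 x))\<^sup>2)"
  proof (rule integrable_AE_eq_lebesgue_on(2)[OF \<Omega>])
    show "integrable (lebesgue_on \<Omega>) (\<lambda>x. (norm (v 0 x))\<^sup>2)"
      using v(1) \<open>T > 0\<close> by (simp add: continuous_L2_rep_def Lp_2_iff)
    show "AE x in lebesgue_on \<Omega>. (norm (v 0 x))\<^sup>2 = (norm (u_init x))\<^sup>2"
      using v(2) by eventually_elim simp
  qed
  \<comment> \<open>The energy inequality and the one-sided chain rule exclude any excess of \<open>P\<close> over
    \<open>R\<close>.\<close>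
  have "integral\<^sup>L (lebesgue_on ?Q) P - integral\<^sup>L (lebesgue_on ?Q) R \<le> 0"
    using energy gain(2) fu unfolding dissipation init by (simp add: \<pi>_def)
  then have "(LINT z|lebesgue_on ?Q. P z - R z) \<le> 0"
    using Pi Ri by simp
  moreover have "0 \<le> (LINT z|lebesgue_on ?Q. P z - R z)"
    using pos by (rule integral_nonneg_AE)
  ultimately have "(LINT z|lebesgue_on ?Q. P z - R z) = 0" by simp
  then have "AE z in lebesgue_on ?Q. P z - R z = 0"
    using integral_nonneg_eq_0_iff_AE[OF _ pos] Pi Ri by simp
  then show ?thesis
    using \<sigma>p by eventually_elim (auto simp: P_def R_def g_def \<pi>_def s_def)
qed

end
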